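(* Let $d\in\mathbb N$, $p,\mu\in(1,\infty)$ and define $$\frac1q:=\frac{1}{4d+2}\left(\frac{3d+1}{p}+\frac{d+1}{\mu}-1\right).$$ Assume $q>\max\{2,p,\mu\}$. Then there exists $C=C(d,p,\mu)>0$ such that for every $f\in \mathrm L^2(\mathbb R^{1+2d})$ with $\nabla_v f\in \mathrm L^p(\mathbb R^{1+2d})$ and satisfying $$(\partial_t+v\cdot\nabla_x)f=\nabla_v\cdot S_0$$ in the sense of distributions for some $S_0\in \mathrm L^\mu(\mathbb R^{1+2d};\mathbb R^d)$, it holds that $$\|f\|_{\mathrm L^q(\mathbb R^{1+2d})}\le C\,\|\nabla_v f\|_{\mathrm L^p(\mathbb R^{1+2d})}^{\frac{3d+1}{4d+2}}\,\|S_0\|_{\mathrm L^\mu(\mathbb R^{1+2d})}^{\frac{d+1}{4d+2}}.$$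
   Context: Points of $\mathbb R^{1+2d}$ are written $(t,x,v)$ with $t\in\mathbb R$, $x,v\in\mathbb R^d$; $\nabla_x,\nabla_v$ denote the gradients in $x$ and $v$ (in the distributional sense). *)

theory Defs
  imports "HOL-Analysis.Analysis"
begin

text \<open>Phase space R^{1+2d}: points (t, x, v) with x, v in R^d, d = CARD('d).
  Lebesgue measure is lborel on the product type (lborel_prod).\<close>
type_synonym 'd phase = "real \<times> (real ^ 'd) \<times> (real ^ 'd)"

primrec Ck :: "nat \<Rightarrow> ('a::euclidean_space \<Rightarrow> real) \<Rightarrow> bool" where
  "Ck 0 f = continuous_on UNIV f"
| "Ck (Suc k) f = (continuous_on UNIV f \<and> (\<forall>z. f differentiable (at z)) \<and>
      (\<forall>b\<in>Basis. Ck k (\<lambda>z. frechet_derivative f (at z) b)))"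

definition test_fun :: "('a::euclidean_space \<Rightarrow> real) \<Rightarrow> bool" where
  "test_fun \<phi> \<longleftrightarrow> (\<forall>k. Ck k \<phi>) \<and> compact (closure {z. \<phi> z \<noteq> 0})"

definition in_Lp :: "real \<Rightarrow> ('a::euclidean_space \<Rightarrow> 'b::real_normed_vector) \<Rightarrow> bool" where
  "in_Lp p f \<longleftrightarrow> f \<in> borel_measurable lborel \<and> integrable lborel (\<lambda>z. norm (f z) powr p)"

definition Lp_norm :: "real \<Rightarrow> ('a::euclidean_space \<Rightarrow> 'b::real_normed_vector) \<Rightarrow> real" where
  "Lp_norm p f = (\<integral>z. norm (f z) powr p \<partial>lborel) powr (1 / p)"

definition weak_grad_v :: "('d phase \<Rightarrow> real) \<Rightarrow> ('d phase \<Rightarrow> real ^ 'd) \<Rightarrow> bool" where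
  "weak_grad_v f g \<longleftrightarrow> (\<forall>\<phi>. test_fun \<phi> \<longrightarrow> (\<forall>e :: real ^ 'd.
      (\<integral>z. f z * frechet_derivative \<phi> (at z) (0, 0, e) \<partial>lborel)
        = - (\<integral>z. (g z \<bullet> e) * \<phi> z \<partial>lborel)))"

text \<open>(d_t + v . grad_x) f = div_v S in the sense of distributions, i.e.
  - int f (d_t + v . grad_x) phi = - int S . grad_v phi for all test functions phi.
  Note (d_t + v . grad_x) phi (t,x,v) = D phi (t,x,v) (1, v, 0) and
  S . grad_v phi = D phi (t,x,v) (0, 0, S).\<close>
definition kinetic_eq :: "('d phase \<Rightarrow> real) \<Rightarrow> ('d phase \<Rightarrow> real ^ 'd) \<Rightarrow> bool" where
  "kinetic_eq f S \<longleftrightarrow> (\<forall>\<phi>. test_fun \<phi> \<longrightarrow>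
      (\<integral>z. f z * frechet_derivative \<phi> (at z) (1, snd (snd z), 0) \<partial>lborel)
        = (\<integral>z. frechet_derivative \<phi> (at z) (0, 0, S z) \<partial>lborel))"

end

theory Submission
  imports Defs
begin

text \<open>
  Put \<open>\<beta> = 1/p - 1/q\<close>, \<open>\<kappa> = 1/\<mu> - 1/q\<close>, \<open>\<alpha> = \<beta> + \<kappa>\<close>, so that \<open>(d + 1) \<alpha> + 2 d \<beta> = 1\<close>, and let \<open>f\<^sub>s\<close> be the average of
  \<open>f\<close> against a smooth bump dilated by \<open>a = a\<^sub>0 s\<^sup>\<alpha>\<close> in time, \<open>b = b\<^sub>0 s\<^sup>\<beta>\<close> in velocity and \<open>a b\<close> in space, and
  translated by the Galilean group; the constants satisfy \<open>a\<^sub>0\<^bsup>d+1\<^esup> b\<^sub>0\<^bsup>2d\<^esup> = 1\<close>, so the dilation has Jacobian \<open>s\<close>.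
  Since \<open>[\<partial>\<^sub>v, \<partial>\<^sub>t + v \<cdot> \<nabla>\<^sub>x] = \<nabla>\<^sub>x\<close>, the derivative of the kernel in \<open>s\<close> has the form
  \<open>(\<partial>\<^sub>t + v \<cdot> \<nabla>\<^sub>x) B + div\<^sub>v A\<close> with \<open>A\<close>, \<open>B\<close> smooth and compactly supported, hence the equation bounds
  \<open>\<partial>\<^sub>s f\<^sub>s\<close> by \<open>s\<^bsup>\<beta>-1\<^esup>\<close> times the local average of \<open>b\<^sub>0 \<bar>\<nabla>\<^sub>v f\<bar>\<close> plus \<open>s\<^bsup>\<kappa>-1\<^esup>\<close> times that of \<open>(a\<^sub>0/b\<^sub>0) \<bar>S\<bar>\<close>.

  If both functions have norm at most one, integrating over \<open>s \<ge> r\<close> yields \<open>\<bar>f\<^sub>r\<bar> \<le> C r\<^bsup>-1/q\<^esup>\<close>. At a level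
  \<open>\<lambda>\<close> one chooses \<open>r \<sim> \<lambda>\<^bsup>-q\<^esup>\<close>, cuts the two functions at heights \<open>\<lambda>\<^bsup>q/p\<^esup>\<close>, \<open>\<lambda>\<^bsup>q/\<mu>\<^esup>\<close>, and estimates the part of
  \<open>f - f\<^sub>r\<close> coming from large values in \<open>L\<^sup>1\<close>. This is the argument of the Marcinkiewicz interpolation
  theorem and gives the strong type bound after integration in \<open>\<lambda>\<close>. Optimising the choice of \<open>a\<^sub>0\<close>,
  \<open>b\<^sub>0\<close> turns the resulting additive inequality into the multiplicative one.
\<close>

section \<open>Smooth functions\<close>

text \<open>Nothing is known about x-derivatives of \<open>f\<close>, so the effect of changing the
  scale cannot be measured by them. It has to be written with transport derivatives and
  v-derivatives alone; after rescaling the gradient then carries the velocity scale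
  \<open>b\<close>, and \<open>S\<close> the ratio \<open>a / b\<close>. The exponents come from
  size counting. An L^p function averaged over volume s has size s^(-1/p), so the gradient
  contributes s^(\<beta>-1-1/p), and \<beta> = 1/p - 1/q makes this s^(-1-1/q); \<kappa> does the
  same for \<open>S\<close>. Requiring volume s is then the relation that defines q, and q > p, q >
  \<mu> make both exponents positive, so that the integrals over small s converge. That
  \<open>f\<close> lies in L^2 is used qualitatively: for the integrability of the pairings, for the
  vanishing of the averages as s tends to infinity, and for the integrability of the part of
  \<open>f\<close> above a positive height. Its L^2 norm enters no constant. The limit s -> 0 is
  taken in L^1 for this truncated part of \<open>f\<close>, where density arguments suffice, so that
  no differentiation theorem for the non-isotropic balls is involved.\<close>

lemma Ck_Suc_I:
  assumes "\<And>z. (f has_derivative f' z) (at z)" and "\<And>b. b \<in> Basis \<Longrightarrow> Ck k (\<lambda>z. f' z b)"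
  shows "Ck (Suc k) f"
proof -
  have "frechet_derivative f (at z) = f' z" for z
    using assms(1) by (metis frechet_derivative_at)
  moreover have "continuous_on UNIV f"
    using assms(1) has_derivative_continuous continuous_at_imp_continuous_on by blast
  ultimately show ?thesis
    using assms by (auto simp: differentiable_def)
qed

lemma Ck_Suc_D: "Ck (Suc k) f \<Longrightarrow> Ck k f"
  by (induction k arbitrary: f) auto

lemma Ck_has_derivative:
  "Ck (Suc k) f \<Longrightarrow> (f has_derivative frechet_derivative f (at z)) (at z)"
  by (simp add: frechet_derivative_works)

lemma Ck_add: "Ck k f \<Longrightarrow> Ck k g \<Longrightarrow> Ck k (\<lambda>z. f z + g z)"
proof (induction k arbitrary: f g)
  case 0
  then show ?case by (auto intro: continuous_intros)
next
  case (Suc k)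
  show ?case
    by (rule Ck_Suc_I[OF has_derivative_add[OF Ck_has_derivative[OF Suc.prems(1)] Ck_has_derivative[OF Suc.prems(2)]]])
       (use Suc in auto)
qed

lemma Ck_mult: "Ck k f \<Longrightarrow> Ck k g \<Longrightarrow> Ck k (\<lambda>z. f z * g z)"
proof (induction k arbitrary: f g)
  case 0
  then show ?case by (auto intro: continuous_intros)
next
  case (Suc k)
  show ?case
    by (rule Ck_Suc_I[OF has_derivative_mult[OF Ck_has_derivative[OF Suc.prems(1)] Ck_has_derivative[OF Suc.prems(2)]]])
       (use Suc in \<open>auto intro!: Ck_add Suc.IH Ck_Suc_D[OF Suc.prems(1)] Ck_Suc_D[OF Suc.prems(2)]\<close>)
qed

lemma Ck_const: "Ck k (\<lambda>z. c)"
proof (induction k arbitrary: c)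
  case (Suc k)
  show ?case
    by (rule Ck_Suc_I[OF has_derivative_const]) (use Suc in auto)
qed auto

lemma Ck_bounded_linear:
  assumes "bounded_linear f"
  shows "Ck k f"
proof (cases k)
  case 0
  then show ?thesis by (simp add: assms linear_continuous_on)
next
  case (Suc n)
  show ?thesis
    unfolding Suc by (rule Ck_Suc_I[OF bounded_linear.has_derivative[OF assms has_derivative_ident]]) (simp add: Ck_const)
qed

lemma Ck_inner:
  assumes "bounded_linear f" "bounded_linear g"
  shows "Ck k (\<lambda>z. f z \<bullet> g z)"
proof (cases k)
  case 0
  then show ?thesis
    by (simp add: assms linear_continuous_on continuous_on_inner)
next
  case (Suc n)
  have 1: "bounded_linear (\<lambda>z. f z \<bullet> g b + f b \<bullet> g z)" for b
    using assms by (intro bounded_linear_add bounded_linear_compose[OF bounded_linear_inner_left]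
        bounded_linear_compose[OF bounded_linear_inner_right])
  show ?thesis
    unfolding Suc
    by (rule Ck_Suc_I[OF has_derivative_inner[OF bounded_linear.has_derivative[OF assms(1) has_derivative_ident]
        bounded_linear.has_derivative[OF assms(2) has_derivative_ident]]]) (rule Ck_bounded_linear[OF 1])
qed

lemma Ck_sum: "(\<And>i. i \<in> I \<Longrightarrow> Ck k (f i)) \<Longrightarrow> Ck k (\<lambda>z. \<Sum>i\<in>I. f i z)"
  by (induction I rule: infinite_finite_induct) (auto intro: Ck_const Ck_add)

lemma Ck_affine:
  fixes L :: "'a::euclidean_space \<Rightarrow> 'b::euclidean_space"
  assumes "bounded_linear L"
  shows "Ck k f \<Longrightarrow> Ck k (\<lambda>z. f (L z + c))"
proof (induction k arbitrary: f)
  case 0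
  have "continuous_on UNIV L"
    by (simp add: assms linear_continuous_on)
  with 0 show ?case
    by (auto intro!: continuous_on_compose2[of UNIV f] continuous_intros)
next
  case (Suc k)
  let ?D = "\<lambda>z. frechet_derivative f (at z)"
  have d: "((\<lambda>z. f (L z + c)) has_derivative (\<lambda>h. ?D (L z + c) (L h))) (at z)" for z
    by (rule has_derivative_compose[OF _ Ck_has_derivative[OF Suc.prems]])
       (auto intro!: derivative_eq_intros bounded_linear.has_derivative[OF assms])
  \<comment> \<open>\<open>Ck\<close> records derivatives along \<open>Basis\<close> only, whereas
    the chain rule produces the direction \<open>L b\<close>; linearity turns it into a combination
    of basis directions with constant coefficients.\<close>
  have lin: "?D (L z + c) (L b) = (\<Sum>j\<in>Basis. (L b \<bullet> j) * ?D (L z + c) j)" for z b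
  proof -
    have "linear (?D (L z + c))"
      using Ck_has_derivative[OF Suc.prems] has_derivative_linear by blast
    then have "?D (L z + c) (\<Sum>j\<in>Basis. (L b \<bullet> j) *\<^sub>R j) = (\<Sum>j\<in>Basis. (L b \<bullet> j) * ?D (L z + c) j)"
      by (simp add: linear_sum linear_cmul)
    then show ?thesis by (simp add: euclidean_representation)
  qed
  show ?case
    by (rule Ck_Suc_I[OF d]) (use Suc in \<open>auto simp: lin intro!: Ck_sum Ck_mult Ck_const\<close>)
qed

section \<open>Flat functions and smooth bumps\<close>

definition flat :: "nat \<Rightarrow> real \<Rightarrow> real" where
  "flat n u = (if 0 < u then (1 / u) ^ n * exp (- (1 / u)) else 0)"

lemma flat_nonneg: "0 \<le> flat n u"
  by (simp add: flat_def)

text \<open>The single term of order \<open>n + k\<close> of the exponential series at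
  \<open>1 / u\<close> is at most \<open>exp (1 / u)\<close>. As \<open>k\<close> is free,
  \<open>flat n\<close> vanishes to every order at the origin.\<close>

lemma flat_le:
  assumes "0 < u"
  shows "flat n u \<le> fact (n + k) * u ^ k"
proof -
  let ?x = "1 / u"
  have "(\<lambda>i. ?x ^ i /\<^sub>R fact i) sums exp ?x"
    by (rule exp_converges)
  then have "?x ^ (n + k) /\<^sub>R fact (n + k) \<le> exp ?x"
    using sum_le_suminf[of "\<lambda>i. ?x ^ i /\<^sub>R fact i" "{n + k}"] assms by (auto simp: sums_iff)
  then have "?x ^ (n + k) / fact (n + k) \<le> exp ?x"
    by (simp add: divide_inverse mult.commute)
  then have "?x ^ n * ?x ^ k \<le> fact (n + k) * exp ?x"
    by (subst (asm) pos_divide_le_eq) (simp_all add: power_add mult.commute)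
  then have "?x ^ n * exp (- ?x) \<le> fact (n + k) * u ^ k"
    using assms by (simp add: field_simps exp_minus)
  then show ?thesis
    using assms by (simp add: flat_def)
qed

text \<open>The family is closed under differentiation, so smoothness of all its members follows
  from one induction on the order with \<open>n\<close> arbitrary.\<close>

lemma flat_has_derivative:
  "(flat n has_field_derivative (flat (n + 2) u - real n * flat (n + 1) u)) (at u)"
proof -
  consider "0 < u" | "u < 0" | "u = 0" by linarith
  then show ?thesis
  proof cases
    case 1
    have "((\<lambda>x. x ^ n * exp (- x)) has_field_derivative
        (real n * (1 / u) ^ (n - 1) - (1 / u) ^ n) * exp (- (1 / u))) (at (1 / u))"
      by (auto intro!: derivative_eq_intros simp: algebra_simps)
    moreover have "((\<lambda>u. 1 / u) has_field_derivative - ((1 / u) ^ 2)) (at u)"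
      using 1 by (auto intro!: derivative_eq_intros simp: power2_eq_square)
    ultimately have "((\<lambda>u. (1 / u) ^ n * exp (- (1 / u))) has_field_derivative
        (real n * (1 / u) ^ (n - 1) - (1 / u) ^ n) * exp (- (1 / u)) * - ((1 / u) ^ 2)) (at u)"
      by (rule DERIV_chain2)
    also have "(real n * (1 / u) ^ (n - 1) - (1 / u) ^ n) * exp (- (1 / u)) * - ((1 / u) ^ 2)
        = flat (n + 2) u - real n * flat (n + 1) u"
      using 1 by (cases n) (simp_all add: flat_def algebra_simps power2_eq_square add_divide_distrib)
    finally have "((\<lambda>u. (1 / u) ^ n * exp (- (1 / u))) has_field_derivative
        (flat (n + 2) u - real n * flat (n + 1) u)) (at u)" .
    moreover have "eventually (\<lambda>v. v \<in> {0<..}) (nhds u)"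
      using 1 by (intro eventually_nhds_in_open) auto
    ultimately show ?thesis
      by (subst DERIV_cong_ev[OF refl _ refl]) (auto elim!: eventually_mono simp: flat_def)
  next
    case 2
    have "eventually (\<lambda>v. v \<in> {..<0}) (nhds u)"
      using 2 by (intro eventually_nhds_in_open) auto
    moreover have "((\<lambda>_. 0) has_field_derivative (flat (n + 2) u - real n * flat (n + 1) u)) (at u)"
      using 2 by (auto simp: flat_def)
    ultimately show ?thesis
      by (subst DERIV_cong_ev[OF refl _ refl]) (auto elim!: eventually_mono simp: flat_def)
  next
    case 3
    \<comment> \<open>By \<open>flat_le\<close> with \<open>k = 2\<close> the difference quotient at
      the origin is O(h). The derivative there is 0, which is also what the right-hand side
      gives.\<close>
    have "((\<lambda>h. flat n h / h) \<longlongrightarrow> 0) (at 0)"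
    proof (rule Lim_null_comparison)
      have "norm (flat n h / h) \<le> fact (n + 2) * \<bar>h\<bar>" for h
      proof (cases "0 < h")
        case True
        then show ?thesis
          using flat_le[OF True, of n 2] flat_nonneg[of n h]
          by (simp add: field_simps power2_eq_square)
      next
        case False
        then have "flat n h = 0" by (simp add: flat_def)
        then show ?thesis by (simp only: div_0 norm_zero) simp
      qed
      then show "\<forall>\<^sub>F h in at 0. norm (flat n h / h) \<le> fact (n + 2) * \<bar>h\<bar>" by simp
      show "((\<lambda>h. fact (n + 2) * \<bar>h\<bar>) \<longlongrightarrow> 0) (at (0::real))"
        by (auto intro!: tendsto_eq_intros)
    qed
    then show ?thesis
      using 3 by (simp add: DERIV_def flat_def)
  qed
qed

text \<open>\<open>bump 0\<close> is the usual mollifier exp(-1/(1 - |z|^2)) without normalisation.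
  Its gradient involves \<open>bump 2\<close>, whose gradient in turn involves \<open>bump 3\<close>
  and \<open>bump 4\<close>.\<close>

definition bump :: "nat \<Rightarrow> 'a::euclidean_space \<Rightarrow> real" where
  "bump n z = flat n (1 - z \<bullet> z)"

lemma bump_has_derivative:
  "(bump n has_derivative (\<lambda>e. (bump (n + 2) z - real n * bump (n + 1) z) * (- 2 * (z \<bullet> e)))) (at z)"
proof -
  have "((\<lambda>z. 1 - z \<bullet> z) has_derivative (\<lambda>e. - 2 * (z \<bullet> e))) (at z)"
    by (auto intro!: derivative_eq_intros simp: inner_commute)
  from has_derivative_compose[OF this flat_has_derivative[unfolded has_field_derivative_def]]
  show ?thesis unfolding bump_def by (simp add: o_def)
qed

lemma Ck_bump: "Ck k (bump n)"
proof (induction k arbitrary: n)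
  case 0
  show ?case
    by (simp add: continuous_at_imp_continuous_on has_derivative_continuous[OF bump_has_derivative])
next
  case (Suc k)
  have "Ck k (\<lambda>z. (bump (n + 2) z + (- real n) * bump (n + 1) z) * ((- 2) * (z \<bullet> b)))" for b :: 'a
    by (intro Ck_mult Ck_add Suc Ck_const Ck_bounded_linear bounded_linear_inner_left)
  then show ?case
    by (intro Ck_Suc_I[OF bump_has_derivative]) simp
qed

lemma bump_nonneg: "0 \<le> bump n z"
  by (simp add: bump_def flat_nonneg)

lemma bump_eq_0: "z \<notin> ball 0 1 \<Longrightarrow> bump n z = 0"
  by (simp add: bump_def flat_def norm_eq_sqrt_inner not_less)

lemma bump_pos: "z \<in> ball 0 1 \<Longrightarrow> 0 < bump n z"
  by (simp add: bump_def flat_def norm_eq_sqrt_inner)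

lemma continuous_on_bump: "continuous_on S (bump n)"
  using Ck_bump[of 0 n] continuous_on_subset by auto

lemma test_fun_I:
  assumes "\<And>k. Ck k \<phi>" and "\<And>z. z \<notin> cball 0 r \<Longrightarrow> \<phi> z = 0"
  shows "test_fun \<phi>"
proof -
  have "{z. \<phi> z \<noteq> 0} \<subseteq> cball 0 r"
    using assms(2) by blast
  then have "closure {z. \<phi> z \<noteq> 0} \<subseteq> cball 0 r"
    by (simp add: closure_minimal)
  then show ?thesis
    using assms(1) compact_Int_closed[OF compact_cball closed_closure]
    unfolding test_fun_def by (metis inf.absorb2 inf.commute closed_closure)
qed

section \<open>Galilean translations and dilations\<close>

text \<open>The dilated point (a \<tau>, a b y, b w) translated by \<open>z\<close> on the left in
  the Galilean group. The shift of x by a \<tau> v and the factor \<open>a * b\<close> in space are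
  what makes the transport field go over into a multiple of itself.\<close>

definition kmap :: "real \<Rightarrow> real \<Rightarrow> 'd::finite phase \<Rightarrow> 'd phase \<Rightarrow> 'd phase" where
  "kmap a b z \<zeta> = (fst z + a * fst \<zeta>,
     fst (snd z) + (a * b) *\<^sub>R fst (snd \<zeta>) + (a * fst \<zeta>) *\<^sub>R snd (snd z),
     snd (snd z) + b *\<^sub>R snd (snd \<zeta>))"

definition kinv :: "real \<Rightarrow> real \<Rightarrow> 'd::finite phase \<Rightarrow> 'd phase \<Rightarrow> 'd phase" where
  "kinv a b z w = ((fst w - fst z) / a,
     (1 / (a * b)) *\<^sub>R (fst (snd w) - fst (snd z) - (fst w - fst z) *\<^sub>R snd (snd z)),
     (1 / b) *\<^sub>R (snd (snd w) - snd (snd z)))"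

lemma kinv_kmap: "0 < a \<Longrightarrow> 0 < b \<Longrightarrow> kinv a b z (kmap a b z \<zeta>) = \<zeta>"
  by (simp add: kinv_def kmap_def prod_eq_iff)

lemma kmap_kinv: "0 < a \<Longrightarrow> 0 < b \<Longrightarrow> kmap a b z (kinv a b z w) = w"
  by (simp add: kinv_def kmap_def prod_eq_iff)

lemma borel_measurable_prod_fst:
  fixes f :: "_ \<Rightarrow> 'a::euclidean_space \<times> 'b::euclidean_space"
  shows "f \<in> borel_measurable M \<Longrightarrow> (\<lambda>x. fst (f x)) \<in> borel_measurable M"
  by (erule borel_measurable_continuous_on[rotated]) (intro continuous_intros)

lemma borel_measurable_prod_snd:
  fixes f :: "_ \<Rightarrow> 'a::euclidean_space \<times> 'b::euclidean_space"
  shows "f \<in> borel_measurable M \<Longrightarrow> (\<lambda>x. snd (f x)) \<in> borel_measurable M"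
  by (erule borel_measurable_continuous_on[rotated]) (intro continuous_intros)

lemma borel_measurable_kmap [measurable]:
  assumes [measurable]: "a \<in> borel_measurable M" "b \<in> borel_measurable M"
    "z \<in> borel_measurable M" "w \<in> borel_measurable M"
  shows "(\<lambda>x. kmap (a x) (b x) (z x) (w x)) \<in> borel_measurable M"
  unfolding kmap_def
  by (intro borel_measurable_Pair borel_measurable_add borel_measurable_scaleR borel_measurable_times
      borel_measurable_prod_fst borel_measurable_prod_snd assms)

lemma borel_measurable_kinv [measurable]:
  assumes [measurable]: "a \<in> borel_measurable M" "b \<in> borel_measurable M"
    "z \<in> borel_measurable M" "w \<in> borel_measurable M"
  shows "(\<lambda>x. kinv (a x) (b x) (z x) (w x)) \<in> borel_measurable M"
  unfolding kinv_def
  by (intro borel_measurable_Pair borel_measurable_diff borel_measurable_scaleR borel_measurable_times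
      borel_measurable_divide borel_measurable_const borel_measurable_prod_fst borel_measurable_prod_snd assms)

section \<open>Change of variables in phase space\<close>

lemma nn_integral_lborel_affine:
  fixes f :: "'a::euclidean_space \<Rightarrow> ennreal"
  assumes [measurable]: "f \<in> borel_measurable borel" and "0 < c"
  shows "(\<integral>\<^sup>+x. f (t + c *\<^sub>R x) \<partial>lborel) = ennreal (1 / c ^ DIM('a)) * (\<integral>\<^sup>+x. f x \<partial>lborel)"
proof -
  have "(\<integral>\<^sup>+x. f x \<partial>lborel) = ennreal (c ^ DIM('a)) * (\<integral>\<^sup>+x. f (t + c *\<^sub>R x) \<partial>lborel)"
    using assms(2) by (subst lborel_affine[of c t])
      (simp_all add: nn_integral_density nn_integral_distr nn_integral_cmult)
  then show ?thesis
    using assms(2) by (simp add: mult.assoc[symmetric] ennreal_mult'[symmetric])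
qed

lemma nn_integral_phase:
  fixes F :: "'d::finite phase \<Rightarrow> ennreal"
  assumes [measurable]: "F \<in> borel_measurable borel"
  shows "(\<integral>\<^sup>+z. F z \<partial>lborel) = (\<integral>\<^sup>+t. \<integral>\<^sup>+v. \<integral>\<^sup>+x. F (t, x, v) \<partial>lborel \<partial>lborel \<partial>lborel)"
proof -
  have [measurable]: "F \<in> borel_measurable (lborel \<Otimes>\<^sub>M lborel)"
    by (simp add: lborel_prod)
  have "(\<integral>\<^sup>+z. F z \<partial>lborel) = (\<integral>\<^sup>+t. \<integral>\<^sup>+y. F (t, y) \<partial>lborel \<partial>lborel)"
    by (subst lborel_prod[symmetric], subst lborel.nn_integral_fst[symmetric]) simp_all
  also have "\<dots> = (\<integral>\<^sup>+t. \<integral>\<^sup>+v. \<integral>\<^sup>+x. F (t, x, v) \<partial>lborel \<partial>lborel \<partial>lborel)"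
  proof (rule nn_integral_cong)
    fix t
    have [measurable]: "(\<lambda>y. F (t, y)) \<in> borel_measurable (lborel \<Otimes>\<^sub>M lborel)"
      unfolding lborel_prod by measurable
    show "(\<integral>\<^sup>+y. F (t, y) \<partial>lborel) = (\<integral>\<^sup>+v. \<integral>\<^sup>+x. F (t, x, v) \<partial>lborel \<partial>lborel)"
      by (subst lborel_prod[symmetric], subst lborel_pair.nn_integral_snd[symmetric]) simp_all
  qed
  finally show ?thesis .
qed

lemma borel_measurable_borel_lborel:
  "borel_measurable ((borel :: 'a::euclidean_space measure) \<Otimes>\<^sub>M (lborel :: 'b::euclidean_space measure))
    = borel_measurable borel"
proof (rule measurable_cong_sets)
  have "sets ((borel :: 'a measure) \<Otimes>\<^sub>M (lborel :: 'b measure)) = sets (borel \<Otimes>\<^sub>M borel)"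
    by (rule sets_pair_measure_cong) simp_all
  then show "sets ((borel :: 'a measure) \<Otimes>\<^sub>M (lborel :: 'b measure)) = sets borel"
    by (simp only: borel_prod)
qed simp

lemmas borel_phase_intros = borel_measurable_Pair borel_measurable_prod_fst borel_measurable_prod_snd
  borel_measurable_const measurable_ident[unfolded id_def]

text \<open>The Galilean shear displaces x by an amount depending on t and v only. With x integrated
  innermost, \<open>k t v\<close> is a constant translation and disappears by translation
  invariance.\<close>

lemma nn_integral_phase_affine:
  fixes F :: "'d::finite phase \<Rightarrow> ennreal"
  assumes F[measurable]: "F \<in> borel_measurable borel" and a: "0 < a" and b: "0 < b" and c: "0 < c"
  shows "(\<integral>\<^sup>+t. \<integral>\<^sup>+v. \<integral>\<^sup>+x. F (t0 + a *\<^sub>R t, k t v + c *\<^sub>R x, v0 + b *\<^sub>R v) \<partial>lborel \<partial>lborel \<partial>lborel)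
    = ennreal (1 / (a * b ^ CARD('d) * c ^ CARD('d))) * (\<integral>\<^sup>+w. F w \<partial>lborel)"
proof -
  let ?d = "CARD('d)"
  define F1 where "F1 t v = (\<integral>\<^sup>+x. F (t, x, v) \<partial>lborel)" for t v
  define F2 where "F2 t = (\<integral>\<^sup>+v. F1 t v \<partial>lborel)" for t
  have F1: "(\<lambda>p. F1 (fst p) (snd p)) \<in> borel_measurable borel"
  proof -
    have "(\<lambda>(p, x). F (fst p, x, snd p)) \<in> borel_measurable (borel \<Otimes>\<^sub>M lborel)"
      unfolding split_beta borel_measurable_borel_lborel
      by (intro measurable_compose[OF _ F] borel_phase_intros)
    from lborel.borel_measurable_nn_integral[OF this] show ?thesis
      by (simp add: F1_def)
  qed
  have F1': "F1 t \<in> borel_measurable borel" for t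
  proof -
    have "(\<lambda>v. F1 (fst (t, v)) (snd (t, v))) \<in> borel_measurable borel"
      by (rule measurable_compose[OF _ F1]) (intro borel_phase_intros)
    then show ?thesis by simp
  qed
  have F2[measurable]: "F2 \<in> borel_measurable borel"
  proof -
    have "(\<lambda>(t, v). F1 t v) \<in> borel_measurable (borel \<Otimes>\<^sub>M lborel)"
      unfolding split_beta borel_measurable_borel_lborel by (rule F1)
    from lborel.borel_measurable_nn_integral[OF this] show ?thesis
      by (simp add: F2_def[abs_def])
  qed
  have 1: "(\<integral>\<^sup>+x. F (t, k' + c *\<^sub>R x, v) \<partial>lborel) = ennreal (1 / c ^ ?d) * F1 t v" for t v k'
    unfolding F1_def using nn_integral_lborel_affine[OF _ c, of "\<lambda>x. F (t, x, v)" k']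
    by (simp add: measurable_compose[OF _ F] borel_phase_intros)
  have 2: "(\<integral>\<^sup>+v. F1 t (v0 + b *\<^sub>R v) \<partial>lborel) = ennreal (1 / b ^ ?d) * F2 t" for t
    unfolding F2_def using nn_integral_lborel_affine[OF F1' b, of t v0] by simp
  have 3: "(\<integral>\<^sup>+t. F2 (t0 + a *\<^sub>R t) \<partial>lborel) = ennreal (1 / a) * (\<integral>\<^sup>+w. F w \<partial>lborel)"
    using nn_integral_lborel_affine[OF F2 a, of t0]
    by (simp add: nn_integral_phase[OF F] F2_def F1_def)
  have "(\<integral>\<^sup>+t. \<integral>\<^sup>+v. \<integral>\<^sup>+x. F (t0 + a *\<^sub>R t, k t v + c *\<^sub>R x, v0 + b *\<^sub>R v) \<partial>lborel \<partial>lborel \<partial>lborel)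
      = (\<integral>\<^sup>+t. \<integral>\<^sup>+v. ennreal (1 / c ^ ?d) * F1 (t0 + a *\<^sub>R t) (v0 + b *\<^sub>R v) \<partial>lborel \<partial>lborel)"
    by (simp only: 1)
  also have "\<dots> = (\<integral>\<^sup>+t. ennreal (1 / c ^ ?d) * (\<integral>\<^sup>+v. F1 (t0 + a *\<^sub>R t) (v0 + b *\<^sub>R v) \<partial>lborel) \<partial>lborel)"
    by (intro nn_integral_cong nn_integral_cmult measurable_compose[OF _ F1']) measurable
  also have "\<dots> = (\<integral>\<^sup>+t. ennreal (1 / c ^ ?d) * (ennreal (1 / b ^ ?d) * F2 (t0 + a *\<^sub>R t)) \<partial>lborel)"
    by (simp only: 2)
  also have "\<dots> = ennreal (1 / c ^ ?d) * (ennreal (1 / b ^ ?d) * (ennreal (1 / a) * (\<integral>\<^sup>+w. F w \<partial>lborel)))"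
    by (simp add: nn_integral_cmult 3[simplified])
  also have "\<dots> = ennreal (1 / (a * b ^ ?d * c ^ ?d)) * (\<integral>\<^sup>+w. F w \<partial>lborel)"
  proof -
    have "1 / (a * b ^ ?d * c ^ ?d) = 1 / c ^ ?d * (1 / b ^ ?d * (1 / a))" by simp
    then show ?thesis
      using a b c by (simp only: ennreal_mult zero_le_divide_1_iff zero_le_power less_imp_le mult_nonneg_nonneg mult.assoc)
  qed
  finally show ?thesis .
qed

lemma nn_integral_kmap:
  fixes F :: "'d::finite phase \<Rightarrow> ennreal"
  assumes F[measurable]: "F \<in> borel_measurable borel" and a: "0 < a" and b: "0 < b"
  shows "(\<integral>\<^sup>+\<zeta>. F (kmap a b z \<zeta>) \<partial>lborel)
    = ennreal (1 / (a ^ (CARD('d) + 1) * b ^ (2 * CARD('d)))) * (\<integral>\<^sup>+w. F w \<partial>lborel)"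
proof -
  have ab: "0 < a * b" using a b by simp
  have "(\<integral>\<^sup>+\<zeta>. F (kmap a b z \<zeta>) \<partial>lborel) = (\<integral>\<^sup>+t. \<integral>\<^sup>+v. \<integral>\<^sup>+x.
      F (fst z + a *\<^sub>R t, (fst (snd z) + (a * t) *\<^sub>R snd (snd z)) + (a * b) *\<^sub>R x, snd (snd z) + b *\<^sub>R v) \<partial>lborel \<partial>lborel \<partial>lborel)"
    by (subst nn_integral_phase, measurable) (simp add: kmap_def add_ac)
  also have "\<dots> = ennreal (1 / (a * b ^ CARD('d) * (a * b) ^ CARD('d))) * (\<integral>\<^sup>+w. F w \<partial>lborel)"
    by (rule nn_integral_phase_affine[OF F a b ab])
  finally show ?thesis
    by (simp add: power_mult_distrib power_mult power2_eq_square mult_ac)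
qed

text \<open>For fixed \<zeta> the map in \<open>z\<close> is a translation composed with a shear, so
  its Jacobian is one for all real \<open>a\<close>, \<open>b\<close>. The degenerate case
  \<open>a = b = 0\<close>, where the map is the identity, is used in
  \<open>nn_integral_pair_fst\<close>.\<close>

lemma nn_integral_kmap_right:
  fixes F :: "'d::finite phase \<Rightarrow> ennreal"
  assumes F[measurable]: "F \<in> borel_measurable borel"
  shows "(\<integral>\<^sup>+z. F (kmap a b z \<zeta>) \<partial>lborel) = (\<integral>\<^sup>+w. F w \<partial>lborel)"
proof -
  have "(\<integral>\<^sup>+z. F (kmap a b z \<zeta>) \<partial>lborel) = (\<integral>\<^sup>+t. \<integral>\<^sup>+v. \<integral>\<^sup>+x.
      F (a * fst \<zeta> + 1 *\<^sub>R t, ((a * b) *\<^sub>R fst (snd \<zeta>) + (a * fst \<zeta>) *\<^sub>R v) + 1 *\<^sub>R x, b *\<^sub>R snd (snd \<zeta>) + 1 *\<^sub>R v) \<partial>lborel \<partial>lborel \<partial>lborel)"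
    by (subst nn_integral_phase, measurable) (simp add: kmap_def add_ac)
  also have "\<dots> = (\<integral>\<^sup>+w. F w \<partial>lborel)"
    using nn_integral_phase_affine[OF F zero_less_one zero_less_one zero_less_one,
        of "a * fst \<zeta>" "\<lambda>t v. (a * b) *\<^sub>R fst (snd \<zeta>) + (a * fst \<zeta>) *\<^sub>R v"] by simp
  finally show ?thesis .
qed

lemma lborel_kmap:
  fixes z :: "'d::finite phase"
  assumes a: "0 < a" and b: "0 < b"
  shows "(lborel :: 'd phase measure) = density (distr lborel borel (kmap a b z)) (\<lambda>_. ennreal (a ^ (CARD('d) + 1) * b ^ (2 * CARD('d))))"
proof (rule measure_eqI)
  fix X :: "'d phase set" assume "X \<in> sets lborel"
  then have [measurable]: "X \<in> sets borel" by simp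
  let ?J = "a ^ (CARD('d) + 1) * b ^ (2 * CARD('d))"
  have "emeasure (density (distr lborel borel (kmap a b z)) (\<lambda>_. ennreal ?J)) X
      = ennreal ?J * (\<integral>\<^sup>+\<zeta>. indicator X (kmap a b z \<zeta>) \<partial>lborel)"
    by (simp add: emeasure_density nn_integral_cmult nn_integral_distr del: nn_integral_indicator)
  also have "\<dots> = (\<integral>\<^sup>+w. indicator X w \<partial>lborel)"
  proof -
    have "ennreal ?J * ennreal (1 / ?J) = 1"
      using a b by (subst ennreal_mult'[symmetric]) auto
    then show ?thesis
      by (subst nn_integral_kmap[OF _ a b]) (simp_all only: mult.assoc[symmetric] mult_1 borel_measurable_indicator \<open>X \<in> sets borel\<close>)
  qed
  finally show "emeasure lborel X = emeasure (density (distr lborel borel (kmap a b z)) (\<lambda>_. ennreal ?J)) X"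
    by simp
qed simp

lemma integral_kmap:
  fixes F :: "'d::finite phase \<Rightarrow> real"
  assumes [measurable]: "F \<in> borel_measurable borel" and a: "0 < a" and b: "0 < b"
  shows "(\<integral>w. F w \<partial>lborel) = a ^ (CARD('d) + 1) * b ^ (2 * CARD('d)) * (\<integral>\<zeta>. F (kmap a b z \<zeta>) \<partial>lborel)"
proof -
  have "0 \<le> a ^ (CARD('d) + 1) * b ^ (2 * CARD('d))"
    using a b by simp
  then show ?thesis
    by (subst lborel_kmap[OF a b, of z], subst integral_density) (simp_all add: integral_distr)
qed

section \<open>Test functions and invariance of the equations\<close>

lemma test_fun_has_derivative:
  "test_fun \<phi> \<Longrightarrow> (\<phi> has_derivative frechet_derivative \<phi> (at z)) (at z)"
  unfolding test_fun_def using Ck_has_derivative by blast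

lemma test_fun_frechet_sum:
  assumes "test_fun \<phi>"
  shows "frechet_derivative \<phi> (at z) e = (\<Sum>b\<in>Basis. (e \<bullet> b) * frechet_derivative \<phi> (at z) b)"
proof -
  have "linear (frechet_derivative \<phi> (at z))"
    using test_fun_has_derivative[OF assms] has_derivative_linear by blast
  then have "frechet_derivative \<phi> (at z) (\<Sum>b\<in>Basis. (e \<bullet> b) *\<^sub>R b)
      = (\<Sum>b\<in>Basis. (e \<bullet> b) * frechet_derivative \<phi> (at z) b)"
    by (simp add: linear_sum linear_cmul)
  then show ?thesis by (simp add: euclidean_representation)
qed

lemma test_fun_continuous: "test_fun \<phi> \<Longrightarrow> continuous_on S \<phi>"
  unfolding test_fun_def by (metis Ck.simps(1) continuous_on_subset subset_UNIV)

lemma test_fun_frechet_continuous: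
  assumes "test_fun \<phi>" "b \<in> Basis"
  shows "continuous_on S (\<lambda>z. frechet_derivative \<phi> (at z) b)"
proof -
  have "Ck (Suc 0) \<phi>" using assms(1) by (simp only: test_fun_def)
  then show ?thesis using assms(2) by (auto intro: continuous_on_subset[OF _ subset_UNIV])
qed

lemma test_fun_frechet_measurable:
  assumes "test_fun \<phi>" and [measurable]: "e \<in> borel_measurable borel"
  shows "(\<lambda>z. frechet_derivative \<phi> (at z) (e z)) \<in> borel_measurable borel"
proof -
  have [measurable]: "(\<lambda>z. frechet_derivative \<phi> (at z) b) \<in> borel_measurable borel" if "b \<in> Basis" for b
    using test_fun_frechet_continuous[OF assms(1) that] by (rule borel_measurable_continuous_onI)
  show ?thesis
    by (subst test_fun_frechet_sum[OF assms(1)]) measurable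
qed

lemma frechet_derivative_eq_0:
  assumes "\<And>z. z \<notin> cball 0 r \<Longrightarrow> \<phi> z = 0" and "z \<notin> cball 0 r"
  shows "frechet_derivative \<phi> (at z) e = (0::real)"
proof -
  have "((\<lambda>_. 0) has_derivative (\<lambda>_. 0)) (at z)" by simp
  then have "(\<phi> has_derivative (\<lambda>_. 0)) (at z)"
    by (rule has_derivative_transform_within_open[where s="- cball 0 r"]) (use assms in auto)
  then show ?thesis
    by (metis frechet_derivative_at)
qed

lemma test_fun_frechet_bound:
  fixes \<phi> :: "'a::euclidean_space \<Rightarrow> real"
  assumes "test_fun \<phi>" and "\<And>z. z \<notin> cball 0 1 \<Longrightarrow> \<phi> z = 0"
  obtains K where "0 \<le> K" "\<And>z e. \<bar>frechet_derivative \<phi> (at z) e\<bar> \<le> K * norm e * indicator (cball 0 1) z"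
proof -
  have "\<exists>K. \<forall>z\<in>cball 0 1. \<bar>frechet_derivative \<phi> (at z) b\<bar> \<le> K" if "b \<in> Basis" for b
  proof -
    have "compact ((\<lambda>z. frechet_derivative \<phi> (at z) b) ` cball 0 1)"
      by (intro compact_continuous_image test_fun_frechet_continuous assms that compact_cball)
    then show ?thesis
      using compact_imp_bounded bounded_iff by (metis (no_types, lifting) imageI real_norm_def)
  qed
  then obtain K where K: "\<And>b z. b \<in> Basis \<Longrightarrow> z \<in> cball 0 1 \<Longrightarrow> \<bar>frechet_derivative \<phi> (at z) b\<bar> \<le> K b"
    by metis
  have "\<bar>frechet_derivative \<phi> (at z) e\<bar> \<le> (\<Sum>b\<in>Basis. \<bar>K b\<bar>) * norm e * indicator (cball 0 1) z" for z e
  proof (cases "z \<in> cball 0 1")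
    case True
    have "\<bar>frechet_derivative \<phi> (at z) e\<bar> \<le> (\<Sum>b\<in>Basis. \<bar>(e \<bullet> b) * frechet_derivative \<phi> (at z) b\<bar>)"
      by (subst test_fun_frechet_sum[OF assms(1)]) (rule sum_abs)
    also have "\<dots> \<le> (\<Sum>b\<in>Basis. norm e * \<bar>K b\<bar>)"
      unfolding abs_mult
      by (intro sum_mono mult_mono Basis_le_norm) (use K[OF _ True] in \<open>auto intro: order_trans[OF _ abs_ge_self]\<close>)
    finally show ?thesis
      using True by (simp add: sum_distrib_left mult.commute)
  next
    case False
    then show ?thesis using frechet_derivative_eq_0[OF assms(2)] by simp
  qed
  then show ?thesis
    using that[of "\<Sum>b\<in>Basis. \<bar>K b\<bar>"] by (simp add: sum_nonneg)
qed

text \<open>The linear part of the affine map \<open>kinv a b z\<close>, hence its derivative at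
  every point; of \<open>z\<close> only the velocity enters.\<close>

definition klin :: "real \<Rightarrow> real \<Rightarrow> real ^ 'd \<Rightarrow> 'd::finite phase \<Rightarrow> 'd phase" where
  "klin a b v w = (fst w / a, (1 / (a * b)) *\<^sub>R (fst (snd w) - fst w *\<^sub>R v), (1 / b) *\<^sub>R snd (snd w))"

lemma bounded_linear_klin: "bounded_linear (klin a b v)"
  unfolding linear_conv_bounded_linear[symmetric]
  by (rule linearI) (simp_all add: klin_def algebra_simps add_divide_distrib)

lemma kinv_eq_klin: "kinv a b z w = klin a b (snd (snd z)) w + kinv a b z 0"
  by (simp add: kinv_def klin_def algebra_simps diff_divide_distrib)

lemma continuous_on_kmap: "continuous_on S (kmap a b z)"
  unfolding kmap_def by (intro continuous_intros)

lemma test_fun_kinv: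
  assumes "test_fun \<phi>" "0 < a" "0 < b"
  shows "test_fun (\<lambda>w. \<phi> (kinv a b z w))"
proof -
  have "{w. \<phi> (kinv a b z w) \<noteq> 0} \<subseteq> kmap a b z ` closure {\<zeta>. \<phi> \<zeta> \<noteq> 0}"
  proof
    fix w assume "w \<in> {w. \<phi> (kinv a b z w) \<noteq> 0}"
    then have "kinv a b z w \<in> closure {\<zeta>. \<phi> \<zeta> \<noteq> 0}"
      using closure_subset by fast
    then show "w \<in> kmap a b z ` closure {\<zeta>. \<phi> \<zeta> \<noteq> 0}"
      using kmap_kinv[OF assms(2,3), of z w] by (metis imageI)
  qed
  moreover have c: "compact (kmap a b z ` closure {\<zeta>. \<phi> \<zeta> \<noteq> 0})"
    using assms(1) by (intro compact_continuous_image continuous_on_kmap) (simp add: test_fun_def)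
  ultimately have "closure {w. \<phi> (kinv a b z w) \<noteq> 0} \<subseteq> kmap a b z ` closure {\<zeta>. \<phi> \<zeta> \<noteq> 0}"
    by (simp add: closure_minimal compact_imp_closed)
  then have "compact (closure {w. \<phi> (kinv a b z w) \<noteq> 0})"
    using c by (metis closed_closure closed_Int_compact inf.absorb1)
  moreover have "Ck k (\<lambda>w. \<phi> (kinv a b z w))" for k
    using Ck_affine[OF bounded_linear_klin, of k \<phi> a b "snd (snd z)" "kinv a b z 0"] assms(1)
    by (simp only: kinv_eq_klin[symmetric] test_fun_def)
  ultimately show ?thesis by (simp add: test_fun_def)
qed

lemma frechet_derivative_kinv:
  assumes "test_fun \<phi>" "0 < a" "0 < b"
  shows "frechet_derivative (\<lambda>w. \<phi> (kinv a b z w)) (at (kmap a b z \<zeta>)) e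
    = frechet_derivative \<phi> (at \<zeta>) (klin a b (snd (snd z)) e)"
proof -
  let ?w = "kmap a b z \<zeta>"
  have *: "kinv a b z = (\<lambda>w. klin a b (snd (snd z)) w + kinv a b z 0)"
    by (rule ext) (rule kinv_eq_klin)
  have "(kinv a b z has_derivative klin a b (snd (snd z))) (at ?w)"
    by (subst *) (intro has_derivative_add_const bounded_linear_imp_has_derivative bounded_linear_klin)
  moreover have "(\<phi> has_derivative frechet_derivative \<phi> (at \<zeta>)) (at (kinv a b z ?w))"
    using test_fun_has_derivative[OF assms(1)] by (simp add: kinv_kmap assms)
  ultimately have "((\<lambda>w. \<phi> (kinv a b z w)) has_derivative (\<lambda>e. frechet_derivative \<phi> (at \<zeta>) (klin a b (snd (snd z)) e))) (at ?w)"
    by (rule has_derivative_compose)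
  from frechet_derivative_at[OF this] show ?thesis by metis
qed

lemma frechet_scale:
  "test_fun \<phi> \<Longrightarrow> frechet_derivative \<phi> (at z) (c *\<^sub>R e) = c * frechet_derivative \<phi> (at z) e"
  using linear_cmul[OF has_derivative_linear[OF test_fun_has_derivative]] by (metis real_scaleR_def)

text \<open>The relation for \<open>f\<close> is tested with \<phi> composed with
  \<open>kinv\<close>. A v-derivative of this composition carries the factor 1/b, and the Jacobian
  cancels from both sides.\<close>

lemma weak_grad_v_kmap:
  assumes f[measurable]: "f \<in> borel_measurable borel" and g[measurable]: "g \<in> borel_measurable borel"
    and w: "weak_grad_v f g" and ab: "0 < a" "0 < b"
  shows "weak_grad_v (\<lambda>\<zeta>. f (kmap a b z \<zeta>)) (\<lambda>\<zeta>. b *\<^sub>R g (kmap a b z \<zeta>))"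
  unfolding weak_grad_v_def
proof (intro allI impI)
  fix \<phi> :: "'a phase \<Rightarrow> real" and e :: "real ^ 'a" assume \<phi>: "test_fun \<phi>"
  let ?\<phi> = "\<lambda>w. \<phi> (kinv a b z w)"
  let ?J = "a ^ (CARD('a) + 1) * b ^ (2 * CARD('a))"
  note t = test_fun_kinv[OF \<phi> ab, of z]
  have J: "?J \<noteq> 0" using ab by simp
  have [measurable]: "(\<lambda>w. frechet_derivative ?\<phi> (at w) (0, 0, e)) \<in> borel_measurable borel"
    by (rule test_fun_frechet_measurable[OF t]) simp
  have [measurable]: "\<phi> \<in> borel_measurable borel"
    using test_fun_continuous[OF \<phi>] by (rule borel_measurable_continuous_onI)
  have k: "klin a b (snd (snd z)) (0, 0, e) = (1 / b) *\<^sub>R (0, 0, e)"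
    by (simp add: klin_def)
  have e1: "(\<integral>w. f w * frechet_derivative ?\<phi> (at w) (0, 0, e) \<partial>lborel) = - (\<integral>w. (g w \<bullet> e) * ?\<phi> w \<partial>lborel)"
    using w t unfolding weak_grad_v_def by blast
  have e2: "(\<integral>w. f w * frechet_derivative ?\<phi> (at w) (0, 0, e) \<partial>lborel)
      = ?J * ((\<integral>\<zeta>. f (kmap a b z \<zeta>) * frechet_derivative \<phi> (at \<zeta>) (0, 0, e) \<partial>lborel) / b)"
    by (subst integral_kmap[OF _ ab, of _ z], measurable)
       (simp only: frechet_derivative_kinv[OF \<phi> ab] k frechet_scale[OF \<phi>], simp)
  have e3: "(\<integral>w. (g w \<bullet> e) * ?\<phi> w \<partial>lborel) = ?J * (\<integral>\<zeta>. (g (kmap a b z \<zeta>) \<bullet> e) * \<phi> \<zeta> \<partial>lborel)"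
    by (subst integral_kmap[OF _ ab, of _ z], measurable) (simp only: kinv_kmap[OF ab])
  from e1[unfolded e2 e3] have "(\<integral>\<zeta>. f (kmap a b z \<zeta>) * frechet_derivative \<phi> (at \<zeta>) (0, 0, e) \<partial>lborel) / b
      = - (\<integral>\<zeta>. (g (kmap a b z \<zeta>) \<bullet> e) * \<phi> \<zeta> \<partial>lborel)"
    using J by (simp only: mult_minus_right[symmetric] mult_cancel_left simp_thms)
  then show "(\<integral>\<zeta>. f (kmap a b z \<zeta>) * frechet_derivative \<phi> (at \<zeta>) (0, 0, e) \<partial>lborel)
      = - (\<integral>\<zeta>. (b *\<^sub>R g (kmap a b z \<zeta>) \<bullet> e) * \<phi> \<zeta> \<partial>lborel)"
    using ab(2) by (simp add: field_simps)
qed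

lemma kinetic_eq_kmap:
  assumes f[measurable]: "f \<in> borel_measurable borel" and S[measurable]: "S \<in> borel_measurable borel"
    and w: "kinetic_eq f S" and ab: "0 < a" "0 < b"
  shows "kinetic_eq (\<lambda>\<zeta>. f (kmap a b z \<zeta>)) (\<lambda>\<zeta>. (a / b) *\<^sub>R S (kmap a b z \<zeta>))"
  unfolding kinetic_eq_def
proof (intro allI impI)
  fix \<phi> :: "'a phase \<Rightarrow> real" assume \<phi>: "test_fun \<phi>"
  let ?\<phi> = "\<lambda>w. \<phi> (kinv a b z w)"
  let ?J = "a ^ (CARD('a) + 1) * b ^ (2 * CARD('a))"
  note t = test_fun_kinv[OF \<phi> ab, of z]
  have J: "?J \<noteq> 0" using ab by simp
  have [measurable]: "(\<lambda>w. frechet_derivative ?\<phi> (at w) (1, snd (snd w), 0)) \<in> borel_measurable borel"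
    by (rule test_fun_frechet_measurable[OF t]) (intro borel_phase_intros)
  have [measurable]: "(\<lambda>w. frechet_derivative ?\<phi> (at w) (0, 0, S w)) \<in> borel_measurable borel"
    by (rule test_fun_frechet_measurable[OF t]) measurable
  \<comment> \<open>The transport field at the image point is pulled back to 1/a times the transport
    field at \<zeta>: the shift by the base velocity removes that velocity, and the space factor
    \<open>a * b\<close> matches time \<open>a\<close> with velocity \<open>b\<close>.\<close>
  have k1: "klin a b (snd (snd z)) (1, snd (snd (kmap a b z \<zeta>)), 0) = (1 / a) *\<^sub>R (1, snd (snd \<zeta>), 0)" for \<zeta>
    using ab by (simp add: klin_def kmap_def)
  have k2: "klin a b (snd (snd z)) (0, 0, e) = (1 / b) *\<^sub>R (0, 0, e)" for e
    by (simp add: klin_def)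
  have k3: "frechet_derivative \<phi> (at \<zeta>) (0, 0, (a / b) *\<^sub>R e) = (a / b) * frechet_derivative \<phi> (at \<zeta>) (0, 0, e)" for \<zeta> e
    using frechet_scale[OF \<phi>, of \<zeta> "a / b" "(0, 0, e)"] by simp
  have e1: "(\<integral>w. f w * frechet_derivative ?\<phi> (at w) (1, snd (snd w), 0) \<partial>lborel)
      = (\<integral>w. frechet_derivative ?\<phi> (at w) (0, 0, S w) \<partial>lborel)"
    using w t unfolding kinetic_eq_def by blast
  have e2: "(\<integral>w. f w * frechet_derivative ?\<phi> (at w) (1, snd (snd w), 0) \<partial>lborel)
      = ?J * ((\<integral>\<zeta>. f (kmap a b z \<zeta>) * frechet_derivative \<phi> (at \<zeta>) (1, snd (snd \<zeta>), 0) \<partial>lborel) / a)"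
    by (subst integral_kmap[OF _ ab, of _ z], measurable)
       (simp only: frechet_derivative_kinv[OF \<phi> ab] k1 frechet_scale[OF \<phi>], simp)
  have e3: "(\<integral>w. frechet_derivative ?\<phi> (at w) (0, 0, S w) \<partial>lborel)
      = ?J * ((\<integral>\<zeta>. frechet_derivative \<phi> (at \<zeta>) (0, 0, S (kmap a b z \<zeta>)) \<partial>lborel) / b)"
    by (subst integral_kmap[OF _ ab, of _ z], measurable)
       (simp only: frechet_derivative_kinv[OF \<phi> ab] k2 frechet_scale[OF \<phi>], simp)
  from e1[unfolded e2 e3] have "(\<integral>\<zeta>. f (kmap a b z \<zeta>) * frechet_derivative \<phi> (at \<zeta>) (1, snd (snd \<zeta>), 0) \<partial>lborel) / a
      = (\<integral>\<zeta>. frechet_derivative \<phi> (at \<zeta>) (0, 0, S (kmap a b z \<zeta>)) \<partial>lborel) / b"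
    using J by (simp only: mult_cancel_left simp_thms)
  then show "(\<integral>\<zeta>. f (kmap a b z \<zeta>) * frechet_derivative \<phi> (at \<zeta>) (1, snd (snd \<zeta>), 0) \<partial>lborel)
      = (\<integral>\<zeta>. frechet_derivative \<phi> (at \<zeta>) (0, 0, (a / b) *\<^sub>R S (kmap a b z \<zeta>)) \<partial>lborel)"
    using ab by (simp add: k3 field_simps)
qed

section \<open>The kernel identity\<close>

text \<open>Write \<open>(\<tau>, y, w)\<close> for the variables, \<open>X = \<partial>\<^sub>\<tau> + w \<cdot> \<nabla>\<^sub>y\<close> and \<open>\<phi> = bump 0\<close>. Then
  \<open>kL = - \<partial>\<^sub>\<tau> (\<alpha> \<tau> \<phi>) - div\<^sub>y ((\<alpha> + \<beta>) y \<phi>) - div\<^sub>w (\<beta> w \<phi>)\<close> generates the dilations of \<open>\<phi>\<close>. Substituting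
  \<open>\<partial>\<^sub>\<tau> F = X F - div\<^sub>y (w F)\<close> and \<open>\<partial>\<^bsub>y\<^sub>i\<^esub> F = \<partial>\<^bsub>w\<^sub>i\<^esub> (X F) - X (\<partial>\<^bsub>w\<^sub>i\<^esub> F)\<close> gives \<open>kL = X kB + div\<^sub>w kA\<close>;
  \<open>kA \<alpha> \<beta> e\<close> is the component of the vector field in direction \<open>e\<close>.\<close>

definition kB :: "real \<Rightarrow> real \<Rightarrow> 'd::finite phase \<Rightarrow> real" where
  "kB \<alpha> \<beta> z = - ((real CARD('d) + 1) * \<alpha>) * fst z * bump 0 z
     - 2 * ((\<alpha> + \<beta>) * (snd (snd z) \<bullet> fst (snd z)) - \<alpha> * fst z * (snd (snd z) \<bullet> snd (snd z))) * bump 2 z"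

definition kA :: "real \<Rightarrow> real \<Rightarrow> real ^ 'd \<Rightarrow> 'd::finite phase \<Rightarrow> real" where
  "kA \<alpha> \<beta> e z = - 2 * \<beta> * bump 0 z * (snd (snd z) \<bullet> e)
     + 2 * (fst z + snd (snd z) \<bullet> fst (snd z)) * bump 2 z
       * ((\<alpha> + \<beta>) * (fst (snd z) \<bullet> e) - \<alpha> * fst z * (snd (snd z) \<bullet> e))"

definition kL :: "real \<Rightarrow> real \<Rightarrow> 'd::finite phase \<Rightarrow> real" where
  "kL \<alpha> \<beta> z = - bump 0 z + 2 * bump 2 z * (\<alpha> * (fst z)\<^sup>2
     + (\<alpha> + \<beta>) * (fst (snd z) \<bullet> fst (snd z)) + \<beta> * (snd (snd z) \<bullet> snd (snd z)))"

lemma Ck_diff: "Ck k f \<Longrightarrow> Ck k g \<Longrightarrow> Ck k (\<lambda>z. f z - g z)"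
  using Ck_add[of k f "\<lambda>z. (- 1) * g z"] Ck_mult[OF Ck_const, of k g "- 1"] by simp

lemma bounded_linear_snd_snd: "bounded_linear (\<lambda>z. snd (snd z))"
  by (intro bounded_linear_compose[OF bounded_linear_snd] bounded_linear_snd)

lemma bounded_linear_fst_snd: "bounded_linear (\<lambda>z. fst (snd z))"
  by (intro bounded_linear_compose[OF bounded_linear_fst] bounded_linear_snd)

lemmas Ck_phase = Ck_diff Ck_add Ck_mult Ck_const Ck_bump Ck_inner Ck_bounded_linear[OF bounded_linear_fst]
  bounded_linear_snd_snd bounded_linear_fst_snd

lemma Ck_inner_const: "bounded_linear f \<Longrightarrow> Ck k (\<lambda>z. f z \<bullet> e)"
  by (intro Ck_bounded_linear bounded_linear_compose[OF bounded_linear_inner_left])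

lemma kB_eq_0: "z \<notin> cball 0 1 \<Longrightarrow> kB \<alpha> \<beta> z = 0"
  by (simp add: kB_def bump_eq_0)

lemma kA_eq_0: "z \<notin> cball 0 1 \<Longrightarrow> kA \<alpha> \<beta> e z = 0"
  by (simp add: kA_def bump_eq_0)

lemma test_fun_kB: "test_fun (kB \<alpha> \<beta>)"
  by (rule test_fun_I[OF _ kB_eq_0]) (unfold kB_def, intro Ck_phase)

lemma test_fun_kA: "test_fun (kA \<alpha> \<beta> e)"
  by (rule test_fun_I[OF _ kA_eq_0]) (unfold kA_def, intro Ck_diff Ck_add Ck_mult Ck_const Ck_bump Ck_inner_const Ck_inner Ck_bounded_linear[OF bounded_linear_fst]
  bounded_linear_snd_snd bounded_linear_fst_snd)

text \<open>Along the transport field t, y, w have derivatives 1, w, 0. Hence |z|^2 / 2 has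
  derivative t + y \<bullet> w, and the polynomial factor of \<open>bump 2\<close> reduces to
  \<beta> (w \<bullet> w) because its two \<alpha>-terms cancel.\<close>

lemma frechet_kB:
  fixes z :: "'d::finite phase"
  defines "t \<equiv> fst z" and "y \<equiv> fst (snd z)" and "w \<equiv> snd (snd z)"
  shows "frechet_derivative (kB \<alpha> \<beta>) (at z) (1, w, 0) =
     - ((real CARD('d) + 1) * \<alpha>) * (bump 0 z - 2 * t * bump 2 z * (t + y \<bullet> w))
     - 2 * (\<beta> * (w \<bullet> w) * bump 2 z
       - 2 * ((\<alpha> + \<beta>) * (w \<bullet> y) - \<alpha> * t * (w \<bullet> w)) * (bump 4 z - 2 * bump 3 z) * (t + y \<bullet> w))"
proof -
  have b0: "(bump 0 has_derivative (\<lambda>e. bump 2 z * (- 2 * (z \<bullet> e)))) (at z)"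
    using bump_has_derivative[of 0 z] by (simp add: numeral_2_eq_2)
  have b2: "(bump 2 has_derivative (\<lambda>e. (bump 4 z - 2 * bump 3 z) * (- 2 * (z \<bullet> e)))) (at z)"
    using bump_has_derivative[of 2 z] by (simp add: eval_nat_numeral)
  have "(kB \<alpha> \<beta> has_derivative (\<lambda>e.
      - ((real CARD('d) + 1) * \<alpha>) * (fst e * bump 0 z + t * (bump 2 z * (- 2 * (z \<bullet> e))))
     - 2 * (((\<alpha> + \<beta>) * (snd (snd e) \<bullet> y + w \<bullet> fst (snd e)) - \<alpha> * (fst e * (w \<bullet> w) + t * (2 * (w \<bullet> snd (snd e))))) * bump 2 z
       + ((\<alpha> + \<beta>) * (w \<bullet> y) - \<alpha> * t * (w \<bullet> w)) * ((bump 4 z - 2 * bump 3 z) * (- 2 * (z \<bullet> e)))))) (at z)"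
    unfolding kB_def t_def y_def w_def
    by (rule derivative_eq_intros b0 b2 refl | simp add: algebra_simps inner_commute)+
  from frechet_derivative_at[OF this] have "frechet_derivative (kB \<alpha> \<beta>) (at z) = (\<lambda>e.
      - ((real CARD('d) + 1) * \<alpha>) * (fst e * bump 0 z + t * (bump 2 z * (- 2 * (z \<bullet> e))))
     - 2 * (((\<alpha> + \<beta>) * (snd (snd e) \<bullet> y + w \<bullet> fst (snd e)) - \<alpha> * (fst e * (w \<bullet> w) + t * (2 * (w \<bullet> snd (snd e))))) * bump 2 z
       + ((\<alpha> + \<beta>) * (w \<bullet> y) - \<alpha> * t * (w \<bullet> w)) * ((bump 4 z - 2 * bump 3 z) * (- 2 * (z \<bullet> e)))))"
    by simp
  moreover have "z \<bullet> (1, w, 0) = t + y \<bullet> w"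
    by (simp add: inner_prod_def t_def y_def)
  ultimately show ?thesis
    by (simp add: algebra_simps)
qed

text \<open>Only w varies here. The factor t + y \<bullet> w has derivative y \<bullet> e, and the
  last factor has derivative -\<alpha> t because \<open>e\<close> is a unit vector.\<close>

lemma frechet_kA:
  fixes z :: "'d::finite phase"
  defines "t \<equiv> fst z" and "y \<equiv> fst (snd z)" and "w \<equiv> snd (snd z)"
  assumes "e \<bullet> e = 1"
  shows "frechet_derivative (kA \<alpha> \<beta> e) (at z) (0, 0, e) =
     - 2 * \<beta> * (bump 0 z - 2 * bump 2 z * ((w \<bullet> e) * (w \<bullet> e)))
     + 2 * (bump 2 z * ((y \<bullet> e) * ((\<alpha> + \<beta>) * (y \<bullet> e) - \<alpha> * t * (w \<bullet> e)))
       - 2 * (t + y \<bullet> w) * (bump 4 z - 2 * bump 3 z) * ((w \<bullet> e) * ((\<alpha> + \<beta>) * (y \<bullet> e) - \<alpha> * t * (w \<bullet> e)))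
       - \<alpha> * t * (t + y \<bullet> w) * bump 2 z)"
proof -
  have b0: "(bump 0 has_derivative (\<lambda>e. bump 2 z * (- 2 * (z \<bullet> e)))) (at z)"
    using bump_has_derivative[of 0 z] by (simp add: numeral_2_eq_2)
  have b2: "(bump 2 has_derivative (\<lambda>e. (bump 4 z - 2 * bump 3 z) * (- 2 * (z \<bullet> e)))) (at z)"
    using bump_has_derivative[of 2 z] by (simp add: eval_nat_numeral)
  have "(kA \<alpha> \<beta> e has_derivative (\<lambda>h.
      - 2 * \<beta> * ((bump 2 z * (- 2 * (z \<bullet> h))) * (w \<bullet> e) + bump 0 z * (snd (snd h) \<bullet> e))
      + 2 * ((fst h + snd (snd h) \<bullet> y + w \<bullet> fst (snd h)) * bump 2 z * ((\<alpha> + \<beta>) * (y \<bullet> e) - \<alpha> * t * (w \<bullet> e))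
        + (t + w \<bullet> y) * ((bump 4 z - 2 * bump 3 z) * (- 2 * (z \<bullet> h))) * ((\<alpha> + \<beta>) * (y \<bullet> e) - \<alpha> * t * (w \<bullet> e))
        + (t + w \<bullet> y) * bump 2 z * ((\<alpha> + \<beta>) * (fst (snd h) \<bullet> e) - \<alpha> * (fst h * (w \<bullet> e) + t * (snd (snd h) \<bullet> e)))))) (at z)"
    unfolding kA_def t_def y_def w_def
    by (rule derivative_eq_intros b0 b2 refl | simp add: algebra_simps inner_commute)+
  from frechet_derivative_at[OF this] have "frechet_derivative (kA \<alpha> \<beta> e) (at z) = (\<lambda>h.
      - 2 * \<beta> * ((bump 2 z * (- 2 * (z \<bullet> h))) * (w \<bullet> e) + bump 0 z * (snd (snd h) \<bullet> e))
      + 2 * ((fst h + snd (snd h) \<bullet> y + w \<bullet> fst (snd h)) * bump 2 z * ((\<alpha> + \<beta>) * (y \<bullet> e) - \<alpha> * t * (w \<bullet> e))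
        + (t + w \<bullet> y) * ((bump 4 z - 2 * bump 3 z) * (- 2 * (z \<bullet> h))) * ((\<alpha> + \<beta>) * (y \<bullet> e) - \<alpha> * t * (w \<bullet> e))
        + (t + w \<bullet> y) * bump 2 z * ((\<alpha> + \<beta>) * (fst (snd h) \<bullet> e) - \<alpha> * (fst h * (w \<bullet> e) + t * (snd (snd h) \<bullet> e)))))"
    by simp
  moreover have "z \<bullet> (0, 0, e) = w \<bullet> e"
    by (simp add: inner_prod_def w_def)
  ultimately show ?thesis
    using assms(4) by (simp add: algebra_simps inner_commute)
qed

lemma kernel_identity:
  fixes z :: "'d::finite phase"
  assumes "(real CARD('d) + 1) * \<alpha> + 2 * real CARD('d) * \<beta> = 1"
  shows "frechet_derivative (kB \<alpha> \<beta>) (at z) (1, snd (snd z), 0)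
    + (\<Sum>e\<in>Basis. frechet_derivative (kA \<alpha> \<beta> e) (at z) (0, 0, e)) = kL \<alpha> \<beta> z"
proof -
  define t y w where "t = fst z" and "y = fst (snd z)" and "w = snd (snd z)"
  \<comment> \<open>The polynomial in \<open>kB\<close> is w \<bullet> c and that in
    \<open>kA\<close> is (t + y \<bullet> w) (c \<bullet> e), so the sum over \<open>e\<close>
    collapses into the inner products w \<bullet> w, y \<bullet> c and w \<bullet> c.\<close>
  define c where "c = (\<alpha> + \<beta>) *\<^sub>R y - (\<alpha> * t) *\<^sub>R w"
  let ?d = "real CARD('d)"
  have "(\<Sum>e\<in>Basis. frechet_derivative (kA \<alpha> \<beta> e) (at z) (0, 0, e))
    = (\<Sum>e\<in>Basis. - 2 * \<beta> * (bump 0 z - 2 * bump 2 z * ((w \<bullet> e) * (w \<bullet> e)))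
     + 2 * (bump 2 z * ((y \<bullet> e) * (c \<bullet> e))
       - 2 * (t + y \<bullet> w) * (bump 4 z - 2 * bump 3 z) * ((w \<bullet> e) * (c \<bullet> e))
       - \<alpha> * t * (t + y \<bullet> w) * bump 2 z))"
    by (intro sum.cong refl, subst frechet_kA) (simp_all add: t_def y_def w_def c_def inner_diff_left)
  also have "\<dots> = - 2 * \<beta> * (?d * bump 0 z - 2 * bump 2 z * (w \<bullet> w))
     + 2 * (bump 2 z * (y \<bullet> c) - 2 * (t + y \<bullet> w) * (bump 4 z - 2 * bump 3 z) * (w \<bullet> c)
       - ?d * (\<alpha> * t * (t + y \<bullet> w) * bump 2 z))"
    by (simp only: sum.distrib sum_subtractf sum_distrib_left[symmetric] sum_constant DIM_cart DIM_real
        euclidean_inner[symmetric]) simp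
  finally have A: "(\<Sum>e\<in>Basis. frechet_derivative (kA \<alpha> \<beta> e) (at z) (0, 0, e)) = \<dots>" .
  \<comment> \<open>The terms with \<open>K\<close>, which stem from differentiating
    \<open>bump 2\<close>, cancel between the two contributions. The coefficient of \<open>X\<close>
    is -((d+1) \<alpha> + 2 d \<beta>), that is -1 by homogeneity.\<close>
  have "- ((?d + 1) * \<alpha>) * (X - 2 * t * E2 * N) - 2 * (\<beta> * W * E2 - 2 * U * K * N)
     + (- 2 * \<beta> * (?d * X - 2 * E2 * W) + 2 * (E2 * V - 2 * N * K * U - ?d * (\<alpha> * t * N * E2)))
     = - X + 2 * E2 * (\<alpha> * t * N + V + \<beta> * W)" for X E2 N W U K V
  proof -
    have 1: "(?d + 1) * \<alpha> = 1 - 2 * ?d * \<beta>" using assms by simp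
    have "1 - 2 * ?d * \<beta> - \<alpha> = ?d * \<alpha>"
      using assms by (simp add: algebra_simps)
    then have 2: "?d * (\<alpha> * t * N * E2) = (1 - 2 * ?d * \<beta> - \<alpha>) * (t * N * E2)"
      by (simp only:)
    show ?thesis unfolding 1 2 by (simp add: algebra_simps)
  qed
  from this[of "bump 0 z" "bump 2 z" "t + y \<bullet> w" "w \<bullet> w" "w \<bullet> c" "bump 4 z - 2 * bump 3 z" "y \<bullet> c"]
  show ?thesis
    unfolding A frechet_kB kL_def
    by (simp add: c_def t_def[symmetric] y_def[symmetric] w_def[symmetric] inner_diff_right inner_commute
        power2_eq_square algebra_simps)
qed

section \<open>Local averages\<close>

text \<open>The kernel is left unnormalised; its mass is the constant \<open>c0\<close> below, and
  small-scale averages approach \<open>c0 * f\<close>.\<close>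

definition kmean :: "real \<Rightarrow> real \<Rightarrow> ('d::finite phase \<Rightarrow> real) \<Rightarrow> 'd phase \<Rightarrow> real" where
  "kmean a b f z = (\<integral>\<zeta>. f (kmap a b z \<zeta>) * bump 0 \<zeta> \<partial>lborel)"

text \<open>With values in \<open>ennreal\<close>, so that averages of arbitrary measurable
  nonnegative functions make sense and Tonelli applies without integrability conditions.\<close>

definition kavg :: "real \<Rightarrow> real \<Rightarrow> ('d::finite phase \<Rightarrow> ennreal) \<Rightarrow> 'd phase \<Rightarrow> ennreal" where
  "kavg a b G z = (\<integral>\<^sup>+\<zeta>. G (kmap a b z \<zeta>) * indicator (cball 0 1) \<zeta> \<partial>lborel)"

lemma cball_phase_borel [measurable]: "cball (0 :: 'd::finite phase) 1 \<in> sets borel"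
  by simp

lemma young_split:
  fixes x c r :: real
  assumes "0 \<le> x" "0 < c" "1 \<le> r"
  shows "x \<le> c + c powr (1 - r) * x powr r"
proof (cases "x \<le> c")
  case True
  then show ?thesis using assms by (simp add: add_increasing2)
next
  case False
  then have "x = x powr (1 - r) * x powr r"
    using assms by (simp add: powr_add[symmetric])
  also have "\<dots> \<le> c powr (1 - r) * x powr r"
    using assms False by (intro mult_right_mono powr_mono2') auto
  finally show ?thesis using assms by linarith
qed

text \<open>A substitute for Hoelder's inequality: \<open>young_split\<close> is applied pointwise
  under the average, and the free parameter \<open>c\<close> is left to be balanced against the
  volume.\<close>

lemma kavg_le:
  fixes f :: "'d::finite phase \<Rightarrow> 'b::real_normed_vector"
  assumes f: "in_Lp r f" and r: "1 \<le> r" and c: "0 < c" and ab: "0 < a" "0 < b"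
  shows "kavg a b (\<lambda>z. ennreal (norm (f z))) z \<le> ennreal (c * measure lborel (cball 0 1 :: 'd phase set)
    + c powr (1 - r) / (a ^ (CARD('d) + 1) * b ^ (2 * CARD('d))) * (\<integral>z. norm (f z) powr r \<partial>lborel))"
proof -
  let ?J = "a ^ (CARD('d) + 1) * b ^ (2 * CARD('d))"
  let ?B = "cball 0 1 :: 'd phase set"
  let ?I = "\<integral>z. norm (f z) powr r \<partial>lborel"
  have [measurable]: "f \<in> borel_measurable borel" and i: "integrable lborel (\<lambda>z. norm (f z) powr r)"
    using f by (auto simp: in_Lp_def)
  have I0: "0 \<le> ?I" by simp
  have fin: "emeasure lborel ?B = ennreal (measure lborel ?B)"
    using emeasure_bounded_finite[of ?B] by (intro emeasure_eq_ennreal_measure) auto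
  have "kavg a b (\<lambda>z. ennreal (norm (f z))) z
      \<le> (\<integral>\<^sup>+\<zeta>. ennreal c * indicator ?B \<zeta> + ennreal (c powr (1 - r)) * ennreal (norm (f (kmap a b z \<zeta>)) powr r) \<partial>lborel)"
    unfolding kavg_def
  proof (rule nn_integral_mono)
    fix \<zeta>
    have "ennreal (norm (f (kmap a b z \<zeta>))) \<le> ennreal c + ennreal (c powr (1 - r)) * ennreal (norm (f (kmap a b z \<zeta>)) powr r)"
      using young_split[OF norm_ge_zero c r, of "f (kmap a b z \<zeta>)"] c
      by (simp add: ennreal_mult''[symmetric] ennreal_plus[symmetric] del: ennreal_plus)
    then show "ennreal (norm (f (kmap a b z \<zeta>))) * indicator ?B \<zeta>
        \<le> ennreal c * indicator ?B \<zeta> + ennreal (c powr (1 - r)) * ennreal (norm (f (kmap a b z \<zeta>)) powr r)"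
      by (auto simp: indicator_def)
  qed
  also have "\<dots> = ennreal c * ennreal (measure lborel ?B)
      + ennreal (c powr (1 - r)) * (\<integral>\<^sup>+\<zeta>. ennreal (norm (f (kmap a b z \<zeta>)) powr r) \<partial>lborel)"
  proof -
    have [measurable]: "?B \<in> sets lborel" by simp
    show ?thesis
      by (subst nn_integral_add) (simp_all add: nn_integral_cmult nn_integral_cmult_indicator fin)
  qed
  also have "(\<integral>\<^sup>+\<zeta>. ennreal (norm (f (kmap a b z \<zeta>)) powr r) \<partial>lborel)
      = ennreal (1 / ?J) * ennreal ?I"
    by (subst nn_integral_kmap[OF _ ab, of "\<lambda>w. ennreal (norm (f w) powr r)"])
       (simp_all add: nn_integral_eq_integral[OF i])
  also have "ennreal c * ennreal (measure lborel ?B) + ennreal (c powr (1 - r)) * (ennreal (1 / ?J) * ennreal ?I)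
      = ennreal (c * measure lborel ?B + c powr (1 - r) / ?J * ?I)"
  proof -
    have "ennreal (c powr (1 - r)) * (ennreal (1 / ?J) * ennreal ?I) = ennreal (c powr (1 - r) * (1 / ?J * ?I))"
      using I0 ab c by (simp only: ennreal_mult zero_le_divide_1_iff zero_le_power zero_le_mult_iff less_imp_le powr_ge_zero simp_thms)
    moreover have "0 \<le> c powr (1 - r) * (1 / ?J * ?I)"
      using I0 ab by simp
    ultimately show ?thesis
      using c by (subst ennreal_plus) (simp_all add: ennreal_mult)
  qed
  finally show ?thesis .
qed

lemma integrable_kmap_mult:
  fixes f :: "'d::finite phase \<Rightarrow> real"
  assumes f: "in_Lp r f" and r: "1 \<le> r" and ab: "0 < a" "0 < b"
    and [measurable]: "\<psi> \<in> borel_measurable borel" and \<psi>: "\<And>\<zeta>. \<bar>\<psi> \<zeta>\<bar> \<le> C * indicator (cball 0 1) \<zeta>"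
  shows "integrable lborel (\<lambda>\<zeta>. f (kmap a b z \<zeta>) * \<psi> \<zeta>)"
    and "(\<integral>\<^sup>+\<zeta>. ennreal (norm (f (kmap a b z \<zeta>) * \<psi> \<zeta>)) \<partial>lborel) \<le> ennreal C * kavg a b (\<lambda>z. ennreal (norm (f z))) z"
proof -
  have [measurable]: "f \<in> borel_measurable borel"
    using f by (auto simp: in_Lp_def)
  have C: "0 \<le> C" using \<psi>[of 0] by simp
  show *: "(\<integral>\<^sup>+\<zeta>. ennreal (norm (f (kmap a b z \<zeta>) * \<psi> \<zeta>)) \<partial>lborel) \<le> ennreal C * kavg a b (\<lambda>z. ennreal (norm (f z))) z"
  proof -
    have "ennreal C * kavg a b (\<lambda>z. ennreal (norm (f z))) z
        = (\<integral>\<^sup>+\<zeta>. ennreal C * (ennreal (norm (f (kmap a b z \<zeta>))) * indicator (cball 0 1) \<zeta>) \<partial>lborel)"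
      unfolding kavg_def
      by (intro nn_integral_cmult[symmetric] borel_measurable_times borel_measurable_indicator cball_phase_borel) measurable
    moreover have "(\<integral>\<^sup>+\<zeta>. ennreal (norm (f (kmap a b z \<zeta>) * \<psi> \<zeta>)) \<partial>lborel)
        \<le> (\<integral>\<^sup>+\<zeta>. ennreal C * (ennreal (norm (f (kmap a b z \<zeta>))) * indicator (cball 0 1) \<zeta>) \<partial>lborel)"
    proof (rule nn_integral_mono)
      fix \<zeta>
      have "norm (f (kmap a b z \<zeta>) * \<psi> \<zeta>) \<le> \<bar>f (kmap a b z \<zeta>)\<bar> * (C * indicator (cball 0 1) \<zeta>)"
        unfolding real_norm_def abs_mult by (intro mult_left_mono \<psi>) simp
      then have "ennreal (norm (f (kmap a b z \<zeta>) * \<psi> \<zeta>)) \<le> ennreal (C * (norm (f (kmap a b z \<zeta>)) * indicator (cball 0 1) \<zeta>))"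
        by (intro ennreal_leI) (simp add: mult_ac)
      also have "\<dots> = ennreal C * (ennreal (norm (f (kmap a b z \<zeta>))) * indicator (cball 0 1) \<zeta>)"
        using C by (simp add: ennreal_mult ennreal_indicator)
      finally show "ennreal (norm (f (kmap a b z \<zeta>) * \<psi> \<zeta>))
          \<le> ennreal C * (ennreal (norm (f (kmap a b z \<zeta>))) * indicator (cball 0 1) \<zeta>)" .
    qed
    ultimately show ?thesis by simp
  qed
  also have "\<dots> < \<infinity>"
  proof -
    have "kavg a b (\<lambda>z. ennreal (norm (f z))) z < \<infinity>"
      using kavg_le[OF f r zero_less_one ab, of z] by (rule order.strict_trans1) simp
    then show ?thesis by (simp add: ennreal_mult_less_top)
  qed
  finally show "integrable lborel (\<lambda>\<zeta>. f (kmap a b z \<zeta>) * \<psi> \<zeta>)"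
    by (intro integrableI_bounded) simp_all
qed

text \<open>True for every \<open>f\<close>, since the Bochner integral of a non-integrable function
  is 0.\<close>

lemma ennreal_abs_integral_le:
  "ennreal \<bar>\<integral>x. f x \<partial>M\<bar> \<le> (\<integral>\<^sup>+x. ennreal \<bar>f x\<bar> \<partial>M)"
proof (cases "integrable M f")
  case True
  then show ?thesis using integral_norm_bound_ennreal[OF True] by simp
qed (simp add: not_integrable_integral_eq)

lemma kernel_bounds:
  obtains K where "0 \<le> K"
    and "\<And>e \<zeta>. e \<in> Basis \<Longrightarrow> \<bar>kA \<alpha> \<beta> e \<zeta>\<bar> \<le> K * indicator (cball 0 1) (\<zeta> :: 'd::finite phase)"
    and "\<And>e \<zeta>. \<bar>frechet_derivative (kB \<alpha> \<beta>) (at \<zeta>) (0, 0, e)\<bar> \<le> K * norm e * indicator (cball 0 1) (\<zeta> :: 'd phase)"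
proof -
  obtain K1 where K1: "0 \<le> K1" "\<And>z e. \<bar>frechet_derivative (kB \<alpha> \<beta>) (at (z :: 'd phase)) e\<bar> \<le> K1 * norm e * indicator (cball 0 1) z"
    using test_fun_frechet_bound[OF test_fun_kB kB_eq_0] by metis
  have "\<exists>C. \<forall>\<zeta> \<in> cball 0 1. \<bar>kA \<alpha> \<beta> e (\<zeta> :: 'd phase)\<bar> \<le> C" for e
  proof -
    have "compact (kA \<alpha> \<beta> e ` (cball 0 1 :: 'd phase set))"
      by (intro compact_continuous_image test_fun_continuous test_fun_kA compact_cball)
    then show ?thesis
      using compact_imp_bounded bounded_iff by (metis (no_types, lifting) imageI real_norm_def)
  qed
  then obtain C where C: "\<And>e \<zeta>. \<zeta> \<in> cball 0 1 \<Longrightarrow> \<bar>kA \<alpha> \<beta> e (\<zeta> :: 'd phase)\<bar> \<le> C e"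
    by metis
  let ?K = "K1 + (\<Sum>e\<in>Basis. \<bar>C e\<bar>)"
  have S: "\<bar>C e\<bar> \<le> (\<Sum>e\<in>Basis. \<bar>C e\<bar>)" if "e \<in> Basis" for e
    using that by (intro member_le_sum) auto
  have S0: "0 \<le> (\<Sum>e\<in>Basis. \<bar>C e\<bar>)" by (rule sum_nonneg) simp
  show ?thesis
  proof (rule that[of ?K])
    show "0 \<le> ?K" using K1(1) S0 by simp
    fix e :: "real ^ 'd" and \<zeta> :: "'d phase"
    show "\<bar>kA \<alpha> \<beta> e \<zeta>\<bar> \<le> ?K * indicator (cball 0 1) \<zeta>" if e: "e \<in> Basis"
    proof (cases "\<zeta> \<in> cball 0 1")
      case True
      have "\<bar>kA \<alpha> \<beta> e \<zeta>\<bar> \<le> ?K" using C[OF True, of e] S[OF e] K1(1) by linarith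
      then show ?thesis using True by simp
    next
      case False
      then show ?thesis using kA_eq_0[OF False] by simp
    qed
    have "\<bar>frechet_derivative (kB \<alpha> \<beta>) (at \<zeta>) (0, 0, e)\<bar> \<le> K1 * norm e * indicator (cball 0 1) \<zeta>"
      using K1(2)[of \<zeta> "(0, 0, e)"] by (simp add: norm_Pair)
    also have "\<dots> \<le> ?K * norm e * indicator (cball 0 1) \<zeta>"
      by (intro mult_right_mono) (use S0 in auto)
    finally show "\<bar>frechet_derivative (kB \<alpha> \<beta>) (at \<zeta>) (0, 0, e)\<bar> \<le> ?K * norm e * indicator (cball 0 1) \<zeta>" .
  qed
qed

lemma kL_bound:
  obtains C where "0 \<le> C" "\<And>\<zeta>. \<bar>kL \<alpha> \<beta> (\<zeta> :: 'd::finite phase)\<bar> \<le> C * indicator (cball 0 1) \<zeta>"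
proof -
  have c: "continuous_on (cball 0 1 :: 'd phase set) (kL \<alpha> \<beta>)"
    unfolding kL_def by (intro continuous_intros continuous_on_bump)
  have "compact (kL \<alpha> \<beta> ` (cball 0 1 :: 'd phase set))"
    by (intro compact_continuous_image c compact_cball)
  then obtain C where C: "\<And>\<zeta>. \<zeta> \<in> cball 0 1 \<Longrightarrow> \<bar>kL \<alpha> \<beta> (\<zeta> :: 'd phase)\<bar> \<le> C"
    using compact_imp_bounded bounded_iff by (metis (no_types, lifting) imageI real_norm_def)
  have "0 \<le> C" using C[of 0] by simp
  moreover have "\<bar>kL \<alpha> \<beta> \<zeta>\<bar> \<le> C * indicator (cball 0 1) \<zeta>" for \<zeta> :: "'d phase"
  proof (cases "\<zeta> \<in> cball 0 1")
    case False
    then show ?thesis by (simp add: kL_def bump_eq_0)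
  qed (use C in auto)
  ultimately show ?thesis using that by blast
qed

text \<open>Both equations are transported to the variable \<zeta>, where the kernels no longer
  depend on the scale. \<open>kB\<close> tests the kinetic equation, each \<open>kA\<close> tests
  the weak gradient in its own direction, and all scale dependence sits in the factors
  \<open>b\<close> and \<open>a / b\<close>.\<close>

lemma kL_pairing_le:
  fixes f :: "'d::finite phase \<Rightarrow> real"
  assumes f: "in_Lp 2 f" and g: "in_Lp p g" and S: "in_Lp \<mu> S" and p: "1 \<le> p" "1 \<le> \<mu>"
    and wg: "weak_grad_v f g" and kin: "kinetic_eq f S" and ab: "0 < a" "0 < b"
    and hom: "(real CARD('d) + 1) * \<alpha> + 2 * real CARD('d) * \<beta> = 1"
    and K: "\<And>e \<zeta>. e \<in> Basis \<Longrightarrow> \<bar>kA \<alpha> \<beta> e \<zeta>\<bar> \<le> K * indicator (cball 0 1) (\<zeta> :: 'd::finite phase)"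
    "\<And>e \<zeta>. \<bar>frechet_derivative (kB \<alpha> \<beta>) (at \<zeta>) (0, 0, e)\<bar> \<le> K * norm e * indicator (cball 0 1) (\<zeta> :: 'd phase)"
  shows "ennreal \<bar>\<integral>\<zeta>. f (kmap a b z \<zeta>) * kL \<alpha> \<beta> \<zeta> \<partial>lborel\<bar>
    \<le> ennreal (K * real CARD('d) * b) * kavg a b (\<lambda>z. ennreal (norm (g z))) z
      + ennreal (K * (a / b)) * kavg a b (\<lambda>z. ennreal (norm (S z))) z"
proof -
  have [measurable]: "f \<in> borel_measurable borel" "g \<in> borel_measurable borel" "S \<in> borel_measurable borel"
    and fgS: "f \<in> borel_measurable borel" "g \<in> borel_measurable borel" "S \<in> borel_measurable borel"
    using f g S by (auto simp: in_Lp_def)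
  have K0: "0 \<le> K"
    using order_trans[OF abs_ge_zero K(1)[of _ 0]] nonempty_Basis by fastforce
  let ?f = "\<lambda>\<zeta>. f (kmap a b z \<zeta>)" and ?g = "\<lambda>\<zeta>. g (kmap a b z \<zeta>)" and ?S = "\<lambda>\<zeta>. S (kmap a b z \<zeta>)"
  let ?B = "cball 0 1 :: 'd phase set"
  let ?DB = "\<lambda>\<zeta>. frechet_derivative (kB \<alpha> \<beta>) (at \<zeta>) (1, snd (snd \<zeta>), 0)"
  let ?DA = "\<lambda>e \<zeta>. frechet_derivative (kA \<alpha> \<beta> e) (at \<zeta>) (0, 0, e)"
  have iB: "integrable lborel (\<lambda>\<zeta>. ?f \<zeta> * ?DB \<zeta>)"
  proof -
    obtain C where C: "0 \<le> C" "\<And>z e. \<bar>frechet_derivative (kB \<alpha> \<beta>) (at (z :: 'd phase)) e\<bar> \<le> C * norm e * indicator (cball 0 1) z"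
      using test_fun_frechet_bound[OF test_fun_kB kB_eq_0] by metis
    \<comment> \<open>The transport field grows linearly in the velocity, but on the unit ball its
      norm is at most 1 + 1.\<close>
    have "\<bar>?DB \<zeta>\<bar> \<le> C * 2 * indicator ?B \<zeta>" for \<zeta>
    proof (cases "\<zeta> \<in> ?B")
      case True
      have "norm (1 :: real, snd (snd \<zeta>), 0 :: real ^ 'd) \<le> norm (1::real) + norm (snd (snd \<zeta>), 0 :: real ^ 'd)"
        by (rule norm_Pair_le)
      also have "\<dots> \<le> 1 + norm \<zeta>"
        using norm_snd_le[of "snd (snd \<zeta>)" "fst (snd \<zeta>)"] norm_snd_le[of "snd \<zeta>" "fst \<zeta>"]
        by simp
      finally have "norm (1 :: real, snd (snd \<zeta>), 0 :: real ^ 'd) \<le> 2"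
        using True by simp
      then have "C * norm (1 :: real, snd (snd \<zeta>), 0 :: real ^ 'd) \<le> C * 2"
        using C(1) by (rule mult_left_mono)
      then show ?thesis
        using C(2)[of \<zeta> "(1, snd (snd \<zeta>), 0)"] True by simp
    next
      case False
      then show ?thesis using C(2)[of \<zeta> "(1, snd (snd \<zeta>), 0)"] by simp
    qed
    moreover have "?DB \<in> borel_measurable borel"
      by (rule test_fun_frechet_measurable[OF test_fun_kB]) (intro borel_phase_intros)
    ultimately show ?thesis
      by (intro integrable_kmap_mult(1)[OF f _ ab]) auto
  qed
  have iA: "integrable lborel (\<lambda>\<zeta>. ?f \<zeta> * ?DA e \<zeta>)" if e: "e \<in> Basis" for e
  proof -
    obtain C where C: "0 \<le> C" "\<And>z h. \<bar>frechet_derivative (kA \<alpha> \<beta> e) (at (z :: 'd phase)) h\<bar> \<le> C * norm h * indicator (cball 0 1) z"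
      using test_fun_frechet_bound[OF test_fun_kA kA_eq_0] by metis
    have "norm (0 :: real, 0 :: real ^ 'd, e) = 1"
      using e by (simp add: norm_Pair)
    then have "\<bar>?DA e \<zeta>\<bar> \<le> C * indicator ?B \<zeta>" for \<zeta>
      using C(2)[of \<zeta> "(0, 0, e)"] by simp
    moreover have "?DA e \<in> borel_measurable borel"
      by (rule test_fun_frechet_measurable[OF test_fun_kA]) (intro borel_phase_intros)
    ultimately show ?thesis
      by (intro integrable_kmap_mult(1)[OF f _ ab]) auto
  qed
  have "(\<integral>\<zeta>. ?f \<zeta> * kL \<alpha> \<beta> \<zeta> \<partial>lborel) = (\<integral>\<zeta>. ?f \<zeta> * ?DB \<zeta> + (\<Sum>e\<in>Basis. ?f \<zeta> * ?DA e \<zeta>) \<partial>lborel)"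
    by (simp only: kernel_identity[OF hom, symmetric] distrib_left sum_distrib_left)
  also have "\<dots> = (\<integral>\<zeta>. ?f \<zeta> * ?DB \<zeta> \<partial>lborel) + (\<Sum>e\<in>Basis. \<integral>\<zeta>. ?f \<zeta> * ?DA e \<zeta> \<partial>lborel)"
    by (simp add: Bochner_Integration.integral_add Bochner_Integration.integral_sum iA iB)
  also have "(\<integral>\<zeta>. ?f \<zeta> * ?DB \<zeta> \<partial>lborel) = (\<integral>\<zeta>. frechet_derivative (kB \<alpha> \<beta>) (at \<zeta>) (0, 0, (a / b) *\<^sub>R ?S \<zeta>) \<partial>lborel)"
    using kinetic_eq_kmap[OF fgS(1,3) kin ab, of z] test_fun_kB[of \<alpha> \<beta>] unfolding kinetic_eq_def by blast
  also have "(\<Sum>e\<in>Basis. \<integral>\<zeta>. ?f \<zeta> * ?DA e \<zeta> \<partial>lborel) = (\<Sum>e\<in>Basis. - (\<integral>\<zeta>. ((b *\<^sub>R ?g \<zeta>) \<bullet> e) * kA \<alpha> \<beta> e \<zeta> \<partial>lborel))"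
    using weak_grad_v_kmap[OF fgS(1,2) wg ab, of z] test_fun_kA unfolding weak_grad_v_def
    by (intro sum.cong refl) blast
  finally have eq: "(\<integral>\<zeta>. ?f \<zeta> * kL \<alpha> \<beta> \<zeta> \<partial>lborel)
      = (\<integral>\<zeta>. frechet_derivative (kB \<alpha> \<beta>) (at \<zeta>) (0, 0, (a / b) *\<^sub>R ?S \<zeta>) \<partial>lborel)
        + (\<Sum>e\<in>Basis. - (\<integral>\<zeta>. ((b *\<^sub>R ?g \<zeta>) \<bullet> e) * kA \<alpha> \<beta> e \<zeta> \<partial>lborel))" .
  have bS: "ennreal \<bar>\<integral>\<zeta>. frechet_derivative (kB \<alpha> \<beta>) (at \<zeta>) (0, 0, (a / b) *\<^sub>R ?S \<zeta>) \<partial>lborel\<bar>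
      \<le> ennreal (K * (a / b)) * kavg a b (\<lambda>z. ennreal (norm (S z))) z"
  proof -
    have "ennreal \<bar>\<integral>\<zeta>. frechet_derivative (kB \<alpha> \<beta>) (at \<zeta>) (0, 0, (a / b) *\<^sub>R ?S \<zeta>) \<partial>lborel\<bar>
        \<le> (\<integral>\<^sup>+\<zeta>. ennreal (K * (a / b)) * (ennreal (norm (?S \<zeta>)) * indicator ?B \<zeta>) \<partial>lborel)"
    proof (rule order_trans[OF ennreal_abs_integral_le], rule nn_integral_mono)
      fix \<zeta>
      have "\<bar>frechet_derivative (kB \<alpha> \<beta>) (at \<zeta>) (0, 0, (a / b) *\<^sub>R ?S \<zeta>)\<bar> \<le> K * (a / b) * (norm (?S \<zeta>) * indicator ?B \<zeta>)"
        using K(2)[of \<zeta> "(a / b) *\<^sub>R ?S \<zeta>"] ab by (simp add: mult_ac)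
      then have "ennreal \<bar>frechet_derivative (kB \<alpha> \<beta>) (at \<zeta>) (0, 0, (a / b) *\<^sub>R ?S \<zeta>)\<bar> \<le> ennreal (K * (a / b) * (norm (?S \<zeta>) * indicator ?B \<zeta>))"
        by (rule ennreal_leI)
      also have "\<dots> = ennreal (K * (a / b)) * (ennreal (norm (?S \<zeta>)) * indicator ?B \<zeta>)"
        using K0 ab by (subst ennreal_mult) (simp_all add: ennreal_mult ennreal_indicator)
      finally show "ennreal \<bar>frechet_derivative (kB \<alpha> \<beta>) (at \<zeta>) (0, 0, (a / b) *\<^sub>R ?S \<zeta>)\<bar>
          \<le> ennreal (K * (a / b)) * (ennreal (norm (?S \<zeta>)) * indicator ?B \<zeta>)" .
    qed
    also have "\<dots> = ennreal (K * (a / b)) * kavg a b (\<lambda>z. ennreal (norm (S z))) z"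
      unfolding kavg_def
      by (intro nn_integral_cmult borel_measurable_times borel_measurable_indicator) measurable
    finally show ?thesis .
  qed
  have bg: "ennreal \<bar>\<integral>\<zeta>. ((b *\<^sub>R ?g \<zeta>) \<bullet> e) * kA \<alpha> \<beta> e \<zeta> \<partial>lborel\<bar>
      \<le> ennreal (K * b) * kavg a b (\<lambda>z. ennreal (norm (g z))) z" if e: "e \<in> Basis" for e
  proof -
    have "ennreal \<bar>\<integral>\<zeta>. ((b *\<^sub>R ?g \<zeta>) \<bullet> e) * kA \<alpha> \<beta> e \<zeta> \<partial>lborel\<bar>
        \<le> (\<integral>\<^sup>+\<zeta>. ennreal (K * b) * (ennreal (norm (?g \<zeta>)) * indicator ?B \<zeta>) \<partial>lborel)"
    proof (rule order_trans[OF ennreal_abs_integral_le], rule nn_integral_mono)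
      fix \<zeta>
      have "\<bar>(b *\<^sub>R ?g \<zeta>) \<bullet> e\<bar> \<le> b * norm (?g \<zeta>)"
        using Basis_le_norm[OF e, of "?g \<zeta>"] ab by (simp add: abs_mult mult_left_mono)
      then have "\<bar>((b *\<^sub>R ?g \<zeta>) \<bullet> e) * kA \<alpha> \<beta> e \<zeta>\<bar> \<le> (b * norm (?g \<zeta>)) * (K * indicator ?B \<zeta>)"
        unfolding abs_mult using K(1)[OF e, of \<zeta>] ab by (intro mult_mono) auto
      then have "ennreal \<bar>((b *\<^sub>R ?g \<zeta>) \<bullet> e) * kA \<alpha> \<beta> e \<zeta>\<bar> \<le> ennreal (K * b * (norm (?g \<zeta>) * indicator ?B \<zeta>))"
        by (intro ennreal_leI) (simp add: mult_ac)
      also have "\<dots> = ennreal (K * b) * (ennreal (norm (?g \<zeta>)) * indicator ?B \<zeta>)"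
        using K0 ab by (subst ennreal_mult) (simp_all add: ennreal_mult ennreal_indicator)
      finally show "ennreal \<bar>((b *\<^sub>R ?g \<zeta>) \<bullet> e) * kA \<alpha> \<beta> e \<zeta>\<bar>
          \<le> ennreal (K * b) * (ennreal (norm (?g \<zeta>)) * indicator ?B \<zeta>)" .
    qed
    also have "\<dots> = ennreal (K * b) * kavg a b (\<lambda>z. ennreal (norm (g z))) z"
      unfolding kavg_def
      by (intro nn_integral_cmult borel_measurable_times borel_measurable_indicator) measurable
    finally show ?thesis .
  qed
  have "ennreal \<bar>\<integral>\<zeta>. ?f \<zeta> * kL \<alpha> \<beta> \<zeta> \<partial>lborel\<bar>
      \<le> ennreal (\<bar>\<integral>\<zeta>. frechet_derivative (kB \<alpha> \<beta>) (at \<zeta>) (0, 0, (a / b) *\<^sub>R ?S \<zeta>) \<partial>lborel\<bar>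
        + (\<Sum>e\<in>Basis. \<bar>\<integral>\<zeta>. ((b *\<^sub>R ?g \<zeta>) \<bullet> e) * kA \<alpha> \<beta> e \<zeta> \<partial>lborel\<bar>))"
    unfolding eq
    by (intro ennreal_leI order_trans[OF abs_triangle_ineq] add_mono order_refl order_trans[OF sum_abs]) simp
  also have "\<dots> = ennreal \<bar>\<integral>\<zeta>. frechet_derivative (kB \<alpha> \<beta>) (at \<zeta>) (0, 0, (a / b) *\<^sub>R ?S \<zeta>) \<partial>lborel\<bar>
        + (\<Sum>e\<in>Basis. ennreal \<bar>\<integral>\<zeta>. ((b *\<^sub>R ?g \<zeta>) \<bullet> e) * kA \<alpha> \<beta> e \<zeta> \<partial>lborel\<bar>)"
    by (subst ennreal_plus) (simp_all add: sum_nonneg sum_ennreal)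
  also have "\<dots> \<le> ennreal (K * (a / b)) * kavg a b (\<lambda>z. ennreal (norm (S z))) z
      + (\<Sum>e\<in>(Basis :: (real ^ 'd) set). ennreal (K * b) * kavg a b (\<lambda>z. ennreal (norm (g z))) z)"
    by (intro add_mono bS sum_mono bg)
  also have "(\<Sum>e\<in>(Basis :: (real ^ 'd) set). ennreal (K * b) * kavg a b (\<lambda>z. ennreal (norm (g z))) z)
      = ennreal (K * real CARD('d) * b) * kavg a b (\<lambda>z. ennreal (norm (g z))) z"
  proof -
    have "ennreal (K * real CARD('d) * b) = of_nat CARD('d) * ennreal (K * b)"
      using K0 ab by (simp add: ennreal_of_nat_eq_real_of_nat ennreal_mult[symmetric] mult_ac)
    then show ?thesis by (simp add: mult_ac)
  qed
  finally show ?thesis by (simp add: add.commute)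
qed

section \<open>Dependence of the averages on the scale\<close>

lemma kmean_eq:
  fixes f :: "'d::finite phase \<Rightarrow> real"
  assumes [measurable]: "f \<in> borel_measurable borel" and ab: "0 < a" "0 < b"
  shows "kmean a b f z = (\<integral>w. f w * bump 0 (kinv a b z w) / (a ^ (CARD('d) + 1) * b ^ (2 * CARD('d))) \<partial>lborel)"
proof -
  have [measurable]: "(bump 0 :: 'd phase \<Rightarrow> real) \<in> borel_measurable borel"
    by (intro borel_measurable_continuous_onI continuous_on_bump)
  have "a ^ (CARD('d) + 1) * b ^ (2 * CARD('d)) \<noteq> 0" using ab by simp
  then show ?thesis
    by (subst integral_kmap[OF _ ab, of _ z], measurable) (simp add: kmean_def kinv_kmap[OF ab])
qed

lemma scale_volume:
  fixes s :: real
  assumes "0 < s" "a0 ^ (n + 1) * b0 ^ (2 * n) = 1" "(real n + 1) * \<alpha> + 2 * real n * \<beta> = 1"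
  shows "(a0 * s powr \<alpha>) ^ (n + 1) * (b0 * s powr \<beta>) ^ (2 * n) = s"
proof -
  have "(a0 * s powr \<alpha>) ^ (n + 1) * (b0 * s powr \<beta>) ^ (2 * n)
      = (a0 ^ (n + 1) * b0 ^ (2 * n)) * ((s powr \<alpha>) ^ (n + 1) * (s powr \<beta>) ^ (2 * n))"
    by (simp add: power_mult_distrib mult_ac)
  also have "(s powr \<alpha>) ^ (n + 1) * (s powr \<beta>) ^ (2 * n) = s powr (\<alpha> * real (n + 1)) * s powr (\<beta> * real (2 * n))"
    using assms(1) by (simp add: powr_power algebra_simps powr_add)
  also have "\<dots> = s powr ((real n + 1) * \<alpha> + 2 * real n * \<beta>)"
    by (simp add: powr_add[symmetric] algebra_simps)
  finally show ?thesis
    using assms(1) by (simp only: assms(2,3) mult_1_left powr_one less_imp_le)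
qed

text \<open>The squared norm of the rescaled point is a combination of three powers of
  \<open>s\<close>, and only this norm enters \<open>bump 0\<close>. The quotient by
  \<open>s\<close>, the inverse Jacobian, produces the term \<open>- bump 0\<close> in
  \<open>kL\<close>.\<close>

lemma bump_scale_derivative:
  fixes z w :: "'d::finite phase"
  assumes s: "0 < s" and a0: "0 < a0" and b0: "0 < b0"
  shows "((\<lambda>s. bump 0 (kinv (a0 * s powr \<alpha>) (b0 * s powr \<beta>) z w) / s) has_real_derivative
    kL \<alpha> \<beta> (kinv (a0 * s powr \<alpha>) (b0 * s powr \<beta>) z w) / s\<^sup>2) (at s)"
proof -
  define T where "T = (fst w - fst z) / a0"
  define Y where "Y = (1 / (a0 * b0)) *\<^sub>R (fst (snd w) - fst (snd z) - (fst w - fst z) *\<^sub>R snd (snd z))"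
  define W where "W = (1 / b0) *\<^sub>R (snd (snd w) - snd (snd z))"
  let ?k = "\<lambda>s. kinv (a0 * s powr \<alpha>) (b0 * s powr \<beta>) z w"
  define N where "N s = T\<^sup>2 * s powr (- (2 * \<alpha>)) + (Y \<bullet> Y) * s powr (- (2 * (\<alpha> + \<beta>))) + (W \<bullet> W) * s powr (- (2 * \<beta>))" for s
  have k: "?k s = (T * s powr - \<alpha>, s powr (- (\<alpha> + \<beta>)) *\<^sub>R Y, s powr - \<beta> *\<^sub>R W)" if "0 < s" for s
  proof -
    have "s powr (- (\<alpha> + \<beta>)) = 1 / (s powr \<alpha> * s powr \<beta>)"
      using powr_minus_divide[of s "\<alpha> + \<beta>"] by (simp add: powr_add)
    then show ?thesis
      by (simp only: kinv_def T_def Y_def W_def powr_minus_divide) (simp add: mult_ac)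
  qed
  have sq: "s powr x * s powr x = s powr (2 * x)" for s x :: real
    by (simp add: powr_add[symmetric])
  have c1: "(fst (?k s))\<^sup>2 = T\<^sup>2 * s powr (- (2 * \<alpha>))" if "0 < s" for s
    using k[OF that] sq[of s "- \<alpha>"] by (simp add: power2_eq_square mult_ac)
  have c2: "fst (snd (?k s)) \<bullet> fst (snd (?k s)) = (Y \<bullet> Y) * s powr (- (2 * (\<alpha> + \<beta>)))" if "0 < s" for s
    using k[OF that] sq[of s "- (\<alpha> + \<beta>)"] by (simp add: mult_ac)
  have c3: "snd (snd (?k s)) \<bullet> snd (snd (?k s)) = (W \<bullet> W) * s powr (- (2 * \<beta>))" if "0 < s" for s
    using k[OF that] sq[of s "- \<beta>"] by (simp add: mult_ac)
  have N: "?k s \<bullet> ?k s = N s" if "0 < s" for s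
    using c1[OF that] c2[OF that] c3[OF that] by (simp add: inner_prod_def N_def power2_eq_square)
  have dp: "((\<lambda>s. s powr x) has_real_derivative x * (s powr x / s)) (at s)" for x
    using has_real_derivative_powr[OF s, of x] s by (simp add: powr_diff)
  \<comment> \<open>Up to the factor -2/s this is the derivative of \<open>N\<close>; it equals the
    quadratic form in \<open>kL\<close>, evaluated at the rescaled point.\<close>
  define M where "M = \<alpha> * (T\<^sup>2 * s powr (- (2 * \<alpha>))) + (\<alpha> + \<beta>) * ((Y \<bullet> Y) * s powr (- (2 * (\<alpha> + \<beta>)))) + \<beta> * ((W \<bullet> W) * s powr (- (2 * \<beta>)))"
  have "(N has_real_derivative (T\<^sup>2 * (- (2 * \<alpha>) * (s powr (- (2 * \<alpha>)) / s))
      + (Y \<bullet> Y) * (- (2 * (\<alpha> + \<beta>)) * (s powr (- (2 * (\<alpha> + \<beta>))) / s))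
      + (W \<bullet> W) * (- (2 * \<beta>) * (s powr (- (2 * \<beta>)) / s)))) (at s)"
    unfolding N_def[abs_def] by (intro DERIV_add DERIV_cmult dp)
  also have "(T\<^sup>2 * (- (2 * \<alpha>) * (s powr (- (2 * \<alpha>)) / s))
      + (Y \<bullet> Y) * (- (2 * (\<alpha> + \<beta>)) * (s powr (- (2 * (\<alpha> + \<beta>))) / s))
      + (W \<bullet> W) * (- (2 * \<beta>) * (s powr (- (2 * \<beta>)) / s))) = - 2 * M / s"
    using s unfolding M_def by (simp add: field_simps)
  finally have "((\<lambda>s. 1 - N s) has_real_derivative (0 - (- 2 * M / s))) (at s)"
    by (intro DERIV_diff DERIV_const)
  from DERIV_chain2[OF flat_has_derivative[of 0] this]
  have "((\<lambda>s. flat 0 (1 - N s)) has_real_derivative flat 2 (1 - N s) * (2 * M / s)) (at s)"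
    by (simp add: numeral_2_eq_2)
  from DERIV_divide[OF this DERIV_ident]
  have D: "((\<lambda>s. flat 0 (1 - N s) / s) has_real_derivative
      ((flat 2 (1 - N s) * (2 * M / s)) * s - flat 0 (1 - N s) * 1) / (s * s)) (at s)"
    using s by simp
  have e: "((flat 2 (1 - N s) * (2 * M / s)) * s - flat 0 (1 - N s) * 1) / (s * s) = kL \<alpha> \<beta> (?k s) / s\<^sup>2"
    using s unfolding kL_def c1[OF s] c2[OF s] c3[OF s] bump_def N[OF s] M_def by (simp add: power2_eq_square)
  have ev: "eventually (\<lambda>s. flat 0 (1 - N s) / s = bump 0 (?k s) / s) (nhds s)"
  proof -
    have "eventually (\<lambda>s. s \<in> {0<..}) (nhds s)"
      using s by (intro eventually_nhds_in_open) auto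
    then show ?thesis
      by eventually_elim (simp only: bump_def N greaterThan_iff)
  qed
  show ?thesis
    using D unfolding e using DERIV_cong_ev[OF refl ev refl] by simp
qed

text \<open>In the variable \<open>w\<close> the scale occurs in the kernel alone, so
  differentiation in \<open>s\<close> never falls on \<open>f\<close>. The identity is the
  fundamental theorem of calculus for the kernel at fixed \<open>w\<close>, integrated against
  \<open>f\<close>.\<close>

lemma kmean_diff:
  fixes f :: "'d::finite phase \<Rightarrow> real"
  assumes f: "in_Lp 2 f" and a0: "0 < a0" and b0: "0 < b0" and e: "0 < \<epsilon>" and r: "\<epsilon> \<le> r"
    and hom: "(real CARD('d) + 1) * \<alpha> + 2 * real CARD('d) * \<beta> = 1"
    and vol: "a0 ^ (CARD('d) + 1) * b0 ^ (2 * CARD('d)) = 1"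
  defines "a \<equiv> \<lambda>s. a0 * s powr \<alpha>" and "b \<equiv> \<lambda>s. b0 * s powr \<beta>"
  shows "kmean (a r) (b r) f z - kmean (a \<epsilon>) (b \<epsilon>) f z
    = (\<integral>s. indicator {\<epsilon>..r} s * ((\<integral>\<zeta>. f (kmap (a s) (b s) z \<zeta>) * kL \<alpha> \<beta> \<zeta> \<partial>lborel) / s) \<partial>lborel)"
proof -
  have [measurable]: "f \<in> borel_measurable borel" using f by (simp add: in_Lp_def)
  obtain C where C: "0 \<le> C" "\<And>\<zeta>. \<bar>kL \<alpha> \<beta> (\<zeta> :: 'd phase)\<bar> \<le> C * indicator (cball 0 1) \<zeta>"
    using kL_bound by blast
  have cL: "continuous_on UNIV (kL \<alpha> \<beta> :: 'd phase \<Rightarrow> real)"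
    unfolding kL_def by (intro continuous_intros continuous_on_bump)
  have [measurable]: "(kL \<alpha> \<beta> :: 'd phase \<Rightarrow> real) \<in> borel_measurable borel"
    by (intro borel_measurable_continuous_onI cL)
  have [measurable]: "(bump 0 :: 'd phase \<Rightarrow> real) \<in> borel_measurable borel"
    by (intro borel_measurable_continuous_onI continuous_on_bump)
  have ab: "0 < a s" "0 < b s" if "0 < s" for s
    using that a0 b0 by (auto simp: a_def b_def)
  have J: "a s ^ (CARD('d) + 1) * b s ^ (2 * CARD('d)) = s" if "0 < s" for s
    unfolding a_def b_def by (rule scale_volume[OF that vol hom])
  let ?\<Phi> = "\<lambda>s w. bump 0 (kinv (a s) (b s) z w) / s"
  let ?H = "\<lambda>s w. indicator {\<epsilon>..r} s * (kL \<alpha> \<beta> (kinv (a s) (b s) z w) / s\<^sup>2)"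
  have [measurable]: "a \<in> borel_measurable borel" "b \<in> borel_measurable borel"
    unfolding a_def b_def by measurable
  have m: "(\<lambda>(s, w). f w * ?H s w) \<in> borel_measurable (lborel \<Otimes>\<^sub>M lborel)"
    unfolding split_beta by measurable
  have ftc: "(\<integral>s. ?H s w \<partial>lborel) = ?\<Phi> r w - ?\<Phi> \<epsilon> w" for w
  proof -
    have "continuous_on {\<epsilon>..r} (\<lambda>s. kL \<alpha> \<beta> (kinv (a s) (b s) z w) / s\<^sup>2)"
    proof -
      have "continuous_on {\<epsilon>..r} (\<lambda>s. kinv (a s) (b s) z w)"
        unfolding kinv_def a_def b_def using e a0 b0 by (intro continuous_intros) auto
      then show ?thesis
        using e by (intro continuous_intros continuous_on_compose2[OF cL]) auto
    qed
    then have "(\<integral>s. indicator {\<epsilon>..r} s *\<^sub>R (kL \<alpha> \<beta> (kinv (a s) (b s) z w) / s\<^sup>2) \<partial>lborel) = ?\<Phi> r w - ?\<Phi> \<epsilon> w"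
      using e r
      by (intro integral_FTC_atLeastAtMost)
         (auto simp: a_def b_def has_real_derivative_iff_has_vector_derivative[symmetric]
           intro!: has_field_derivative_at_within[OF bump_scale_derivative[OF _ a0 b0]])
    then show ?thesis by simp
  qed
  \<comment> \<open>A bound of the w-integral that is uniform for \<open>s\<close> in the interval;
    it supplies the integrability on the product needed for Fubini and is the reason for staying
    above \<epsilon>.\<close>
  have inner: "(\<integral>\<^sup>+w. ennreal (norm (f w * ?H s w)) \<partial>lborel) \<le> ennreal (C * (measure lborel (cball 0 1 :: 'd phase set)
      + (\<integral>z. (norm (f z)) powr 2 \<partial>lborel) / \<epsilon>) / \<epsilon>) * indicator {\<epsilon>..r} s" for s
  proof (cases "s \<in> {\<epsilon>..r}")
    case True
    then have s: "0 < s" "\<epsilon> \<le> s" using e by auto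
    let ?I = "\<integral>z. (norm (f z)) powr 2 \<partial>lborel"
    have I: "0 \<le> ?I" by simp
    have "(\<integral>\<^sup>+w. ennreal (norm (f w * ?H s w)) \<partial>lborel)
        = (\<integral>\<^sup>+w. ennreal (1 / s\<^sup>2) * ennreal (norm (f w * kL \<alpha> \<beta> (kinv (a s) (b s) z w))) \<partial>lborel)"
      using True s by (intro nn_integral_cong) (simp add: ennreal_mult[symmetric] abs_mult)
    also have "\<dots> = ennreal (1 / s\<^sup>2) * (\<integral>\<^sup>+w. ennreal (norm (f w * kL \<alpha> \<beta> (kinv (a s) (b s) z w))) \<partial>lborel)"
      by (rule nn_integral_cmult) measurable
    also have "(\<integral>\<^sup>+w. ennreal (norm (f w * kL \<alpha> \<beta> (kinv (a s) (b s) z w))) \<partial>lborel)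
        = ennreal s * (\<integral>\<^sup>+\<zeta>. ennreal (norm (f (kmap (a s) (b s) z \<zeta>) * kL \<alpha> \<beta> \<zeta>)) \<partial>lborel)"
    proof -
      have "(\<integral>\<^sup>+\<zeta>. ennreal (norm (f (kmap (a s) (b s) z \<zeta>) * kL \<alpha> \<beta> (kinv (a s) (b s) z (kmap (a s) (b s) z \<zeta>)))) \<partial>lborel)
        = ennreal (1 / s) * (\<integral>\<^sup>+w. ennreal (norm (f w * kL \<alpha> \<beta> (kinv (a s) (b s) z w))) \<partial>lborel)"
        using nn_integral_kmap[OF _ ab[OF s(1)], of "\<lambda>w. ennreal (norm (f w * kL \<alpha> \<beta> (kinv (a s) (b s) z w)))" z]
        unfolding J[OF s(1)] by measurable
      moreover have "ennreal s * (ennreal (1 / s) * X) = X" for X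
        using s by (simp add: mult.assoc[symmetric] ennreal_mult'[symmetric])
      ultimately show ?thesis
        by (simp add: kinv_kmap[OF ab[OF s(1)]])
    qed
    also have "\<dots> \<le> ennreal s * (ennreal C * ennreal (measure lborel (cball 0 1 :: 'd phase set) + ?I / s))"
      using kavg_le[OF f _ zero_less_one ab[OF s(1)], of z] unfolding J[OF s(1)]
      by (intro mult_left_mono order_trans[OF integrable_kmap_mult(2)[OF f _ ab[OF s(1)] _ C(2)]]) auto
    also have "ennreal (1 / s\<^sup>2) * (ennreal s * (ennreal C * ennreal (measure lborel (cball 0 1 :: 'd phase set) + ?I / s)))
        = ennreal (C * (measure lborel (cball 0 1 :: 'd phase set) + ?I / s) / s)"
      using s C(1) I by (simp add: ennreal_mult[symmetric] power2_eq_square field_simps)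
    also have "\<dots> \<le> ennreal (C * (measure lborel (cball 0 1 :: 'd phase set) + ?I / \<epsilon>) / \<epsilon>)"
      using s e C(1) I by (intro ennreal_leI frac_le mult_left_mono add_left_mono divide_left_mono) auto
    finally show ?thesis using True by (simp add: mult_left_mono)
  next
    case False
    then show ?thesis by simp
  qed
  have int: "integrable (lborel \<Otimes>\<^sub>M lborel) (\<lambda>(s, w). f w * ?H s w)"
  proof (rule integrableI_bounded[OF m])
    have "(\<integral>\<^sup>+x. ennreal (norm (case x of (s, w) \<Rightarrow> f w * ?H s w)) \<partial>(lborel \<Otimes>\<^sub>M lborel))
        = (\<integral>\<^sup>+s. \<integral>\<^sup>+w. ennreal (norm (f w * ?H s w)) \<partial>lborel \<partial>lborel)"
      using m by (subst lborel.nn_integral_fst[symmetric]) simp_all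
    also have "\<dots> \<le> (\<integral>\<^sup>+s. ennreal (C * (measure lborel (cball 0 1 :: 'd phase set)
      + (\<integral>z. (norm (f z)) powr 2 \<partial>lborel) / \<epsilon>) / \<epsilon>) * indicator {\<epsilon>..r} s \<partial>lborel)"
      by (intro nn_integral_mono inner)
    also have "\<dots> < \<infinity>"
      using r by (simp add: nn_integral_cmult_indicator ennreal_mult_less_top)
    finally show "(\<integral>\<^sup>+x. ennreal (norm (case x of (s, w) \<Rightarrow> f w * ?H s w)) \<partial>(lborel \<Otimes>\<^sub>M lborel)) < \<infinity>" .
  qed
  have \<Phi>: "integrable lborel (\<lambda>w. f w * ?\<Phi> s w)" "kmean (a s) (b s) f z = (\<integral>w. f w * ?\<Phi> s w \<partial>lborel)"
    if s: "0 < s" for s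
  proof -
    have bb: "\<bar>bump 0 (\<zeta> :: 'd phase)\<bar> \<le> 1 * indicator (cball 0 1) \<zeta>" for \<zeta>
    proof (cases "\<zeta> \<in> cball 0 1")
      case True
      then show ?thesis by (simp add: bump_def flat_def)
    qed (simp add: bump_eq_0)
    have "(\<integral>\<^sup>+\<zeta>. ennreal (norm (f (kmap (a s) (b s) z \<zeta>) * ?\<Phi> s (kmap (a s) (b s) z \<zeta>))) \<partial>lborel)
        = ennreal (1 / s) * (\<integral>\<^sup>+w. ennreal (norm (f w * ?\<Phi> s w)) \<partial>lborel)"
      using nn_integral_kmap[OF _ ab[OF s], of "\<lambda>w. ennreal (norm (f w * ?\<Phi> s w))" z]
      unfolding J[OF s] by measurable
    moreover have "integrable lborel (\<lambda>\<zeta>. f (kmap (a s) (b s) z \<zeta>) * bump 0 \<zeta> / s)"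
      by (intro integrable_divide integrable_kmap_mult(1)[OF f _ ab[OF s] _ bb]) auto
    then have "(\<integral>\<^sup>+\<zeta>. ennreal (norm (f (kmap (a s) (b s) z \<zeta>) * ?\<Phi> s (kmap (a s) (b s) z \<zeta>))) \<partial>lborel) < \<infinity>"
      by (simp add: integrable_iff_bounded kinv_kmap[OF ab[OF s]])
    ultimately have "(\<integral>\<^sup>+w. ennreal (norm (f w * ?\<Phi> s w)) \<partial>lborel) < \<infinity>"
      using s by (auto simp: ennreal_mult_less_top)
    then show "integrable lborel (\<lambda>w. f w * ?\<Phi> s w)"
      by (intro integrableI_bounded) measurable
    show "kmean (a s) (b s) f z = (\<integral>w. f w * ?\<Phi> s w \<partial>lborel)"
      by (subst kmean_eq[OF _ ab[OF s]]) (simp_all add: J[OF s, simplified])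
  qed
  have r0: "0 < r" using e r by simp
  have "kmean (a r) (b r) f z - kmean (a \<epsilon>) (b \<epsilon>) f z = (\<integral>w. f w * ?\<Phi> r w - f w * ?\<Phi> \<epsilon> w \<partial>lborel)"
    using \<Phi>[OF r0] \<Phi>[OF e] by simp
  also have "\<dots> = (\<integral>w. (\<integral>s. f w * ?H s w \<partial>lborel) \<partial>lborel)"
    by (simp only: integral_mult_right_zero ftc right_diff_distrib)
  also have "\<dots> = (\<integral>s. (\<integral>w. f w * ?H s w \<partial>lborel) \<partial>lborel)"
    by (rule lborel_pair.Fubini_integral[OF int])
  also have "\<dots> = (\<integral>s. indicator {\<epsilon>..r} s * ((\<integral>\<zeta>. f (kmap (a s) (b s) z \<zeta>) * kL \<alpha> \<beta> \<zeta> \<partial>lborel) / s) \<partial>lborel)"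
  proof (intro Bochner_Integration.integral_cong refl)
    fix s
    show "(\<integral>w. f w * ?H s w \<partial>lborel) = indicator {\<epsilon>..r} s * ((\<integral>\<zeta>. f (kmap (a s) (b s) z \<zeta>) * kL \<alpha> \<beta> \<zeta> \<partial>lborel) / s)"
    proof (cases "s \<in> {\<epsilon>..r}")
      case True
      then have s: "0 < s" using e by auto
      \<comment> \<open>Back to the variable \<zeta>: the Jacobian \<open>s\<close> leaves one of
        the two powers of \<open>s\<close> in the denominator.\<close>
      have "(\<integral>w. f w * ?H s w \<partial>lborel) = s * (\<integral>\<zeta>. f (kmap (a s) (b s) z \<zeta>) * ?H s (kmap (a s) (b s) z \<zeta>) \<partial>lborel)"
        using integral_kmap[OF _ ab[OF s], of "\<lambda>w. f w * ?H s w" z] unfolding J[OF s] by measurable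
      then show ?thesis
        using True s by (simp add: kinv_kmap[OF ab[OF s]] power2_eq_square)
    qed simp
  qed
  finally show ?thesis .
qed

section \<open>Convergence of averages\<close>

text \<open>An L^1 modulus of continuity, with the displacement averaged over the unit ball in
  \<zeta>. Written as one integral over the product so that either variable may be integrated
  first.\<close>

definition osc :: "real \<Rightarrow> real \<Rightarrow> ('d::finite phase \<Rightarrow> real) \<Rightarrow> ennreal" where
  "osc a b u = (\<integral>\<^sup>+x. ennreal \<bar>u (kmap a b (fst x) (snd x)) - u (fst x)\<bar> * indicator (cball 0 1) (snd x) \<partial>(lborel \<Otimes>\<^sub>M lborel))"

lemma nn_integral_pair_kmap:
  fixes h :: "'d::finite phase \<Rightarrow> ennreal"
  assumes [measurable]: "h \<in> borel_measurable borel"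
  shows "(\<integral>\<^sup>+x. h (kmap a b (fst x) (snd x)) * indicator (cball 0 1) (snd x) \<partial>(lborel \<Otimes>\<^sub>M lborel))
    = emeasure lborel (cball 0 1 :: 'd phase set) * (\<integral>\<^sup>+z. h z \<partial>lborel)"
proof -
  have "(\<integral>\<^sup>+x. h (kmap a b (fst x) (snd x)) * indicator (cball 0 1) (snd x) \<partial>(lborel \<Otimes>\<^sub>M lborel))
      = (\<integral>\<^sup>+\<zeta>. \<integral>\<^sup>+z. h (kmap a b z \<zeta>) * indicator (cball 0 1) \<zeta> \<partial>lborel \<partial>lborel)"
    by (subst lborel_pair.nn_integral_snd[symmetric]) simp_all
  also have "\<dots> = (\<integral>\<^sup>+\<zeta>. (\<integral>\<^sup>+z. h z \<partial>lborel) * indicator (cball 0 1 :: 'd phase set) \<zeta> \<partial>lborel)"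
    by (intro nn_integral_cong) (simp add: nn_integral_multc nn_integral_kmap_right)
  finally show ?thesis
    by (simp add: nn_integral_cmult_indicator mult.commute)
qed

lemma nn_integral_pair_fst:
  fixes h :: "'d::finite phase \<Rightarrow> ennreal"
  assumes [measurable]: "h \<in> borel_measurable borel"
  shows "(\<integral>\<^sup>+x. h (fst x) * indicator (cball 0 1) (snd x) \<partial>(lborel \<Otimes>\<^sub>M (lborel :: 'd phase measure)))
    = emeasure lborel (cball 0 1 :: 'd phase set) * (\<integral>\<^sup>+z. h z \<partial>lborel)"
proof -
  have "kmap 0 0 z \<zeta> = z" for z \<zeta> :: "'d phase"
    by (simp add: kmap_def)
  then show ?thesis using nn_integral_pair_kmap[OF assms, of 0 0] by simp
qed

text \<open>\<open>kmap\<close> preserves the measure in its base point, so replacing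
  \<open>u\<close> by \<open>v\<close> costs the same L^1 distance at the displaced point as at the
  base point, whatever the scale.\<close>

lemma osc_perturb:
  fixes u v :: "'d::finite phase \<Rightarrow> real"
  assumes [measurable]: "u \<in> borel_measurable borel" "v \<in> borel_measurable borel"
  shows "osc a b u \<le> osc a b v + 2 * (emeasure lborel (cball 0 1 :: 'd phase set) * (\<integral>\<^sup>+z. ennreal \<bar>u z - v z\<bar> \<partial>lborel))"
proof -
  let ?B = "cball 0 1 :: 'd phase set"
  let ?h = "\<lambda>z. ennreal \<bar>u z - v z\<bar>"
  have "osc a b u \<le> (\<integral>\<^sup>+x. ennreal \<bar>v (kmap a b (fst x) (snd x)) - v (fst x)\<bar> * indicator ?B (snd x)
      + (?h (kmap a b (fst x) (snd x)) * indicator ?B (snd x) + ?h (fst x) * indicator ?B (snd x)) \<partial>(lborel \<Otimes>\<^sub>M lborel))"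
    unfolding osc_def
  proof (rule nn_integral_mono)
    fix x :: "'d phase \<times> 'd phase"
    let ?k = "kmap a b (fst x) (snd x)"
    have "ennreal \<bar>u ?k - u (fst x)\<bar> \<le> ennreal (\<bar>v ?k - v (fst x)\<bar> + (\<bar>u ?k - v ?k\<bar> + \<bar>u (fst x) - v (fst x)\<bar>))"
      by (intro ennreal_leI) linarith
    then show "ennreal \<bar>u ?k - u (fst x)\<bar> * indicator ?B (snd x)
        \<le> ennreal \<bar>v ?k - v (fst x)\<bar> * indicator ?B (snd x) + (?h ?k * indicator ?B (snd x) + ?h (fst x) * indicator ?B (snd x))"
      by (auto simp: indicator_def ennreal_plus)
  qed
  also have "\<dots> = osc a b v + ((\<integral>\<^sup>+x. ?h (kmap a b (fst x) (snd x)) * indicator ?B (snd x) \<partial>(lborel \<Otimes>\<^sub>M lborel))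
      + (\<integral>\<^sup>+x. ?h (fst x) * indicator ?B (snd x) \<partial>(lborel \<Otimes>\<^sub>M lborel)))"
    unfolding osc_def by (subst nn_integral_add, measurable, subst nn_integral_add, measurable)
  also have "\<dots> = osc a b v + 2 * (emeasure lborel ?B * (\<integral>\<^sup>+z. ?h z \<partial>lborel))"
    by (subst nn_integral_pair_kmap, measurable, subst nn_integral_pair_fst, measurable) (simp add: mult_2)
  finally show ?thesis .
qed

text \<open>The error in \<open>osc_perturb\<close> is uniform in the scale, hence vanishing
  oscillation passes to L^1 limits.\<close>

lemma osc_tendsto_approx:
  fixes u :: "'d::finite phase \<Rightarrow> real"
  assumes [measurable]: "u \<in> borel_measurable borel"
    and ex: "\<And>e. 0 < e \<Longrightarrow> \<exists>v. v \<in> borel_measurable borel \<and> (\<lambda>n. osc (a n) (b n) v) \<longlonglongrightarrow> 0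
      \<and> (\<integral>\<^sup>+z. ennreal \<bar>u z - v z\<bar> \<partial>lborel) \<le> ennreal e"
  shows "(\<lambda>n. osc (a n) (b n) u) \<longlonglongrightarrow> 0"
proof (rule order_tendstoI)
  define V where "V = measure lborel (cball 0 1 :: 'd phase set)"
  have V: "emeasure lborel (cball 0 1 :: 'd phase set) = ennreal V"
    unfolding V_def using emeasure_bounded_finite[of "cball 0 1 :: 'd phase set"] by (intro emeasure_eq_ennreal_measure) auto
  have V0: "0 \<le> V" by (simp add: V_def)
  fix y :: ennreal assume y: "0 < y"
  obtain y' where y': "0 < y'" "ennreal y' < y"
  proof -
    obtain w where "0 < w" "w < y" using dense[OF y] by blast
    moreover have "w < top"
      using \<open>w < y\<close> top_greatest by (rule order.strict_trans2)
    ultimately show ?thesis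
      using that[of "enn2real w"] by (simp add: enn2real_positive_iff)
  qed
  \<comment> \<open>Chosen so that the approximation error 2 V e is at most y'/2; the summand 1
    keeps the denominator positive.\<close>
  define e where "e = y' / (4 * (V + 1))"
  have "0 < V + 1" using V0 by linarith
  then have e: "0 < e" unfolding e_def using y'(1) by (intro divide_pos_pos mult_pos_pos) simp_all
  obtain v where [measurable]: "v \<in> borel_measurable borel" and v: "(\<lambda>n. osc (a n) (b n) v) \<longlonglongrightarrow> 0"
    and uv: "(\<integral>\<^sup>+z. ennreal \<bar>u z - v z\<bar> \<partial>lborel) \<le> ennreal e"
    using ex[OF e] by blast
  have "2 * (V * e) \<le> y' / 2"
    unfolding e_def using y'(1) \<open>0 < V + 1\<close> by (simp add: field_simps)
  have "eventually (\<lambda>n. osc (a n) (b n) v < ennreal (y' / 2)) sequentially"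
    using y' by (intro order_tendstoD[OF v]) simp
  then show "eventually (\<lambda>n. osc (a n) (b n) u < y) sequentially"
  proof eventually_elim
    case (elim n)
    have "osc (a n) (b n) u \<le> osc (a n) (b n) v + 2 * (ennreal V * (\<integral>\<^sup>+z. ennreal \<bar>u z - v z\<bar> \<partial>lborel))"
      using osc_perturb[of u v "a n" "b n"] by (simp add: V)
    also have "\<dots> \<le> ennreal (y' / 2) + 2 * (ennreal V * ennreal e)"
      using elim uv by (intro add_mono mult_left_mono) auto
    also have "2 * (ennreal V * ennreal e) = ennreal (2 * (V * e))"
      using e V0 by (simp add: ennreal_mult)
    also have "ennreal (y' / 2) + ennreal (2 * (V * e)) = ennreal (y' / 2 + 2 * (V * e))"
      using y' e V0 by (subst ennreal_plus) auto
    also have "\<dots> \<le> ennreal y'"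
      using \<open>2 * (V * e) \<le> y' / 2\<close> by (intro ennreal_leI) linarith
    also have "\<dots> < y" by (rule y')
    finally show ?case .
  qed
qed simp

lemma kmap_tendsto:
  assumes "a \<longlonglongrightarrow> 0" "b \<longlonglongrightarrow> 0"
  shows "(\<lambda>n. kmap (a n) (b n) z \<zeta>) \<longlonglongrightarrow> z"
proof -
  have "(\<lambda>n. kmap (a n) (b n) z \<zeta>) \<longlonglongrightarrow> (fst z + 0 * fst \<zeta>,
     fst (snd z) + (0 * 0) *\<^sub>R fst (snd \<zeta>) + (0 * fst \<zeta>) *\<^sub>R snd (snd z),
     snd (snd z) + 0 *\<^sub>R snd (snd \<zeta>))"
    unfolding kmap_def by (intro tendsto_intros assms)
  then show ?thesis by simp
qed

text \<open>For an open set the decrease of the indicator along \<open>kmap\<close> tends to zero pointwise, and by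
  measure preservation increase and decrease have the same integral.\<close>

lemma osc_tendsto_open:
  fixes U :: "'d::finite phase set"
  assumes U: "open U" and fin: "emeasure lborel U < \<infinity>" and ab: "a \<longlonglongrightarrow> 0" "b \<longlonglongrightarrow> 0"
  shows "(\<lambda>n. osc (a n) (b n) (indicator U)) \<longlonglongrightarrow> 0"
proof -
  let ?B = "cball 0 1 :: 'd phase set"
  let ?M = "lborel \<Otimes>\<^sub>M lborel :: ('d phase \<times> 'd phase) measure"
  have [measurable]: "U \<in> sets borel" using U by simp
  let ?k = "\<lambda>n x. kmap (a n) (b n) (fst x) (snd x) :: 'd phase"
  let ?i = "indicator U :: 'd phase \<Rightarrow> ennreal"
  \<comment> \<open>\<open>P\<close>, \<open>Q\<close>, \<open>R\<close> are the masses of the pairs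
    for which the point leaves, enters or stays in \<open>U\<close> under the displacement.\<close>
  define P where "P n = (\<integral>\<^sup>+x. ?i (fst x) * indicator (- U) (?k n x) * indicator ?B (snd x) \<partial>?M)" for n
  define Q where "Q n = (\<integral>\<^sup>+x. ?i (?k n x) * indicator (- U) (fst x) * indicator ?B (snd x) \<partial>?M)" for n
  define R where "R n = (\<integral>\<^sup>+x. ?i (?k n x) * ?i (fst x) * indicator ?B (snd x) \<partial>?M)" for n
  have B: "emeasure lborel ?B < \<infinity>" by (rule emeasure_bounded_finite) simp
  have tot: "emeasure lborel ?B * emeasure lborel U < \<infinity>"
    using B fin by (simp add: ennreal_mult_less_top)
  have PR: "P n + R n = emeasure lborel ?B * emeasure lborel U" for n
  proof -
    have "P n + R n = (\<integral>\<^sup>+x. ?i (fst x) * indicator ?B (snd x) \<partial>?M)"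
      unfolding P_def R_def by (subst nn_integral_add[symmetric]) (auto intro!: nn_integral_cong simp: indicator_def)
    then show ?thesis by (simp add: nn_integral_pair_fst)
  qed
  have QR: "Q n + R n = emeasure lborel ?B * emeasure lborel U" for n
  proof -
    have "Q n + R n = (\<integral>\<^sup>+x. ?i (?k n x) * indicator ?B (snd x) \<partial>?M)"
      unfolding Q_def R_def by (subst nn_integral_add[symmetric]) (auto intro!: nn_integral_cong simp: indicator_def)
    then show ?thesis by (simp add: nn_integral_pair_kmap)
  qed
  \<comment> \<open>Finiteness allows \<open>R n\<close> to be cancelled from the two decompositions
    in \<open>ennreal\<close>.\<close>
  have "R n < \<infinity>" for n
    using PR[of n] tot by (metis ennreal_add_eq_top infinity_ennreal_def less_top order_less_irrefl)
  then have PQ: "P n = Q n" for n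
    using PR[of n] QR[of n] by (metis ennreal_add_left_cancel add.commute infinity_ennreal_def less_irrefl)
  have osc: "osc (a n) (b n) (indicator U) = P n + Q n" for n
    unfolding osc_def P_def Q_def
    by (subst nn_integral_add[symmetric]) (auto intro!: nn_integral_cong simp: indicator_def)
  have "P \<longlonglongrightarrow> (\<integral>\<^sup>+x. 0 \<partial>?M)"
    unfolding P_def
  proof (rule nn_integral_dominated_convergence[where w="\<lambda>x. ?i (fst x) * indicator ?B (snd x)"])
    show "(\<integral>\<^sup>+x. ?i (fst x) * indicator ?B (snd x) \<partial>?M) < \<infinity>"
      using tot by (simp add: nn_integral_pair_fst)
    show "AE x in ?M. (\<lambda>n. ?i (fst x) * indicator (- U) (?k n x) * indicator ?B (snd x)) \<longlonglongrightarrow> 0"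
    proof (rule AE_I2)
      fix x :: "'d phase \<times> 'd phase"
      show "(\<lambda>n. ?i (fst x) * indicator (- U) (?k n x) * indicator ?B (snd x)) \<longlonglongrightarrow> 0"
      proof (cases "fst x \<in> U")
        case True
        then have "eventually (\<lambda>n. ?k n x \<in> U) sequentially"
          using topological_tendstoD[OF kmap_tendsto[OF ab] U] by blast
        then have "eventually (\<lambda>n. ?i (fst x) * indicator (- U) (?k n x) * indicator ?B (snd x) = 0) sequentially"
          by eventually_elim simp
        then show ?thesis by (rule tendsto_eventually)
      qed simp
    qed
    show "AE x in ?M. ?i (fst x) * indicator (- U) (?k n x) * indicator ?B (snd x) \<le> ?i (fst x) * indicator ?B (snd x)" for n
      by (intro AE_I2) (simp add: indicator_def)
  qed measurable
  then have "(\<lambda>n. P n + Q n) \<longlonglongrightarrow> 0 + 0"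
    by (intro tendsto_add) (simp_all add: PQ[symmetric])
  then show ?thesis by (simp add: osc)
qed

lemma osc_cmult:
  assumes [measurable]: "u \<in> borel_measurable borel"
  shows "osc a b (\<lambda>z. c * u z) = ennreal \<bar>c\<bar> * osc a b u"
  unfolding osc_def
  by (subst nn_integral_cmult[symmetric])
     (auto intro!: nn_integral_cong simp: right_diff_distrib[symmetric] abs_mult ennreal_mult mult.assoc)

lemma osc_add_le:
  assumes [measurable]: "u \<in> borel_measurable borel" "v \<in> borel_measurable borel"
  shows "osc a b (\<lambda>z. u z + v z) \<le> osc a b u + osc a b v"
proof -
  let ?K = "\<lambda>x. kmap a b (fst x) (snd x)"
  have "osc a b (\<lambda>z. u z + v z) \<le> (\<integral>\<^sup>+x. ennreal \<bar>u (?K x) - u (fst x)\<bar> * indicator (cball 0 1) (snd x)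
     + ennreal \<bar>v (?K x) - v (fst x)\<bar> * indicator (cball 0 1) (snd x) \<partial>(lborel \<Otimes>\<^sub>M lborel))"
    unfolding osc_def
  proof (rule nn_integral_mono)
    fix x
    have "ennreal \<bar>u (?K x) + v (?K x) - (u (fst x) + v (fst x))\<bar> \<le> ennreal (\<bar>u (?K x) - u (fst x)\<bar> + \<bar>v (?K x) - v (fst x)\<bar>)"
      by (intro ennreal_leI) linarith
    then show "ennreal \<bar>u (?K x) + v (?K x) - (u (fst x) + v (fst x))\<bar> * indicator (cball 0 1) (snd x)
      \<le> ennreal \<bar>u (?K x) - u (fst x)\<bar> * indicator (cball 0 1) (snd x) + ennreal \<bar>v (?K x) - v (fst x)\<bar> * indicator (cball 0 1) (snd x)"
      by (auto simp: indicator_def ennreal_plus)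
  qed
  also have "\<dots> = osc a b u + osc a b v"
    unfolding osc_def by (subst nn_integral_add) measurable
  finally show ?thesis .
qed

text \<open>Open sets generate all integrable functions through outer regularity, linear
  combinations and dominated limits, each of which preserves vanishing oscillation.\<close>

lemma osc_tendsto:
  fixes u :: "'d::finite phase \<Rightarrow> real"
  assumes u: "integrable lborel u" and ab: "a \<longlonglongrightarrow> 0" "b \<longlonglongrightarrow> 0"
  shows "(\<lambda>n. osc (a n) (b n) u) \<longlonglongrightarrow> 0"
  using u
proof (induction rule: integrable_induct)
  case (base A c)
  then have [measurable]: "A \<in> sets borel" by simp
  have "(\<lambda>n. osc (a n) (b n) (indicator A)) \<longlonglongrightarrow> 0"
  proof (rule osc_tendsto_approx)
    fix e :: real assume e: "0 < e"
    \<comment> \<open>Outer regularity replaces \<open>A\<close> by an open set at L^1 distance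
      below \<open>e\<close>; finite measure of \<open>U\<close> is inherited from
      \<open>A\<close>.\<close>
    obtain U where U: "open U" "A \<subseteq> U" "emeasure lborel (U - A) < ennreal e"
      using outer_regular_lborel[of A e] e by auto
    have "emeasure lborel U \<le> emeasure lborel A + emeasure lborel (U - A)"
      using U by (intro order_trans[OF _ emeasure_subadditive]) (auto intro!: emeasure_mono)
    also have "\<dots> < \<infinity>"
      using base U(3) by (auto simp: less_top[symmetric] top_unique)
    finally have fin: "emeasure lborel U < \<infinity>" .
    have "(\<integral>\<^sup>+z. ennreal \<bar>indicator A z - indicator U z\<bar> \<partial>lborel) = (\<integral>\<^sup>+z. indicator (U - A) z \<partial>lborel)"
      using U(2) by (intro nn_integral_cong) (auto simp: indicator_def)
    also have "\<dots> \<le> ennreal e" using U by simp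
    finally show "\<exists>v. v \<in> borel_measurable borel \<and> (\<lambda>n. osc (a n) (b n) v) \<longlonglongrightarrow> 0
      \<and> (\<integral>\<^sup>+z. ennreal \<bar>indicator A z - v z\<bar> \<partial>lborel) \<le> ennreal e"
      using osc_tendsto_open[OF U(1) fin ab] U(1) by (intro exI[of _ "indicator U"]) auto
  qed measurable
  from tendsto_mult_ennreal[OF tendsto_const this, of "ennreal \<bar>c\<bar>"]
  have "(\<lambda>n. osc (a n) (b n) (\<lambda>z. c * indicator A z)) \<longlonglongrightarrow> 0"
    by (simp add: osc_cmult)
  then show ?case by (simp add: mult.commute)
next
  case (add f g)
  then have [measurable]: "f \<in> borel_measurable borel" "g \<in> borel_measurable borel" by auto
  have lim: "(\<lambda>n. osc (a n) (b n) f + osc (a n) (b n) g) \<longlonglongrightarrow> 0 + 0"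
    by (intro tendsto_add add)
  show ?case
  proof (rule tendsto_sandwich[OF _ _ tendsto_const])
    show "(\<lambda>n. osc (a n) (b n) f + osc (a n) (b n) g) \<longlonglongrightarrow> 0"
      using lim by simp
    show "eventually (\<lambda>n. osc (a n) (b n) (\<lambda>z. f z + g z) \<le> osc (a n) (b n) f + osc (a n) (b n) g) sequentially"
      by (intro always_eventually allI osc_add_le) measurable
  qed simp
next
  case (lim f s)
  then have [measurable]: "f \<in> borel_measurable borel" "\<And>i. s i \<in> borel_measurable borel" by auto
  have f: "integrable lborel f" and bd: "\<And>i z. norm (s i z) \<le> 2 * norm (f z)"
    and cv: "\<And>z. (\<lambda>i. s i z) \<longlonglongrightarrow> f z"
    using lim by auto
  show ?case
  proof (rule osc_tendsto_approx)
    fix e :: real assume e: "0 < e"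
    have "(\<lambda>i. \<integral>\<^sup>+z. ennreal \<bar>f z - s i z\<bar> \<partial>lborel) \<longlonglongrightarrow> (\<integral>\<^sup>+z. 0 \<partial>(lborel :: 'd phase measure))"
    proof (rule nn_integral_dominated_convergence[where w="\<lambda>z. ennreal (3 * norm (f z))"])
      show "(\<integral>\<^sup>+z. ennreal (3 * norm (f z)) \<partial>lborel) < \<infinity>"
        using f by (simp add: ennreal_mult' nn_integral_cmult integrable_iff_bounded ennreal_mult_less_top)
      show "AE z in lborel. ennreal \<bar>f z - s i z\<bar> \<le> ennreal (3 * norm (f z))" for i
      proof (intro AE_I2 ennreal_leI)
        fix z
        show "\<bar>f z - s i z\<bar> \<le> 3 * norm (f z)" using bd[of i z] by auto
      qed
      show "AE z in lborel. (\<lambda>i. ennreal \<bar>f z - s i z\<bar>) \<longlonglongrightarrow> 0"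
      proof (intro AE_I2)
        fix z :: "'d phase"
        have "(\<lambda>i. ennreal \<bar>f z - s i z\<bar>) \<longlonglongrightarrow> ennreal \<bar>f z - f z\<bar>"
          by (intro tendsto_intros cv)
        then show "(\<lambda>i. ennreal \<bar>f z - s i z\<bar>) \<longlonglongrightarrow> 0" by simp
      qed
    qed measurable
    then have "(\<lambda>i. \<integral>\<^sup>+z. ennreal \<bar>f z - s i z\<bar> \<partial>lborel) \<longlonglongrightarrow> 0" by simp
    then have "eventually (\<lambda>i. (\<integral>\<^sup>+z. ennreal \<bar>f z - s i z\<bar> \<partial>lborel) < ennreal e) sequentially"
      using e by (intro order_tendstoD) auto
    then obtain i where "(\<integral>\<^sup>+z. ennreal \<bar>f z - s i z\<bar> \<partial>lborel) < ennreal e"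
      using eventually_happens by force
    then show "\<exists>v. v \<in> borel_measurable borel \<and> (\<lambda>n. osc (a n) (b n) v) \<longlonglongrightarrow> 0
      \<and> (\<integral>\<^sup>+z. ennreal \<bar>f z - v z\<bar> \<partial>lborel) \<le> ennreal e"
      using lim by (intro exI[of _ "s i"]) auto
  qed measurable
qed

section \<open>The level set estimate\<close>

lemma nn_integral_powr_from_0:
  fixes c x :: real
  assumes "0 < x" "0 \<le> c"
  shows "(\<integral>\<^sup>+s. ennreal (s powr (x - 1)) * indicator {0..c} s \<partial>lborel) = ennreal (c powr x / x)"
  using nn_integral_has_integral_lebesgue'[OF _ has_integral_powr_from_0[of "x - 1" c]] assms by simp

lemma nn_integral_powr_to_inf:
  fixes c x :: real
  assumes "0 < x" "0 < c"
  shows "(\<integral>\<^sup>+s. ennreal (s powr (- 1 - x)) * indicator {c..} s \<partial>lborel) = ennreal (c powr (- x) / x)"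
  using nn_integral_has_integral_lebesgue'[OF _ has_integral_powr_to_inf[of "- 1 - x" c]] assms by simp

lemma borel_measurable_kavg [measurable]:
  fixes G :: "'d::finite phase \<Rightarrow> ennreal"
  assumes [measurable]: "a \<in> borel_measurable M" "b \<in> borel_measurable M" "z \<in> borel_measurable M" "G \<in> borel_measurable borel"
  shows "(\<lambda>x. kavg (a x) (b x) G (z x)) \<in> borel_measurable M"
proof -
  have "(\<lambda>(x, \<zeta>). G (kmap (a x) (b x) (z x) \<zeta>) * indicator (cball 0 1) \<zeta>) \<in> borel_measurable (M \<Otimes>\<^sub>M lborel)"
    unfolding split_beta by measurable
  from lborel.borel_measurable_nn_integral[OF this] show ?thesis
    unfolding kavg_def by simp
qed

lemma nn_integral_kavg:
  fixes G :: "'d::finite phase \<Rightarrow> ennreal"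
  assumes [measurable]: "G \<in> borel_measurable borel"
  shows "(\<integral>\<^sup>+z. kavg a b G z \<partial>lborel) = emeasure lborel (cball 0 1 :: 'd phase set) * (\<integral>\<^sup>+z. G z \<partial>lborel)"
  unfolding nn_integral_pair_kmap[OF assms, of a b, symmetric] kavg_def
  by (subst lborel.nn_integral_fst[symmetric]) simp_all

lemma emeasure_unit_ball:
  "emeasure lborel (cball 0 1 :: 'a::euclidean_space set) = ennreal (measure lborel (cball 0 1 :: 'a set))"
  using emeasure_bounded_finite[of "cball 0 1 :: 'a set"] by (intro emeasure_eq_ennreal_measure) auto

lemma measure_unit_ball_pos: "0 < measure lborel (cball 0 1 :: 'a::euclidean_space set)"
  by (rule content_cball_pos) simp

text \<open>Averaging multiplies the L^1 mass by the volume of the unit ball at every scale, so only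
  the integral of s^(x-1) over [0, r] remains. This is the L^1 bound for the large values of the
  data.\<close>

lemma near_mass:
  fixes G :: "'d::finite phase \<Rightarrow> ennreal"
  assumes [measurable]: "G \<in> borel_measurable borel" "a \<in> borel_measurable borel" "b \<in> borel_measurable borel"
    and "0 < x" "0 \<le> r" "0 \<le> K"
  shows "(\<integral>\<^sup>+z. \<integral>\<^sup>+s. ennreal (K * s powr (x - 1)) * kavg (a s) (b s) G z * indicator {0..r} s \<partial>lborel \<partial>lborel)
    = ennreal (K * measure lborel (cball 0 1 :: 'd phase set) * (r powr x / x)) * (\<integral>\<^sup>+z. G z \<partial>lborel)"
proof -
  let ?V = "measure lborel (cball 0 1 :: 'd phase set)"
  have "(\<integral>\<^sup>+z. \<integral>\<^sup>+s. ennreal (K * s powr (x - 1)) * kavg (a s) (b s) G z * indicator {0..r} s \<partial>lborel \<partial>lborel)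
      = (\<integral>\<^sup>+s. \<integral>\<^sup>+z. ennreal (K * s powr (x - 1)) * kavg (a s) (b s) G z * indicator {0..r} s \<partial>lborel \<partial>lborel)"
    by (rule lborel_pair.Fubini') (unfold split_beta, measurable)
  also have "\<dots> = (\<integral>\<^sup>+s. (ennreal K * ennreal ?V * (\<integral>\<^sup>+z. G z \<partial>lborel)) * (ennreal (s powr (x - 1)) * indicator {0..r} s) \<partial>lborel)"
    using assms(6)
    by (intro nn_integral_cong)
       (simp add: nn_integral_multc nn_integral_cmult nn_integral_kavg emeasure_unit_ball ennreal_mult mult_ac)
  also have "\<dots> = (ennreal K * ennreal ?V * (\<integral>\<^sup>+z. G z \<partial>lborel)) * ennreal (r powr x / x)"
    by (subst nn_integral_cmult) (simp_all add: nn_integral_powr_from_0 assms)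
  also have "\<dots> = ennreal (K * ?V * (r powr x / x)) * (\<integral>\<^sup>+z. G z \<partial>lborel)"
  proof -
    have "0 \<le> r powr x / x" using assms by simp
    then have "ennreal (K * ?V * (r powr x / x)) = ennreal K * ennreal ?V * ennreal (r powr x / x)"
      using assms(6) by (simp only: ennreal_mult measure_nonneg mult_nonneg_nonneg)
    then show ?thesis by (simp add: mult_ac)
  qed
  finally show ?thesis .
qed

lemma kavg_truncate:
  fixes G :: "'d::finite phase \<Rightarrow> real"
  assumes [measurable]: "G \<in> borel_measurable borel" and "0 \<le> h"
  shows "kavg a b (\<lambda>z. ennreal (G z)) z
    \<le> ennreal (h * measure lborel (cball 0 1 :: 'd phase set)) + kavg a b (\<lambda>z. ennreal (G z) * indicator {w. h < G w} z) z"
proof -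
  have "kavg a b (\<lambda>z. ennreal (G z)) z \<le> (\<integral>\<^sup>+\<zeta>. ennreal h * indicator (cball 0 1) \<zeta>
      + ennreal (G (kmap a b z \<zeta>)) * indicator {w. h < G w} (kmap a b z \<zeta>) * indicator (cball 0 1) \<zeta> \<partial>lborel)"
    unfolding kavg_def
    by (intro nn_integral_mono) (auto simp: indicator_def not_less intro: ennreal_leI)
  also have "\<dots> = ennreal h * emeasure lborel (cball 0 1 :: 'd phase set) + kavg a b (\<lambda>z. ennreal (G z) * indicator {w. h < G w} z) z"
    unfolding kavg_def by (subst nn_integral_add) (simp_all add: nn_integral_cmult_indicator)
  finally show ?thesis
    using assms(2) by (simp add: emeasure_unit_ball ennreal_mult)
qed

lemma kavg_decay:
  fixes G :: "'d::finite phase \<Rightarrow> real"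
  assumes G: "in_Lp p G" and p: "1 \<le> p" and I: "(\<integral>z. norm (G z) powr p \<partial>lborel) \<le> I"
    and ab: "0 < a" "0 < b" and s: "0 < s" "a ^ (CARD('d) + 1) * b ^ (2 * CARD('d)) = s"
  shows "kavg a b (\<lambda>z. ennreal \<bar>G z\<bar>) z \<le> ennreal ((measure lborel (cball 0 1 :: 'd phase set) + I) * s powr (- 1 / p))"
proof -
  let ?V = "measure lborel (cball 0 1 :: 'd phase set)"
  \<comment> \<open>The cut that balances the two terms of \<open>kavg_le\<close>: it satisfies
    c^(1-p) / s = c.\<close>
  let ?c = "s powr (- 1 / p)"
  have "?c powr (1 - p) / s = ?c powr (1 - p) * s powr (- 1)"
    using s by (simp add: powr_minus_divide)
  also have "\<dots> = s powr ((- 1 / p) * (1 - p) + - 1)"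
    by (simp only: powr_powr powr_add)
  also have "(- 1 / p) * (1 - p) + - 1 = - 1 / p"
    using p by (simp add: field_simps)
  finally have c: "?c powr (1 - p) / s = ?c" .
  have "kavg a b (\<lambda>z. ennreal \<bar>G z\<bar>) z \<le> ennreal (?c * ?V + ?c powr (1 - p) / s * (\<integral>z. norm (G z) powr p \<partial>lborel))"
    using kavg_le[OF G p _ ab, of ?c z] s by simp
  also have "\<dots> \<le> ennreal (?c * ?V + ?c * I)"
    unfolding c using I by (intro ennreal_leI add_left_mono mult_left_mono) auto
  finally show ?thesis by (simp add: algebra_simps)
qed

text \<open>All that the real-variable part of the argument uses. In the application
  \<open>G\<close> is \<open>b0\<close> times the norm of the gradient and \<open>H\<close> is
  \<open>a0 / b0\<close> times the norm of the source; the equation enters through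
  \<open>key\<close> alone.\<close>

locale kinetic_estimate =
  fixes f G H :: "'d::finite phase \<Rightarrow> real" and p \<mu> q \<beta> \<kappa> a0 b0 K :: real
  assumes f: "in_Lp 2 f" and G: "in_Lp p G" and H: "in_Lp \<mu> H"
    and p: "1 < p" and \<mu>: "1 < \<mu>" and q: "0 < q"
    and \<beta>: "0 < \<beta>" "\<beta> = 1 / p - 1 / q" and \<kappa>: "0 < \<kappa>" "\<kappa> = 1 / \<mu> - 1 / q"
    and a0: "0 < a0" and b0: "0 < b0" and K: "0 < K"
    and hom: "(real CARD('d) + 1) * (\<beta> + \<kappa>) + 2 * real CARD('d) * \<beta> = 1"
    and vol: "a0 ^ (CARD('d) + 1) * b0 ^ (2 * CARD('d)) = 1"
    and G1: "\<And>z. 0 \<le> G z" "(\<integral>z. norm (G z) powr p \<partial>lborel) \<le> 1"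
    and H1: "\<And>z. 0 \<le> H z" "(\<integral>z. norm (H z) powr \<mu> \<partial>lborel) \<le> 1"
    and key: "\<And>z \<epsilon> r. 0 < \<epsilon> \<Longrightarrow> \<epsilon> \<le> r \<Longrightarrow>
      ennreal \<bar>kmean (a0 * r powr (\<beta> + \<kappa>)) (b0 * r powr \<beta>) f z - kmean (a0 * \<epsilon> powr (\<beta> + \<kappa>)) (b0 * \<epsilon> powr \<beta>) f z\<bar>
      \<le> (\<integral>\<^sup>+s. (ennreal (K * s powr (\<beta> - 1)) * kavg (a0 * s powr (\<beta> + \<kappa>)) (b0 * s powr \<beta>) (\<lambda>z. ennreal (G z)) z
        + ennreal (K * s powr (\<kappa> - 1)) * kavg (a0 * s powr (\<beta> + \<kappa>)) (b0 * s powr \<beta>) (\<lambda>z. ennreal (H z)) z)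
          * indicator {\<epsilon>..r} s \<partial>lborel)"
begin

definition "a s = a0 * s powr (\<beta> + \<kappa>)"
definition "b s = b0 * s powr \<beta>"
definition "V = measure lborel (cball 0 1 :: 'd phase set)"
definition "c0 = (\<integral>\<zeta>. bump 0 (\<zeta> :: 'd phase) \<partial>lborel)"

lemma ab: "0 < s \<Longrightarrow> 0 < a s" "0 < s \<Longrightarrow> 0 < b s"
  using a0 b0 by (auto simp: a_def b_def)

lemma jac: "0 < s \<Longrightarrow> a s ^ (CARD('d) + 1) * b s ^ (2 * CARD('d)) = s"
  unfolding a_def b_def by (rule scale_volume[OF _ vol hom])

lemma V: "0 < V"
  unfolding V_def by (rule measure_unit_ball_pos)

lemma meas [measurable]: "f \<in> borel_measurable borel" "G \<in> borel_measurable borel" "H \<in> borel_measurable borel"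
    "a \<in> borel_measurable borel" "b \<in> borel_measurable borel"
    "(bump 0 :: 'd phase \<Rightarrow> real) \<in> borel_measurable borel"
  using f G H unfolding a_def b_def in_Lp_def
  by (auto intro!: borel_measurable_continuous_onI continuous_on_bump)

lemma bump_le: "\<bar>bump 0 (\<zeta> :: 'd phase)\<bar> \<le> 1 * indicator (cball 0 1) \<zeta>"
proof (cases "\<zeta> \<in> cball 0 1")
  case True
  then show ?thesis by (simp add: bump_def flat_def)
qed (simp add: bump_eq_0)

lemma integrable_bump: "integrable lborel (bump 0 :: 'd phase \<Rightarrow> real)"
proof (rule Bochner_Integration.integrable_bound)
  show "integrable lborel (\<lambda>\<zeta>. 1 * indicator (cball 0 1) (\<zeta> :: 'd phase) :: real)"
    using emeasure_bounded_finite[of "cball 0 1 :: 'd phase set"] by simp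
  show "AE \<zeta> in lborel. norm (bump 0 (\<zeta> :: 'd phase)) \<le> norm (1 * indicator (cball 0 1) \<zeta> :: real)"
    using bump_le by simp
qed measurable

lemma c0: "0 < c0"
proof -
  have "0 \<le> c0" unfolding c0_def by (intro Bochner_Integration.integral_nonneg bump_nonneg)
  moreover have "c0 \<noteq> 0"
  proof
    assume "c0 = 0"
    then have "AE \<zeta> in lborel. bump 0 (\<zeta> :: 'd phase) = 0"
      unfolding c0_def using integral_nonneg_eq_0_iff_AE[OF integrable_bump] bump_nonneg by auto
    then have "AE \<zeta> in lborel. \<zeta> \<notin> ball (0 :: 'd phase) 1"
      by eventually_elim (metis bump_pos less_irrefl)
    then have "emeasure lborel (ball (0 :: 'd phase) 1) = 0"
      by (subst (asm) AE_iff_measurable[of "ball 0 1"]) auto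
    moreover have "0 < measure lborel (ball (0 :: 'd phase) 1)"
      by (rule content_ball_pos) simp
    ultimately show False by (simp add: measure_def)
  qed
  ultimately show ?thesis by simp
qed

lemma key': "0 < \<epsilon> \<Longrightarrow> \<epsilon> \<le> r \<Longrightarrow> ennreal \<bar>kmean (a r) (b r) f z - kmean (a \<epsilon>) (b \<epsilon>) f z\<bar>
      \<le> (\<integral>\<^sup>+s. (ennreal (K * s powr (\<beta> - 1)) * kavg (a s) (b s) (\<lambda>z. ennreal (G z)) z
        + ennreal (K * s powr (\<kappa> - 1)) * kavg (a s) (b s) (\<lambda>z. ennreal (H z)) z) * indicator {\<epsilon>..r} s \<partial>lborel)"
  unfolding a_def b_def by (rule key)

text \<open>Two data terms, each at most K (V + 1) s^(-1-1/q), integrated over s from r to infinity,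
  which contributes q r^(-1/q).\<close>

definition "Kf = 2 * K * (V + 1) * q"

lemma Kf: "0 < Kf"
  using K V q by (simp add: Kf_def)

text \<open>The average is compared with the one at a larger scale \<open>R\<close>. As
  \<open>R\<close> tends to infinity the latter vanishes because \<open>f\<close> is in L^2, while
  the bound for the difference does not depend on \<open>R\<close>.\<close>

lemma far:
  assumes r: "0 < r"
  shows "\<bar>kmean (a r) (b r) f z\<bar> \<le> Kf * r powr (- 1 / q)"
proof -
  let ?I = "\<integral>z. norm (f z) powr 2 \<partial>lborel"
  have I: "0 \<le> ?I" by simp
  have "\<bar>kmean (a r) (b r) f z\<bar> \<le> Kf * r powr (- 1 / q) + (V + ?I) * R powr (- 1 / 2)" if R: "r \<le> R" for R
  proof -
    have R0: "0 < R" using r R by simp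
    have "ennreal \<bar>kmean (a R) (b R) f z\<bar> \<le> (\<integral>\<^sup>+\<zeta>. ennreal \<bar>f (kmap (a R) (b R) z \<zeta>) * bump 0 \<zeta>\<bar> \<partial>lborel)"
      unfolding kmean_def by (rule ennreal_abs_integral_le)
    also have "\<dots> \<le> ennreal 1 * kavg (a R) (b R) (\<lambda>z. ennreal \<bar>f z\<bar>) z"
      using integrable_kmap_mult(2)[OF f _ ab[OF R0] _ bump_le, of z] by simp
    also have "\<dots> \<le> ennreal ((V + ?I) * R powr (- 1 / 2))"
      using kavg_decay[OF f _ order_refl ab[OF R0] R0 jac[OF R0], of z] by (simp add: V_def)
    finally have far1: "\<bar>kmean (a R) (b R) f z\<bar> \<le> (V + ?I) * R powr (- 1 / 2)"
      using V I by (subst (asm) ennreal_le_iff) auto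
    have "ennreal \<bar>kmean (a R) (b R) f z - kmean (a r) (b r) f z\<bar>
        \<le> (\<integral>\<^sup>+s. (ennreal (K * s powr (\<beta> - 1)) * kavg (a s) (b s) (\<lambda>z. ennreal (G z)) z
        + ennreal (K * s powr (\<kappa> - 1)) * kavg (a s) (b s) (\<lambda>z. ennreal (H z)) z) * indicator {r..R} s \<partial>lborel)"
      by (rule key'[OF r R])
    also have "\<dots> \<le> (\<integral>\<^sup>+s. ennreal (2 * K * (V + 1)) * (ennreal (s powr (- 1 - 1 / q)) * indicator {r..} s) \<partial>lborel)"
    proof (rule nn_integral_mono)
      fix s
      show "(ennreal (K * s powr (\<beta> - 1)) * kavg (a s) (b s) (\<lambda>z. ennreal (G z)) z
        + ennreal (K * s powr (\<kappa> - 1)) * kavg (a s) (b s) (\<lambda>z. ennreal (H z)) z) * indicator {r..R} s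
        \<le> ennreal (2 * K * (V + 1)) * (ennreal (s powr (- 1 - 1 / q)) * indicator {r..} s)"
      proof (cases "s \<in> {r..R}")
        case True
        then have s: "0 < s" "r \<le> s" using r by auto
        have g: "kavg (a s) (b s) (\<lambda>z. ennreal (G z)) z \<le> ennreal ((V + 1) * s powr (- 1 / p))"
          using kavg_decay[OF G _ G1(2) ab[OF s(1)] s(1) jac[OF s(1)], of z] p G1(1) by (simp add: V_def)
        have h: "kavg (a s) (b s) (\<lambda>z. ennreal (H z)) z \<le> ennreal ((V + 1) * s powr (- 1 / \<mu>))"
          using kavg_decay[OF H _ H1(2) ab[OF s(1)] s(1) jac[OF s(1)], of z] \<mu> H1(1) by (simp add: V_def)
        \<comment> \<open>The definitions of \<beta> and \<kappa> are made for these two identities: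
          both data decay at the same rate.\<close>
        have e1: "s powr (\<beta> - 1) * s powr (- 1 / p) = s powr (- 1 - 1 / q)"
          unfolding powr_add[symmetric] by (rule arg_cong[where f="(powr) s"]) (simp add: \<beta>(2))
        have e2: "s powr (\<kappa> - 1) * s powr (- 1 / \<mu>) = s powr (- 1 - 1 / q)"
          unfolding powr_add[symmetric] by (rule arg_cong[where f="(powr) s"]) (simp add: \<kappa>(2))
        have "ennreal (K * s powr (\<beta> - 1)) * kavg (a s) (b s) (\<lambda>z. ennreal (G z)) z
            + ennreal (K * s powr (\<kappa> - 1)) * kavg (a s) (b s) (\<lambda>z. ennreal (H z)) z
          \<le> ennreal (K * s powr (\<beta> - 1)) * ennreal ((V + 1) * s powr (- 1 / p))
            + ennreal (K * s powr (\<kappa> - 1)) * ennreal ((V + 1) * s powr (- 1 / \<mu>))"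
          by (intro add_mono mult_left_mono g h) auto
        also have "\<dots> = ennreal (K * (V + 1) * (s powr (\<beta> - 1) * s powr (- 1 / p)) + K * (V + 1) * (s powr (\<kappa> - 1) * s powr (- 1 / \<mu>)))"
          using K V by (simp add: ennreal_mult[symmetric] ennreal_plus[symmetric] mult_ac del: ennreal_plus)
        also have "\<dots> = ennreal (2 * K * (V + 1) * s powr (- 1 - 1 / q))"
          unfolding e1 e2 by (simp only: mult_2 distrib_right)
        also have "\<dots> = ennreal (2 * K * (V + 1)) * ennreal (s powr (- 1 - 1 / q))"
          using K V by (intro ennreal_mult) auto
        finally show ?thesis using True s by simp
      qed simp
    qed
    also have "\<dots> = ennreal (2 * K * (V + 1)) * ennreal (r powr (- (1 / q)) / (1 / q))"
      using q r by (subst nn_integral_cmult) (simp_all add: nn_integral_powr_to_inf[of "1 / q" r, simplified])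
    also have "\<dots> = ennreal (Kf * r powr (- 1 / q))"
      using K V q by (subst ennreal_mult[symmetric]) (auto simp: Kf_def)
    finally have "\<bar>kmean (a R) (b R) f z - kmean (a r) (b r) f z\<bar> \<le> Kf * r powr (- 1 / q)"
      using Kf by (subst (asm) ennreal_le_iff) auto
    then show ?thesis using far1 by linarith
  qed
  then have ev: "eventually (\<lambda>R. \<bar>kmean (a r) (b r) f z\<bar> \<le> Kf * r powr (- 1 / q) + (V + ?I) * R powr (- 1 / 2)) at_top"
    using eventually_ge_at_top[of r] by (rule eventually_mono[rotated])
  have "((\<lambda>R. R powr (- 1 / 2)) \<longlongrightarrow> (0::real)) at_top"
    by (rule tendsto_neg_powr) (auto intro: filterlim_ident)
  then have "((\<lambda>R. Kf * r powr (- 1 / q) + (V + ?I) * R powr (- 1 / 2)) \<longlongrightarrow> Kf * r powr (- 1 / q) + (V + ?I) * 0) at_top"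
    by (intro tendsto_intros)
  from tendsto_lowerbound[OF this ev] show ?thesis by simp
qed

text \<open>Values up to the heights \<open>h\<close>, \<open>h'\<close> are bounded uniformly;
  larger ones are kept as integrals down to scale 0. The right-hand side is thus free of \<epsilon>,
  and letting \<epsilon> tend to 0 affects the left-hand side only.\<close>

lemma near:
  assumes e: "0 < \<epsilon>" "\<epsilon> \<le> r" and h: "0 \<le> h" "0 \<le> h'"
  shows "ennreal \<bar>kmean (a r) (b r) f z - kmean (a \<epsilon>) (b \<epsilon>) f z\<bar>
    \<le> ennreal (K * V * h * (r powr \<beta> / \<beta>) + K * V * h' * (r powr \<kappa> / \<kappa>))
      + ((\<integral>\<^sup>+s. ennreal (K * s powr (\<beta> - 1)) * kavg (a s) (b s) (\<lambda>z. ennreal (G z) * indicator {w. h < G w} z) z * indicator {0..r} s \<partial>lborel)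
      + (\<integral>\<^sup>+s. ennreal (K * s powr (\<kappa> - 1)) * kavg (a s) (b s) (\<lambda>z. ennreal (H z) * indicator {w. h' < H w} z) z * indicator {0..r} s \<partial>lborel))"
proof -
  have r: "0 \<le> r" using e by simp
  have one: "(\<integral>\<^sup>+s. ennreal (K * s powr (x - 1)) * kavg (a s) (b s) (\<lambda>z. ennreal (F z)) z * indicator {\<epsilon>..r} s \<partial>lborel)
      \<le> ennreal (K * V * k * (r powr x / x))
        + (\<integral>\<^sup>+s. ennreal (K * s powr (x - 1)) * kavg (a s) (b s) (\<lambda>z. ennreal (F z) * indicator {w. k < F w} z) z * indicator {0..r} s \<partial>lborel)"
    if [measurable]: "F \<in> borel_measurable borel" and k: "0 \<le> k" and x: "0 < x" for F x k
  proof -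
    let ?F = "\<lambda>z. ennreal (F z) * indicator {w. k < F w} z"
    have "(\<integral>\<^sup>+s. ennreal (K * s powr (x - 1)) * kavg (a s) (b s) (\<lambda>z. ennreal (F z)) z * indicator {\<epsilon>..r} s \<partial>lborel)
        \<le> (\<integral>\<^sup>+s. ennreal (K * V * k) * (ennreal (s powr (x - 1)) * indicator {0..r} s)
          + ennreal (K * s powr (x - 1)) * kavg (a s) (b s) ?F z * indicator {0..r} s \<partial>lborel)"
    proof (rule nn_integral_mono)
      fix s
      show "ennreal (K * s powr (x - 1)) * kavg (a s) (b s) (\<lambda>z. ennreal (F z)) z * indicator {\<epsilon>..r} s
        \<le> ennreal (K * V * k) * (ennreal (s powr (x - 1)) * indicator {0..r} s)
          + ennreal (K * s powr (x - 1)) * kavg (a s) (b s) ?F z * indicator {0..r} s"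
      proof (cases "s \<in> {\<epsilon>..r}")
        case True
        have "ennreal (K * s powr (x - 1)) * kavg (a s) (b s) (\<lambda>z. ennreal (F z)) z
            \<le> ennreal (K * s powr (x - 1)) * (ennreal (k * V) + kavg (a s) (b s) ?F z)"
          unfolding V_def using k by (intro mult_left_mono kavg_truncate) auto
        also have "\<dots> = ennreal (K * V * k) * ennreal (s powr (x - 1)) + ennreal (K * s powr (x - 1)) * kavg (a s) (b s) ?F z"
          using K V k by (simp add: distrib_left ennreal_mult[symmetric] mult_ac)
        finally show ?thesis using True e by simp
      qed simp
    qed
    also have "\<dots> = (\<integral>\<^sup>+s. ennreal (K * V * k) * (ennreal (s powr (x - 1)) * indicator {0..r} s) \<partial>lborel)
        + (\<integral>\<^sup>+s. ennreal (K * s powr (x - 1)) * kavg (a s) (b s) ?F z * indicator {0..r} s \<partial>lborel)"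
      by (rule nn_integral_add) measurable
    also have "(\<integral>\<^sup>+s. ennreal (K * V * k) * (ennreal (s powr (x - 1)) * indicator {0..r} s) \<partial>lborel)
        = ennreal (K * V * k) * ennreal (r powr x / x)"
      by (subst nn_integral_cmult) (simp_all add: nn_integral_powr_from_0[OF x r])
    also have "\<dots> = ennreal (K * V * k * (r powr x / x))"
      using K V k x by (intro ennreal_mult[symmetric]) auto
    finally show ?thesis .
  qed
  have "ennreal \<bar>kmean (a r) (b r) f z - kmean (a \<epsilon>) (b \<epsilon>) f z\<bar>
      \<le> (\<integral>\<^sup>+s. ennreal (K * s powr (\<beta> - 1)) * kavg (a s) (b s) (\<lambda>z. ennreal (G z)) z * indicator {\<epsilon>..r} s
        + ennreal (K * s powr (\<kappa> - 1)) * kavg (a s) (b s) (\<lambda>z. ennreal (H z)) z * indicator {\<epsilon>..r} s \<partial>lborel)"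
    using key'[OF e, of z] by (simp only: distrib_right)
  also have "\<dots> = (\<integral>\<^sup>+s. ennreal (K * s powr (\<beta> - 1)) * kavg (a s) (b s) (\<lambda>z. ennreal (G z)) z * indicator {\<epsilon>..r} s \<partial>lborel)
        + (\<integral>\<^sup>+s. ennreal (K * s powr (\<kappa> - 1)) * kavg (a s) (b s) (\<lambda>z. ennreal (H z)) z * indicator {\<epsilon>..r} s \<partial>lborel)"
    by (rule nn_integral_add) measurable
  also note add_mono[OF one[OF meas(2) h(1) \<beta>(1)] one[OF meas(3) h(2) \<kappa>(1)]]
  finally show ?thesis
    using K V h \<beta>(1) \<kappa>(1) by (subst ennreal_plus) (auto simp: add_ac)
qed

text \<open>\<open>f\<close> itself need not be integrable, so \<open>osc_tendsto\<close> is
  reserved for a function \<open>u\<close> uniformly close to \<open>f\<close>. The discrepancy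
  enters once at the displaced point and once at \<open>z\<close>, whence the factor 2.\<close>

lemma kmean_approx:
  fixes u :: "'d phase \<Rightarrow> real"
  assumes e: "0 < \<epsilon>" and [measurable]: "u \<in> borel_measurable borel" and \<delta>: "0 \<le> \<delta>" "\<And>z. \<bar>f z - u z\<bar> \<le> \<delta>"
  shows "ennreal \<bar>kmean (a \<epsilon>) (b \<epsilon>) f z - c0 * f z\<bar>
    \<le> ennreal (2 * \<delta> * V) + (\<integral>\<^sup>+\<zeta>. ennreal \<bar>u (kmap (a \<epsilon>) (b \<epsilon>) z \<zeta>) - u z\<bar> * indicator (cball 0 1) \<zeta> \<partial>lborel)"
proof -
  let ?k = "kmap (a \<epsilon>) (b \<epsilon>) z"
  have "kmean (a \<epsilon>) (b \<epsilon>) f z - c0 * f z = (\<integral>\<zeta>. f (?k \<zeta>) * bump 0 \<zeta> \<partial>lborel) - (\<integral>\<zeta>. f z * bump 0 (\<zeta> :: 'd phase) \<partial>lborel)"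
    by (simp add: kmean_def c0_def)
  also have "\<dots> = (\<integral>\<zeta>. f (?k \<zeta>) * bump 0 \<zeta> - f z * bump 0 \<zeta> \<partial>lborel)"
    using integrable_kmap_mult(1)[OF f _ ab[OF e] _ bump_le, of z] integrable_bump
    by (intro Bochner_Integration.integral_diff[symmetric]) auto
  finally have "ennreal \<bar>kmean (a \<epsilon>) (b \<epsilon>) f z - c0 * f z\<bar> \<le> (\<integral>\<^sup>+\<zeta>. ennreal \<bar>f (?k \<zeta>) * bump 0 \<zeta> - f z * bump 0 \<zeta>\<bar> \<partial>lborel)"
    by (simp only: ennreal_abs_integral_le)
  also have "\<dots> \<le> (\<integral>\<^sup>+\<zeta>. ennreal (2 * \<delta>) * indicator (cball 0 1) \<zeta>
      + ennreal \<bar>u (?k \<zeta>) - u z\<bar> * indicator (cball 0 1) \<zeta> \<partial>lborel)"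
  proof (rule nn_integral_mono)
    fix \<zeta>
    have "\<bar>f (?k \<zeta>) * bump 0 \<zeta> - f z * bump 0 \<zeta>\<bar> = \<bar>f (?k \<zeta>) - f z\<bar> * \<bar>bump 0 \<zeta>\<bar>"
      by (simp add: left_diff_distrib[symmetric] abs_mult)
    also have "\<dots> \<le> (2 * \<delta> + \<bar>u (?k \<zeta>) - u z\<bar>) * (1 * indicator (cball 0 1) \<zeta>)"
      using \<delta>(2)[of "?k \<zeta>"] \<delta>(2)[of z] by (intro mult_mono bump_le) auto
    finally have "ennreal \<bar>f (?k \<zeta>) * bump 0 \<zeta> - f z * bump 0 \<zeta>\<bar> \<le> ennreal ((2 * \<delta> + \<bar>u (?k \<zeta>) - u z\<bar>) * (1 * indicator (cball 0 1) \<zeta>))"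
      by (rule ennreal_leI)
    also have "\<dots> = ennreal (2 * \<delta>) * indicator (cball 0 1) \<zeta> + ennreal \<bar>u (?k \<zeta>) - u z\<bar> * indicator (cball 0 1) \<zeta>"
      using \<delta>(1) by (simp add: indicator_def ennreal_plus)
    finally show "ennreal \<bar>f (?k \<zeta>) * bump 0 \<zeta> - f z * bump 0 \<zeta>\<bar>
        \<le> ennreal (2 * \<delta>) * indicator (cball 0 1) \<zeta> + ennreal \<bar>u (?k \<zeta>) - u z\<bar> * indicator (cball 0 1) \<zeta>" .
  qed
  also have "\<dots> = ennreal (2 * \<delta>) * ennreal V + (\<integral>\<^sup>+\<zeta>. ennreal \<bar>u (?k \<zeta>) - u z\<bar> * indicator (cball 0 1) \<zeta> \<partial>lborel)"
    by (subst nn_integral_add) (simp_all add: nn_integral_cmult_indicator emeasure_unit_ball V_def)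
  also have "ennreal (2 * \<delta>) * ennreal V = ennreal (2 * \<delta> * V)"
    using \<delta>(1) V by (intro ennreal_mult[symmetric]) auto
  finally show ?thesis .
qed

lemma ab_tendsto: "(\<lambda>n. a (1 / real (Suc n))) \<longlonglongrightarrow> 0" "(\<lambda>n. b (1 / real (Suc n))) \<longlonglongrightarrow> 0"
proof -
  have *: "(\<lambda>n. (1 / real (Suc n)) powr x) \<longlonglongrightarrow> 0 powr x" if "0 < x" for x
    using that by (intro tendsto_powr' lim_1_over_n[THEN LIMSEQ_Suc] tendsto_const) auto
  have "(\<lambda>n. a0 * (1 / real (Suc n)) powr (\<beta> + \<kappa>)) \<longlonglongrightarrow> a0 * 0 powr (\<beta> + \<kappa>)"
    using \<beta>(1) \<kappa>(1) by (intro tendsto_intros *) simp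
  then show "(\<lambda>n. a (1 / real (Suc n))) \<longlonglongrightarrow> 0" by (simp add: a_def)
  have "(\<lambda>n. b0 * (1 / real (Suc n)) powr \<beta>) \<longlonglongrightarrow> b0 * 0 powr \<beta>"
    using \<beta>(1) by (intro tendsto_intros *) simp
  then show "(\<lambda>n. b (1 / real (Suc n))) \<longlonglongrightarrow> 0" by (simp add: b_def)
qed

text \<open>With r = (8 Kf / (c0 l))^q, solving K V h r^\<beta> / \<beta> = c0 l / 8 for h gives
  \<open>AG * l powr (q / p)\<close>, because q/p - q \<beta> = 1. \<open>AH\<close> arises in the
  same way from \<kappa> and \<mu>.\<close>

definition "AG = c0 * \<beta> / (8 * K * V) * (8 * Kf / c0) powr (- (q * \<beta>))"
definition "AH = c0 * \<kappa> / (8 * K * V) * (8 * Kf / c0) powr (- (q * \<kappa>))"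

lemma AGH: "0 < AG" "0 < AH"
  using c0 \<beta>(1) \<kappa>(1) K V Kf by (simp_all add: AG_def AH_def)

text \<open>The scale \<open>r\<close> is chosen so that the average at scale \<open>r\<close> is at most an eighth of the level,
  the truncation heights \<open>h\<close>, \<open>h'\<close> so that the bounded parts of \<open>G\<close>, \<open>H\<close> contribute an eighth each.\<close>

lemma level_set:
  assumes l: "0 < l"
  shows "emeasure lborel {z. l \<le> \<bar>f z\<bar>}
    \<le> ennreal (1 / (4 * (AG * l powr (q / p)))) * (\<integral>\<^sup>+z. ennreal (G z) * indicator {w. AG * l powr (q / p) < G w} z \<partial>lborel)
    + ennreal (1 / (4 * (AH * l powr (q / \<mu>)))) * (\<integral>\<^sup>+z. ennreal (H z) * indicator {w. AH * l powr (q / \<mu>) < H w} z \<partial>lborel)"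
proof -
  define X where "X = 8 * Kf / (c0 * l)"
  have X: "0 < X" using Kf c0 l by (simp add: X_def)
  define r where "r = X powr q"
  have r: "0 < r" using X by (simp add: r_def)
  define h where "h = AG * l powr (q / p)"
  define h' where "h' = AH * l powr (q / \<mu>)"
  have h: "0 < h" "0 < h'" using AGH l by (auto simp: h_def h'_def)
  have scale: "r powr x = (8 * Kf / c0) powr (q * x) * l powr (- (q * x))" for x
  proof -
    have "r powr x = (8 * Kf / c0 / l) powr (q * x)"
      by (simp add: r_def powr_powr X_def)
    also have "\<dots> = (8 * Kf / c0) powr (q * x) / l powr (q * x)"
      by (rule powr_divide)
    finally show ?thesis by (simp add: powr_minus_divide)
  qed
  have hr: "K * V * h * (r powr \<beta> / \<beta>) = c0 * l / 8"
  proof -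
    have "l powr (q / p) * l powr (- (q * \<beta>)) = l powr 1"
      unfolding powr_add[symmetric] using q p by (simp add: \<beta>(2) field_simps)
    moreover have "(8 * Kf / c0) powr (- (q * \<beta>)) * (8 * Kf / c0) powr (q * \<beta>) = 1"
      unfolding powr_add[symmetric] using Kf c0 by simp
    ultimately have "(8 * Kf / c0) powr (- (q * \<beta>)) * (8 * Kf / c0) powr (q * \<beta>) * (l powr (q / p) * l powr (- (q * \<beta>))) = l"
      using l by simp
    moreover have "K * V * h * (r powr \<beta> / \<beta>) = c0 / 8 * ((8 * Kf / c0) powr (- (q * \<beta>)) * (8 * Kf / c0) powr (q * \<beta>) * (l powr (q / p) * l powr (- (q * \<beta>))))"
      unfolding scale h_def AG_def using K V \<beta>(1) by simp
    ultimately show ?thesis by simp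
  qed
  have hr': "K * V * h' * (r powr \<kappa> / \<kappa>) = c0 * l / 8"
  proof -
    have "l powr (q / \<mu>) * l powr (- (q * \<kappa>)) = l powr 1"
      unfolding powr_add[symmetric] using q \<mu> by (simp add: \<kappa>(2) field_simps)
    moreover have "(8 * Kf / c0) powr (- (q * \<kappa>)) * (8 * Kf / c0) powr (q * \<kappa>) = 1"
      unfolding powr_add[symmetric] using Kf c0 by simp
    ultimately have "(8 * Kf / c0) powr (- (q * \<kappa>)) * (8 * Kf / c0) powr (q * \<kappa>) * (l powr (q / \<mu>) * l powr (- (q * \<kappa>))) = l"
      using l by simp
    moreover have "K * V * h' * (r powr \<kappa> / \<kappa>) = c0 / 8 * ((8 * Kf / c0) powr (- (q * \<kappa>)) * (8 * Kf / c0) powr (q * \<kappa>) * (l powr (q / \<mu>) * l powr (- (q * \<kappa>))))"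
      unfolding scale h'_def AH_def using K V \<kappa>(1) by simp
    ultimately show ?thesis by simp
  qed
  have farr: "\<bar>kmean (a r) (b r) f z\<bar> \<le> c0 * l / 8" for z
  proof -
    have "Kf * r powr (- 1 / q) = Kf * X powr (- 1)"
      using q by (simp add: r_def powr_powr)
    also have "\<dots> = c0 * l / 8"
      using X Kf c0 l by (simp add: powr_minus_divide X_def)
    finally show ?thesis using far[OF r, of z] by simp
  qed
  \<comment> \<open>Chosen so that the error 2 \<delta> V of \<open>kmean_approx\<close> is another
    eighth of \<open>c0 * l\<close>. Being positive, it makes the truncation \<open>u\<close>
    integrable, since |u| is at most |f|^2 / \<delta>.\<close>
  define \<delta> where "\<delta> = c0 * l / (16 * V)"
  have \<delta>: "0 < \<delta>" using c0 l V by (simp add: \<delta>_def)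
  define u where "u z = (if \<delta> < \<bar>f z\<bar> then f z else 0)" for z
  have [measurable]: "u \<in> borel_measurable borel" unfolding u_def by measurable
  have u: "integrable lborel u"
  proof (rule Bochner_Integration.integrable_bound)
    show "integrable lborel (\<lambda>z. norm (f z) powr 2 / \<delta>)"
      using f by (intro integrable_divide) (simp add: in_Lp_def)
    have "\<bar>u z\<bar> \<le> norm (f z) powr 2 / \<delta>" for z
    proof (cases "\<delta> < \<bar>f z\<bar>")
      case True
      then have "\<delta> * \<bar>f z\<bar> \<le> \<bar>f z\<bar> * \<bar>f z\<bar>" by (intro mult_right_mono) auto
      then show ?thesis using True \<delta> by (simp add: u_def field_simps power2_eq_square)
    qed (simp add: u_def \<delta> less_imp_le)
    then show "AE z in lborel. norm (u z) \<le> norm (norm (f z) powr 2 / \<delta>)"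
      using \<delta> by (intro AE_I2) (auto intro: order_trans[OF _ abs_ge_self])
  qed measurable
  define NG where "NG z = (\<integral>\<^sup>+s. ennreal (K * s powr (\<beta> - 1)) * kavg (a s) (b s) (\<lambda>z. ennreal (G z) * indicator {w. h < G w} z) z * indicator {0..r} s \<partial>lborel)" for z
  define NH where "NH z = (\<integral>\<^sup>+s. ennreal (K * s powr (\<kappa> - 1)) * kavg (a s) (b s) (\<lambda>z. ennreal (H z) * indicator {w. h' < H w} z) z * indicator {0..r} s \<partial>lborel)" for z
  define OS where "OS n z = (\<integral>\<^sup>+\<zeta>. ennreal \<bar>u (kmap (a (1 / real (Suc n))) (b (1 / real (Suc n))) z \<zeta>) - u z\<bar> * indicator (cball 0 1) \<zeta> \<partial>lborel)" for n z
  have [measurable]: "NG \<in> borel_measurable lborel" "NH \<in> borel_measurable lborel" "\<And>n. OS n \<in> borel_measurable lborel"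
    unfolding NG_def NH_def OS_def by (intro lborel.borel_measurable_nn_integral, unfold split_beta, measurable)+
  have OS: "(\<integral>\<^sup>+z. OS n z \<partial>lborel) = osc (a (1 / real (Suc n))) (b (1 / real (Suc n))) u" for n
    unfolding OS_def osc_def by (subst lborel.nn_integral_fst[symmetric]) simp_all
  have NG: "(\<integral>\<^sup>+z. NG z \<partial>lborel) = ennreal (c0 * l / (8 * h)) * (\<integral>\<^sup>+z. ennreal (G z) * indicator {w. h < G w} z \<partial>lborel)"
  proof -
    have "K * V * (r powr \<beta> / \<beta>) = c0 * l / (8 * h)"
      using hr h by (simp add: field_simps)
    then show ?thesis
      unfolding NG_def using near_mass[of "\<lambda>z. ennreal (G z) * indicator {w. h < G w} z" a b \<beta> r K] \<beta>(1) r K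
      by (simp add: V_def)
  qed
  have NH: "(\<integral>\<^sup>+z. NH z \<partial>lborel) = ennreal (c0 * l / (8 * h')) * (\<integral>\<^sup>+z. ennreal (H z) * indicator {w. h' < H w} z \<partial>lborel)"
  proof -
    have "K * V * (r powr \<kappa> / \<kappa>) = c0 * l / (8 * h')"
      using hr' h by (simp add: field_simps)
    then show ?thesis
      unfolding NH_def using near_mass[of "\<lambda>z. ennreal (H z) * indicator {w. h' < H w} z" a b \<kappa> r K] \<kappa>(1) r K
      by (simp add: V_def)
  qed
  \<comment> \<open>Four eighths of \<open>c0 * l\<close> are absorbed: one by the approximation at
    the small scale, two by the bounded parts of \<open>G\<close> and \<open>H\<close>, one by the
    average at scale \<open>r\<close>. The remaining half must come from \<open>OS\<close>,
    \<open>NG\<close> and \<open>NH\<close>.\<close>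
  have point: "ennreal (c0 * l / 2) * indicator {z. l \<le> \<bar>f z\<bar>} z \<le> OS n z + (NG z + NH z)"
    if n: "1 / real (Suc n) \<le> r" for n z
  proof (cases "l \<le> \<bar>f z\<bar>")
    case True
    let ?e = "1 / real (Suc n)"
    have e: "0 < ?e" by simp
    have fu: "\<bar>f z - u z\<bar> \<le> \<delta>" for z using \<delta> by (auto simp: u_def)
    have "c0 * l \<le> \<bar>c0 * f z\<bar>"
      using True c0 by (simp add: abs_mult)
    also have "\<dots> \<le> \<bar>kmean (a ?e) (b ?e) f z - c0 * f z\<bar> + (\<bar>kmean (a r) (b r) f z - kmean (a ?e) (b ?e) f z\<bar> + \<bar>kmean (a r) (b r) f z\<bar>)"
      by linarith
    finally have "ennreal (c0 * l) \<le> ennreal \<bar>kmean (a ?e) (b ?e) f z - c0 * f z\<bar>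
        + (ennreal \<bar>kmean (a r) (b r) f z - kmean (a ?e) (b ?e) f z\<bar> + ennreal \<bar>kmean (a r) (b r) f z\<bar>)"
      by (simp add: ennreal_plus[symmetric] ennreal_leI del: ennreal_plus)
    also have "\<dots> \<le> (ennreal (2 * \<delta> * V) + OS n z) + ((ennreal (c0 * l / 8 + c0 * l / 8) + (NG z + NH z)) + ennreal (c0 * l / 8))"
      using kmean_approx[OF e _ less_imp_le[OF \<delta>] fu, of z]
        near[OF e n less_imp_le[OF h(1)] less_imp_le[OF h(2)], of z] farr[of z]
      unfolding hr hr' NG_def[symmetric] NH_def[symmetric] OS_def[symmetric]
      by (intro add_mono ennreal_leI) auto
    also have "2 * \<delta> * V = c0 * l / 8"
      using V by (simp add: \<delta>_def)
    also have "(ennreal (c0 * l / 8) + OS n z) + ((ennreal (c0 * l / 8 + c0 * l / 8) + (NG z + NH z)) + ennreal (c0 * l / 8))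
        = (ennreal (c0 * l / 8) + (ennreal (c0 * l / 8 + c0 * l / 8) + ennreal (c0 * l / 8))) + (OS n z + (NG z + NH z))"
      by (simp add: ac_simps)
    also have "ennreal (c0 * l / 8) + (ennreal (c0 * l / 8 + c0 * l / 8) + ennreal (c0 * l / 8)) = ennreal (c0 * l / 2)"
      using c0 l by (simp add: ennreal_plus[symmetric] del: ennreal_plus)
    also have "ennreal (c0 * l) = ennreal (c0 * l / 2) + ennreal (c0 * l / 2)"
      using c0 l by (subst ennreal_plus[symmetric]) (auto simp: field_simps)
    finally have "ennreal (c0 * l / 2) + ennreal (c0 * l / 2) \<le> ennreal (c0 * l / 2) + (OS n z + (NG z + NH z))" .
    then show ?thesis using True by (simp add: ennreal_add_left_cancel_le)
  qed simp
  have bound: "ennreal (c0 * l / 2) * emeasure lborel {z. l \<le> \<bar>f z\<bar>}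
      \<le> osc (a (1 / real (Suc n))) (b (1 / real (Suc n))) u + ((\<integral>\<^sup>+z. NG z \<partial>lborel) + (\<integral>\<^sup>+z. NH z \<partial>lborel))"
    if n: "1 / real (Suc n) \<le> r" for n
  proof -
    have "ennreal (c0 * l / 2) * emeasure lborel {z. l \<le> \<bar>f z\<bar>}
        = (\<integral>\<^sup>+z. ennreal (c0 * l / 2) * indicator {z. l \<le> \<bar>f z\<bar>} z \<partial>lborel)"
      by (rule nn_integral_cmult_indicator[symmetric]) measurable
    also have "\<dots> \<le> (\<integral>\<^sup>+z. OS n z + (NG z + NH z) \<partial>lborel)"
      by (intro nn_integral_mono point n)
    also have "\<dots> = (\<integral>\<^sup>+z. OS n z \<partial>lborel) + ((\<integral>\<^sup>+z. NG z \<partial>lborel) + (\<integral>\<^sup>+z. NH z \<partial>lborel))"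
      by (subst nn_integral_add, measurable, subst nn_integral_add, measurable)
    finally show ?thesis by (simp add: OS)
  qed
  \<comment> \<open>Only the oscillation depends on \<open>n\<close>, and it tends to 0; the
    pointwise estimate was integrated beforehand, so no almost everywhere convergence is
    required.\<close>
  have "ennreal (c0 * l / 2) * emeasure lborel {z. l \<le> \<bar>f z\<bar>} \<le> 0 + ((\<integral>\<^sup>+z. NG z \<partial>lborel) + (\<integral>\<^sup>+z. NH z \<partial>lborel))"
  proof (rule tendsto_lowerbound)
    show "(\<lambda>n. osc (a (1 / real (Suc n))) (b (1 / real (Suc n))) u + ((\<integral>\<^sup>+z. NG z \<partial>lborel) + (\<integral>\<^sup>+z. NH z \<partial>lborel)))
        \<longlonglongrightarrow> 0 + ((\<integral>\<^sup>+z. NG z \<partial>lborel) + (\<integral>\<^sup>+z. NH z \<partial>lborel))"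
      by (intro tendsto_add tendsto_const osc_tendsto[OF u] ab_tendsto)
    have "eventually (\<lambda>n. 1 / real (Suc n) < r) sequentially"
      using order_tendstoD(2)[OF LIMSEQ_Suc[OF lim_1_over_n] r] by simp
    then show "eventually (\<lambda>n. ennreal (c0 * l / 2) * emeasure lborel {z. l \<le> \<bar>f z\<bar>}
        \<le> osc (a (1 / real (Suc n))) (b (1 / real (Suc n))) u + ((\<integral>\<^sup>+z. NG z \<partial>lborel) + (\<integral>\<^sup>+z. NH z \<partial>lborel))) sequentially"
      by eventually_elim (rule bound, simp)
  qed simp
  then have "ennreal (2 / (c0 * l)) * (ennreal (c0 * l / 2) * emeasure lborel {z. l \<le> \<bar>f z\<bar>})
      \<le> ennreal (2 / (c0 * l)) * ((\<integral>\<^sup>+z. NG z \<partial>lborel) + (\<integral>\<^sup>+z. NH z \<partial>lborel))"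
    by (intro mult_left_mono) auto
  moreover have "ennreal (2 / (c0 * l)) * (ennreal (c0 * l / 2) * E) = E" for E
    using c0 l by (simp add: mult.assoc[symmetric] ennreal_mult'[symmetric])
  moreover have "ennreal (2 / (c0 * l)) * ennreal (c0 * l / (8 * k)) = ennreal (1 / (4 * k))" if "0 < k" for k
    using c0 l that by (subst ennreal_mult[symmetric]) (auto simp: field_simps)
  ultimately have "emeasure lborel {z. l \<le> \<bar>f z\<bar>}
    \<le> ennreal (1 / (4 * h)) * (\<integral>\<^sup>+z. ennreal (G z) * indicator {w. h < G w} z \<partial>lborel)
    + ennreal (1 / (4 * h')) * (\<integral>\<^sup>+z. ennreal (H z) * indicator {w. h' < H w} z \<partial>lborel)"
    unfolding NG NH distrib_left mult.assoc[symmetric]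
    using h by (simp add: mult.assoc[symmetric])
  then show ?thesis unfolding h_def h'_def .
qed

end

section \<open>From level sets to the strong L^q bound\<close>

lemma layer_term:
  fixes F :: "'a::euclidean_space \<Rightarrow> real"
  assumes [measurable]: "F \<in> borel_measurable borel" and F: "\<And>z. 0 \<le> F z" and A: "0 < A" and p: "1 < p" and q: "0 < q"
  shows "(\<integral>\<^sup>+l. ennreal (q * l powr (q - 1)) * indicator {0<..} l * (ennreal (1 / (4 * (A * l powr (q / p))))
      * (\<integral>\<^sup>+z. ennreal (F z) * indicator {w. A * l powr (q / p) < F w} z \<partial>lborel)) \<partial>lborel)
    \<le> ennreal (A powr (- p) / (4 * (1 - 1 / p))) * (\<integral>\<^sup>+z. ennreal (F z powr p) \<partial>lborel)"
proof -
  \<comment> \<open>For fixed \<open>z\<close> the l-integrand is a constant times l^(x-1) up to the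
    level where the truncation height reaches \<open>F z\<close>; p > 1 makes x positive and the
    integral finite at 0.\<close>
  define x where "x = q - q / p"
  have x: "0 < x" using p q by (simp add: x_def field_simps)
  let ?L = "\<lambda>l z. ennreal (q * l powr (q - 1)) * indicator {0<..} l * (ennreal (1 / (4 * (A * l powr (q / p))))
      * (ennreal (F z) * indicator {u. A * l powr (q / p) < u} (F z)))"
  have "(\<integral>\<^sup>+l. ennreal (q * l powr (q - 1)) * indicator {0<..} l * (ennreal (1 / (4 * (A * l powr (q / p))))
      * (\<integral>\<^sup>+z. ennreal (F z) * indicator {w. A * l powr (q / p) < F w} z \<partial>lborel)) \<partial>lborel)
      = (\<integral>\<^sup>+l. \<integral>\<^sup>+z. ?L l z \<partial>lborel \<partial>lborel)"
  proof (rule nn_integral_cong)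
    fix l :: real
    have "(\<integral>\<^sup>+z. ennreal (F z) * indicator {w. A * l powr (q / p) < F w} z \<partial>lborel)
        = (\<integral>\<^sup>+z. ennreal (F z) * indicator {u. A * l powr (q / p) < u} (F z) \<partial>lborel)"
      by (intro nn_integral_cong) (simp add: indicator_def)
    then show "ennreal (q * l powr (q - 1)) * indicator {0<..} l * (ennreal (1 / (4 * (A * l powr (q / p))))
      * (\<integral>\<^sup>+z. ennreal (F z) * indicator {w. A * l powr (q / p) < F w} z \<partial>lborel)) = (\<integral>\<^sup>+z. ?L l z \<partial>lborel)"
      by (simp add: nn_integral_cmult)
  qed
  also have "\<dots> = (\<integral>\<^sup>+z. \<integral>\<^sup>+l. ?L l z \<partial>lborel \<partial>lborel)"
  proof (rule lborel_pair.Fubini'[symmetric])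
    have "(\<lambda>x. ?L (fst x) (snd x)) \<in> borel_measurable (lborel \<Otimes>\<^sub>M lborel)"
    proof -
      have "(\<lambda>x. ?L (fst x) (snd x)) = (\<lambda>x. ennreal (q * fst x powr (q - 1)) * indicator {0<..} (fst x) * (ennreal (1 / (4 * (A * fst x powr (q / p))))
          * (ennreal (F (snd x)) * (if A * fst x powr (q / p) < F (snd x) then 1 else 0))))"
        by (rule ext) (simp add: indicator_def)
      then show ?thesis by simp
    qed
    then show "(\<lambda>(l, z). ?L l z) \<in> borel_measurable (lborel \<Otimes>\<^sub>M lborel)"
      by (simp only: case_prod_unfold)
  qed
  also have "\<dots> \<le> (\<integral>\<^sup>+z. ennreal (A powr (- p) / (4 * (1 - 1 / p))) * ennreal (F z powr p) \<partial>lborel)"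
  proof (rule nn_integral_mono)
    fix z :: 'a
    let ?F = "F z" and ?R = "(F z / A) powr (p / q)"
    have "(\<integral>\<^sup>+l. ?L l z \<partial>lborel) \<le> (\<integral>\<^sup>+l. ennreal (q / (4 * A) * ?F) * (ennreal (l powr (x - 1)) * indicator {0..?R} l) \<partial>lborel)"
    proof (rule nn_integral_mono)
      fix l :: real
      show "?L l z \<le> ennreal (q / (4 * A) * ?F) * (ennreal (l powr (x - 1)) * indicator {0..?R} l)"
      proof (cases "0 < l \<and> A * l powr (q / p) < ?F")
        case True
        then have "l powr (q / p) \<le> ?F / A" using A by (simp add: field_simps)
        then have "(l powr (q / p)) powr (p / q) \<le> ?R"
          using p q by (intro powr_mono2) auto
        then have le: "l \<le> ?R" using True p q by (simp add: powr_powr)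
        have "l powr (q - 1) / l powr (q / p) = l powr (x - 1)"
          unfolding powr_diff[symmetric] by (simp add: x_def algebra_simps)
        moreover have "q * l powr (q - 1) * (1 / (4 * (A * l powr (q / p))) * ?F)
            = q / (4 * A) * ?F * (l powr (q - 1) / l powr (q / p))"
          by (simp add: mult_ac)
        ultimately have e: "q * l powr (q - 1) * (1 / (4 * (A * l powr (q / p))) * ?F) = q / (4 * A) * ?F * l powr (x - 1)"
          by (simp only:)
        have "?L l z = ennreal (q * l powr (q - 1)) * (ennreal (1 / (4 * (A * l powr (q / p)))) * ennreal ?F)"
          using True by simp
        also have "\<dots> = ennreal (q * l powr (q - 1) * (1 / (4 * (A * l powr (q / p))) * ?F))"
        proof -
          have "0 \<le> q * l powr (q - 1)" "0 \<le> 1 / (4 * (A * l powr (q / p)))" using A q by auto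
          then show ?thesis using F[of z] by (simp only: ennreal_mult mult_nonneg_nonneg)
        qed
        also have "\<dots> = ennreal (q / (4 * A) * ?F) * ennreal (l powr (x - 1))"
          unfolding e using A q F[of z] by (intro ennreal_mult) auto
        finally show ?thesis using le True by simp
      qed (auto simp: indicator_def)
    qed
    also have "\<dots> = ennreal (q / (4 * A) * ?F) * ennreal (?R powr x / x)"
      by (subst nn_integral_cmult) (simp_all add: nn_integral_powr_from_0[OF x])
    also have "\<dots> = ennreal (q / (4 * A) * ?F * (?R powr x / x))"
      using A q F[of z] x by (intro ennreal_mult[symmetric]) auto
    also have "q / (4 * A) * ?F * (?R powr x / x) = A powr (- p) / (4 * (1 - 1 / p)) * ?F powr p"
    proof (cases "?F = 0")
      case False
      then have F0: "0 < ?F" using F[of z] by simp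
      \<comment> \<open>This is why the truncation height grows like l^(q/p): the top level to the
        power x is (F/A)^(p-1), and the remaining factor F completes the p-th power.\<close>
      have px: "p / q * x = p - 1" using p q by (simp add: x_def field_simps)
      have "?R powr x = (?F / A) powr (p - 1)"
        by (simp only: powr_powr px)
      also have "\<dots> = ?F powr p * A powr (- p) / (?F / A)"
        using F0 A by (simp add: powr_divide powr_diff powr_minus_divide)
      finally have R: "?R powr x = ?F powr p * A powr (- p) / (?F / A)" .
      have xq: "x = q * (1 - 1 / p)" by (simp add: x_def algebra_simps)
      show ?thesis
        unfolding R unfolding xq using F0 A q p by (simp add: field_simps)
    qed simp
    also have "ennreal (A powr (- p) / (4 * (1 - 1 / p)) * ?F powr p) = ennreal (A powr (- p) / (4 * (1 - 1 / p))) * ennreal (?F powr p)"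
      using p by (intro ennreal_mult divide_nonneg_nonneg mult_nonneg_nonneg) auto
    finally show "(\<integral>\<^sup>+l. ?L l z \<partial>lborel) \<le> ennreal (A powr (- p) / (4 * (1 - 1 / p))) * ennreal (?F powr p)" .
  qed
  also have "\<dots> = ennreal (A powr (- p) / (4 * (1 - 1 / p))) * (\<integral>\<^sup>+z. ennreal (F z powr p) \<partial>lborel)"
    by (rule nn_integral_cmult) measurable
  finally show ?thesis .
qed

context kinetic_estimate
begin

text \<open>The layer-cake formula for |f|^q, with the level set bound inserted at each positive
  level. Truncation heights varying with the level are what makes the sum over levels
  converge.\<close>

lemma strong_type:
  "(\<integral>\<^sup>+z. ennreal (\<bar>f z\<bar> powr q) \<partial>lborel)
    \<le> ennreal (AG powr (- p) / (4 * (1 - 1 / p)) + AH powr (- \<mu>) / (4 * (1 - 1 / \<mu>)))"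
proof -
  have nG: "(\<integral>\<^sup>+z. ennreal (G z powr p) \<partial>lborel) \<le> 1"
    using G G1 by (subst nn_integral_eq_integral) (auto simp: in_Lp_def)
  have nH: "(\<integral>\<^sup>+z. ennreal (H z powr \<mu>) \<partial>lborel) \<le> 1"
    using H H1 by (subst nn_integral_eq_integral) (auto simp: in_Lp_def)
  let ?TG = "\<lambda>l. ennreal (1 / (4 * (AG * l powr (q / p)))) * (\<integral>\<^sup>+z. ennreal (G z) * indicator {w. AG * l powr (q / p) < G w} z \<partial>lborel)"
  let ?TH = "\<lambda>l. ennreal (1 / (4 * (AH * l powr (q / \<mu>)))) * (\<integral>\<^sup>+z. ennreal (H z) * indicator {w. AH * l powr (q / \<mu>) < H w} z \<partial>lborel)"
  let ?w = "\<lambda>l. ennreal (q * l powr (q - 1)) * indicator {0<..} l"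
  have m: "(\<lambda>l. \<integral>\<^sup>+z. ennreal (F z) * indicator {w. k * l powr x < F w} z \<partial>lborel) \<in> borel_measurable borel"
    if [measurable]: "F \<in> borel_measurable borel" for F :: "'d phase \<Rightarrow> real" and k x
  proof -
    have "(\<lambda>(l, z). ennreal (F z) * (if k * l powr x < F z then 1 else 0)) \<in> borel_measurable (borel \<Otimes>\<^sub>M lborel)"
      unfolding split_beta by measurable
    from lborel.borel_measurable_nn_integral[OF this] show ?thesis
      by (simp add: indicator_def)
  qed
  note [measurable] = m[OF meas(2)] m[OF meas(3)]
  have "(\<integral>\<^sup>+z. ennreal (\<bar>f z\<bar> powr q) \<partial>lborel)
      = (\<integral>\<^sup>+z. \<integral>\<^sup>+l. ?w l * (if l \<le> \<bar>f z\<bar> then 1 else 0) \<partial>lborel \<partial>lborel)"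
  proof (rule nn_integral_cong)
    fix z
    have "ennreal (\<bar>f z\<bar> powr q) = ennreal q * ennreal (\<bar>f z\<bar> powr q / q)"
      using q by (subst ennreal_mult[symmetric]) auto
    also have "\<dots> = (\<integral>\<^sup>+l. ennreal q * (ennreal (l powr (q - 1)) * indicator {0..\<bar>f z\<bar>} l) \<partial>lborel)"
      by (subst nn_integral_cmult) (simp_all add: nn_integral_powr_from_0[OF q])
    also have "\<dots> = (\<integral>\<^sup>+l. ?w l * (if l \<le> \<bar>f z\<bar> then 1 else 0) \<partial>lborel)"
    proof (rule nn_integral_cong)
      fix l :: real
      \<comment> \<open>At \<open>l = 0\<close> the two indicators disagree, but
        \<open>0 powr (q - 1)\<close> is 0.\<close>
      show "ennreal q * (ennreal (l powr (q - 1)) * indicator {0..\<bar>f z\<bar>} l) = ?w l * (if l \<le> \<bar>f z\<bar> then 1 else 0)"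
        using q by (cases "l = 0") (auto simp: indicator_def ennreal_mult)
    qed
    finally show "ennreal (\<bar>f z\<bar> powr q) = (\<integral>\<^sup>+l. ?w l * (if l \<le> \<bar>f z\<bar> then 1 else 0) \<partial>lborel)" .
  qed
  also have "\<dots> = (\<integral>\<^sup>+l. \<integral>\<^sup>+z. ?w l * (if l \<le> \<bar>f z\<bar> then 1 else 0) \<partial>lborel \<partial>lborel)"
    by (rule lborel_pair.Fubini') (unfold split_beta, measurable)
  also have "\<dots> \<le> (\<integral>\<^sup>+l. ?w l * ?TG l + ?w l * ?TH l \<partial>lborel)"
  proof (rule nn_integral_mono)
    fix l :: real
    show "(\<integral>\<^sup>+z. ?w l * (if l \<le> \<bar>f z\<bar> then 1 else 0) \<partial>lborel) \<le> ?w l * ?TG l + ?w l * ?TH l"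
    proof (cases "0 < l")
      case True
      have "(\<integral>\<^sup>+z. ?w l * (if l \<le> \<bar>f z\<bar> then 1 else 0) \<partial>lborel) = (\<integral>\<^sup>+z. ?w l * indicator {z. l \<le> \<bar>f z\<bar>} z \<partial>lborel)"
        by (intro nn_integral_cong) (simp add: indicator_def)
      also have "\<dots> = ?w l * emeasure lborel {z. l \<le> \<bar>f z\<bar>}"
        by (rule nn_integral_cmult_indicator) measurable
      also have "\<dots> \<le> ?w l * (?TG l + ?TH l)"
        by (intro mult_left_mono level_set[OF True]) auto
      finally show ?thesis by (simp only: distrib_left)
    qed simp
  qed
  also have "\<dots> = (\<integral>\<^sup>+l. ?w l * ?TG l \<partial>lborel) + (\<integral>\<^sup>+l. ?w l * ?TH l \<partial>lborel)"
    by (rule nn_integral_add) measurable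
  also have "\<dots> \<le> ennreal (AG powr (- p) / (4 * (1 - 1 / p))) * (\<integral>\<^sup>+z. ennreal (G z powr p) \<partial>lborel)
      + ennreal (AH powr (- \<mu>) / (4 * (1 - 1 / \<mu>))) * (\<integral>\<^sup>+z. ennreal (H z powr \<mu>) \<partial>lborel)"
    by (intro add_mono layer_term meas G1 H1 AGH p \<mu> q)
  also have "\<dots> \<le> ennreal (AG powr (- p) / (4 * (1 - 1 / p))) * 1 + ennreal (AH powr (- \<mu>) / (4 * (1 - 1 / \<mu>))) * 1"
    by (intro add_mono mult_left_mono nG nH) auto
  finally have "(\<integral>\<^sup>+z. ennreal (\<bar>f z\<bar> powr q) \<partial>lborel)
      \<le> ennreal (AG powr (- p) / (4 * (1 - 1 / p))) * 1 + ennreal (AH powr (- \<mu>) / (4 * (1 - 1 / \<mu>))) * 1" .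
  moreover have "0 \<le> AG powr (- p) / (4 * (1 - 1 / p))" "0 \<le> AH powr (- \<mu>) / (4 * (1 - 1 / \<mu>))"
    using p \<mu> by (intro divide_nonneg_nonneg mult_nonneg_nonneg powr_ge_zero; simp)+
  ultimately show ?thesis
    by (simp only: ennreal_plus mult_1_right)
qed

end

section \<open>The main inequality\<close>

lemma weak_grad_v_cmult:
  assumes "weak_grad_v f g"
  shows "weak_grad_v (\<lambda>z. c * f z) (\<lambda>z. c *\<^sub>R g z)"
  using assms unfolding weak_grad_v_def by (simp add: mult.assoc)

lemma kinetic_eq_cmult:
  assumes "kinetic_eq f S"
  shows "kinetic_eq (\<lambda>z. c * f z) (\<lambda>z. c *\<^sub>R S z)"
  unfolding kinetic_eq_def
proof (intro allI impI)
  fix \<phi> :: "'a phase \<Rightarrow> real" assume \<phi>: "test_fun \<phi>"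
  have "frechet_derivative \<phi> (at z) (0, 0, c *\<^sub>R S z) = c * frechet_derivative \<phi> (at z) (0, 0, S z)" for z
    using frechet_scale[OF \<phi>, of z c "(0, 0, S z)"] by simp
  then show "(\<integral>z. c * f z * frechet_derivative \<phi> (at z) (1, snd (snd z), 0) \<partial>lborel)
      = (\<integral>z. frechet_derivative \<phi> (at z) (0, 0, c *\<^sub>R S z) \<partial>lborel)"
    using assms \<phi> unfolding kinetic_eq_def by (simp add: mult.assoc)
qed

lemma in_Lp_cmult:
  assumes "in_Lp r f"
  shows "in_Lp r (\<lambda>z. c *\<^sub>R f z)"
    and "(\<integral>z. norm (c *\<^sub>R f z) powr r \<partial>lborel) = \<bar>c\<bar> powr r * (\<integral>z. norm (f z) powr r \<partial>lborel)"
  using assms by (auto simp: in_Lp_def powr_mult)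

lemma in_Lp_norm: "in_Lp r f \<Longrightarrow> in_Lp r (\<lambda>z. norm (f z))"
  by (auto simp: in_Lp_def)

text \<open>The factors \<open>b0\<close> and \<open>a0 / b0\<close> are attached to the data, so
  that the constant \<open>K'\<close> is the same for all admissible \<open>a0\<close>,
  \<open>b0\<close>. Dividing the scales by \<open>s\<close> leaves the powers \<beta> - 1 and
  \<kappa> - 1.\<close>

lemma kmean_diff_le:
  fixes f :: "'d::finite phase \<Rightarrow> real"
  assumes f: "in_Lp 2 f" and g: "in_Lp p g" and S: "in_Lp \<mu> S" and p: "1 \<le> p" "1 \<le> \<mu>"
    and wg: "weak_grad_v f g" and kin: "kinetic_eq f S" and a0: "0 < a0" and b0: "0 < b0"
    and e: "0 < \<epsilon>" "\<epsilon> \<le> r"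
    and hom: "(real CARD('d) + 1) * (\<beta> + \<kappa>) + 2 * real CARD('d) * \<beta> = 1"
    and vol: "a0 ^ (CARD('d) + 1) * b0 ^ (2 * CARD('d)) = 1"
    and K: "0 \<le> K" "\<And>e \<zeta>. e \<in> Basis \<Longrightarrow> \<bar>kA (\<beta> + \<kappa>) \<beta> e \<zeta>\<bar> \<le> K * indicator (cball 0 1) (\<zeta> :: 'd::finite phase)"
    "\<And>e \<zeta>. \<bar>frechet_derivative (kB (\<beta> + \<kappa>) \<beta>) (at \<zeta>) (0, 0, e)\<bar> \<le> K * norm e * indicator (cball 0 1) (\<zeta> :: 'd phase)"
    and K': "K * real CARD('d) \<le> K'" "K \<le> K'"
  defines "a \<equiv> \<lambda>s. a0 * s powr (\<beta> + \<kappa>)" and "b \<equiv> \<lambda>s. b0 * s powr \<beta>"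
  shows "ennreal \<bar>kmean (a r) (b r) f z - kmean (a \<epsilon>) (b \<epsilon>) f z\<bar>
    \<le> (\<integral>\<^sup>+s. (ennreal (K' * s powr (\<beta> - 1)) * kavg (a s) (b s) (\<lambda>z. ennreal (b0 * norm (g z))) z
      + ennreal (K' * s powr (\<kappa> - 1)) * kavg (a s) (b s) (\<lambda>z. ennreal (a0 / b0 * norm (S z))) z) * indicator {\<epsilon>..r} s \<partial>lborel)"
proof -
  have [measurable]: "g \<in> borel_measurable borel" "S \<in> borel_measurable borel"
    using g S by (auto simp: in_Lp_def)
  have K0: "0 \<le> K'" using K(1) K'(2) by simp
  have kav: "kavg (a s) (b s) (\<lambda>z. ennreal (c * norm (F z))) z = ennreal c * kavg (a s) (b s) (\<lambda>z. ennreal (norm (F z))) z"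
    if [measurable]: "F \<in> borel_measurable borel" and "0 \<le> c" for c s and F :: "'d phase \<Rightarrow> real ^ 'd"
  proof -
    have "kavg (a s) (b s) (\<lambda>z. ennreal (c * norm (F z))) z
        = (\<integral>\<^sup>+\<zeta>. ennreal c * (ennreal (norm (F (kmap (a s) (b s) z \<zeta>))) * indicator (cball 0 1) \<zeta>) \<partial>lborel)"
      unfolding kavg_def using that(2) by (simp add: ennreal_mult mult.assoc)
    also have "\<dots> = ennreal c * kavg (a s) (b s) (\<lambda>z. ennreal (norm (F z))) z"
      unfolding kavg_def
      by (intro nn_integral_cmult borel_measurable_times borel_measurable_indicator) measurable
    finally show ?thesis .
  qed
  have "ennreal \<bar>kmean (a r) (b r) f z - kmean (a \<epsilon>) (b \<epsilon>) f z\<bar>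
      \<le> (\<integral>\<^sup>+s. ennreal \<bar>indicator {\<epsilon>..r} s * ((\<integral>\<zeta>. f (kmap (a s) (b s) z \<zeta>) * kL (\<beta> + \<kappa>) \<beta> \<zeta> \<partial>lborel) / s)\<bar> \<partial>lborel)"
    unfolding a_def b_def kmean_diff[OF f a0 b0 e hom vol] by (rule ennreal_abs_integral_le)
  also have "\<dots> \<le> (\<integral>\<^sup>+s. (ennreal (K' * s powr (\<beta> - 1)) * kavg (a s) (b s) (\<lambda>z. ennreal (b0 * norm (g z))) z
      + ennreal (K' * s powr (\<kappa> - 1)) * kavg (a s) (b s) (\<lambda>z. ennreal (a0 / b0 * norm (S z))) z) * indicator {\<epsilon>..r} s \<partial>lborel)"
  proof (rule nn_integral_mono)
    fix s
    let ?I = "\<integral>\<zeta>. f (kmap (a s) (b s) z \<zeta>) * kL (\<beta> + \<kappa>) \<beta> \<zeta> \<partial>lborel"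
    let ?g = "kavg (a s) (b s) (\<lambda>z. ennreal (norm (g z))) z" and ?S = "kavg (a s) (b s) (\<lambda>z. ennreal (norm (S z))) z"
    show "ennreal \<bar>indicator {\<epsilon>..r} s * (?I / s)\<bar>
      \<le> (ennreal (K' * s powr (\<beta> - 1)) * kavg (a s) (b s) (\<lambda>z. ennreal (b0 * norm (g z))) z
      + ennreal (K' * s powr (\<kappa> - 1)) * kavg (a s) (b s) (\<lambda>z. ennreal (a0 / b0 * norm (S z))) z) * indicator {\<epsilon>..r} s"
    proof (cases "s \<in> {\<epsilon>..r}")
      case True
      then have s: "0 < s" using e by auto
      have ab: "0 < a s" "0 < b s" using a0 b0 s by (auto simp: a_def b_def)
      have "ennreal \<bar>indicator {\<epsilon>..r} s * (?I / s)\<bar> = ennreal (1 / s) * ennreal \<bar>?I\<bar>"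
        using True s by (simp add: ennreal_mult[symmetric])
      also have "\<dots> \<le> ennreal (1 / s) * (ennreal (K * real CARD('d) * b s) * ?g + ennreal (K * (a s / b s)) * ?S)"
        by (intro mult_left_mono kL_pairing_le[OF f g S p wg kin ab hom K(2,3)]) auto
      also have "\<dots> = ennreal (1 / s) * ennreal (K * real CARD('d) * b s) * ?g + ennreal (1 / s) * ennreal (K * (a s / b s)) * ?S"
        by (simp add: distrib_left mult.assoc)
      also have "\<dots> \<le> (ennreal (K' * s powr (\<beta> - 1)) * ennreal b0) * ?g + (ennreal (K' * s powr (\<kappa> - 1)) * ennreal (a0 / b0)) * ?S"
      proof (intro add_mono mult_right_mono)
        have "1 / s * (K * real CARD('d) * b s) = (K * real CARD('d)) * (s powr (\<beta> - 1) * b0)"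
          using s by (simp add: b_def powr_diff)
        also have "\<dots> \<le> K' * (s powr (\<beta> - 1) * b0)"
          using K'(1) b0 by (intro mult_right_mono) auto
        finally show "ennreal (1 / s) * ennreal (K * real CARD('d) * b s) \<le> ennreal (K' * s powr (\<beta> - 1)) * ennreal b0"
          using s K(1) K0 ab b0 by (simp add: ennreal_mult[symmetric] mult.assoc)
        have "1 / s * (K * (a s / b s)) = K * (s powr (\<kappa> - 1) * (a0 / b0))"
          using s b0 by (simp add: a_def b_def powr_diff powr_add field_simps)
        also have "\<dots> \<le> K' * (s powr (\<kappa> - 1) * (a0 / b0))"
          using K'(2) a0 b0 by (intro mult_right_mono) auto
        finally show "ennreal (1 / s) * ennreal (K * (a s / b s)) \<le> ennreal (K' * s powr (\<kappa> - 1)) * ennreal (a0 / b0)"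
          using s K(1) K0 ab a0 b0 by (simp add: ennreal_mult[symmetric] mult.assoc)
      qed auto
      also have "\<dots> = ennreal (K' * s powr (\<beta> - 1)) * kavg (a s) (b s) (\<lambda>z. ennreal (b0 * norm (g z))) z
          + ennreal (K' * s powr (\<kappa> - 1)) * kavg (a s) (b s) (\<lambda>z. ennreal (a0 / b0 * norm (S z))) z"
      proof -
        have "0 \<le> b0" "0 \<le> a0 / b0" using a0 b0 by auto
        then show ?thesis using \<open>g \<in> borel_measurable borel\<close> \<open>S \<in> borel_measurable borel\<close>
          by (simp only: kav mult.assoc)
      qed
      finally show ?thesis
        using True by simp
    qed simp
  qed
  finally show ?thesis .
qed

text \<open>The constant is chosen before \<open>f\<close>, the data and the pair \<open>a0\<close>,
  \<open>b0\<close>; this uniformity is what the later optimisation over the dilations relies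
  on.\<close>

lemma normalized_bound:
  fixes p \<mu> q :: real
  assumes p: "1 < p" and \<mu>: "1 < \<mu>" and q: "0 < q" "p < q" "\<mu> < q"
    and hom: "(3 * real CARD('d::finite) + 1) / p + (real CARD('d) + 1) / \<mu> - (4 * real CARD('d) + 2) / q = 1"
  obtains C where "0 \<le> C"
    and "\<And>(f :: 'd phase \<Rightarrow> real) g S a0 b0. \<lbrakk>in_Lp 2 f; in_Lp p g; in_Lp \<mu> S; weak_grad_v f g; kinetic_eq f S; 0 < a0; 0 < b0;
      a0 ^ (CARD('d) + 1) * b0 ^ (2 * CARD('d)) = 1;
      (\<integral>z. norm (b0 *\<^sub>R g z) powr p \<partial>lborel) \<le> 1; (\<integral>z. norm ((a0 / b0) *\<^sub>R S z) powr \<mu> \<partial>lborel) \<le> 1\<rbrakk>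
      \<Longrightarrow> (\<integral>\<^sup>+z. ennreal (\<bar>f z\<bar> powr q) \<partial>lborel) \<le> ennreal C"
proof -
  define \<beta> \<kappa> where "\<beta> = 1 / p - 1 / q" and "\<kappa> = 1 / \<mu> - 1 / q"
  have \<beta>: "0 < \<beta>" using p q by (simp add: \<beta>_def frac_less2)
  have \<kappa>: "0 < \<kappa>" using \<mu> q by (simp add: \<kappa>_def frac_less2)
  have "(D + 1) * ((x - y) + (w - y)) + 2 * D * (x - y) = (3 * D + 1) * x + (D + 1) * w - (4 * D + 2) * y"
    for D x y w :: real by (simp add: algebra_simps)
  then have "(real CARD('d) + 1) * (\<beta> + \<kappa>) + 2 * real CARD('d) * \<beta>
      = (3 * real CARD('d) + 1) * (1 / p) + (real CARD('d) + 1) * (1 / \<mu>) - (4 * real CARD('d) + 2) * (1 / q)"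
    unfolding \<beta>_def \<kappa>_def by blast
  then have hom': "(real CARD('d) + 1) * (\<beta> + \<kappa>) + 2 * real CARD('d) * \<beta> = 1"
    using hom by simp
  obtain K where K: "0 \<le> K" "\<And>e \<zeta>. e \<in> Basis \<Longrightarrow> \<bar>kA (\<beta> + \<kappa>) \<beta> e \<zeta>\<bar> \<le> K * indicator (cball 0 1) (\<zeta> :: 'd phase)"
    "\<And>e \<zeta>. \<bar>frechet_derivative (kB (\<beta> + \<kappa>) \<beta>) (at \<zeta>) (0, 0, e)\<bar> \<le> K * norm e * indicator (cball 0 1) (\<zeta> :: 'd phase)"
    using kernel_bounds[of "\<beta> + \<kappa>" \<beta>] by metis
  define K' where "K' = K * real CARD('d) + 1"
  have d1: "1 \<le> real CARD('d)" by (simp add: Suc_leI)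
  have "K * 1 \<le> K * real CARD('d)" using d1 K(1) by (rule mult_left_mono)
  then have K': "K * real CARD('d) \<le> K'" "K \<le> K'" "0 < K'" using K(1) by (auto simp: K'_def)
  \<comment> \<open>These locale constants depend on the dimension, q, the exponents and
    \<open>K'\<close> only, so they can be named ahead of the interpretation.\<close>
  let ?AG = "kinetic_estimate.AG TYPE('d) q \<beta> K'" and ?AH = "kinetic_estimate.AH TYPE('d) q \<kappa> K'"
  let ?C = "?AG powr (- p) / (4 * (1 - 1 / p)) + ?AH powr (- \<mu>) / (4 * (1 - 1 / \<mu>))"
  show ?thesis
  proof (rule that[of ?C])
    have "1 / p \<le> 1" "1 / \<mu> \<le> 1" using p \<mu> by auto
    then show "0 \<le> ?C" by (intro add_nonneg_nonneg divide_nonneg_nonneg) auto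
    fix f :: "'d phase \<Rightarrow> real" and g S a0 b0
    assume f: "in_Lp 2 f" and g: "in_Lp p g" and S: "in_Lp \<mu> S" and wg: "weak_grad_v f g" and kin: "kinetic_eq f S"
      and a0: "0 < a0" and b0: "0 < b0" and vol: "a0 ^ (CARD('d) + 1) * b0 ^ (2 * CARD('d)) = 1"
      and ng: "(\<integral>z. norm (b0 *\<^sub>R g z) powr p \<partial>lborel) \<le> 1" and nS: "(\<integral>z. norm ((a0 / b0) *\<^sub>R S z) powr \<mu> \<partial>lborel) \<le> 1"
    interpret kinetic_estimate f "\<lambda>z. b0 * norm (g z)" "\<lambda>z. a0 / b0 * norm (S z)" p \<mu> q \<beta> \<kappa> a0 b0 K'
    proof
      show "in_Lp p (\<lambda>z. b0 * norm (g z))"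
        using in_Lp_cmult(1)[OF in_Lp_norm[OF g], of b0] by simp
      show "in_Lp \<mu> (\<lambda>z. a0 / b0 * norm (S z))"
        using in_Lp_cmult(1)[OF in_Lp_norm[OF S], of "a0 / b0"] by simp
      show "(\<integral>z. norm (b0 * norm (g z)) powr p \<partial>lborel) \<le> 1"
        using ng by (simp add: abs_mult)
      show "(\<integral>z. norm (a0 / b0 * norm (S z)) powr \<mu> \<partial>lborel) \<le> 1"
        using nS by (simp add: abs_mult)
      show "ennreal \<bar>kmean (a0 * r powr (\<beta> + \<kappa>)) (b0 * r powr \<beta>) f z - kmean (a0 * \<epsilon> powr (\<beta> + \<kappa>)) (b0 * \<epsilon> powr \<beta>) f z\<bar>
        \<le> (\<integral>\<^sup>+s. (ennreal (K' * s powr (\<beta> - 1)) * kavg (a0 * s powr (\<beta> + \<kappa>)) (b0 * s powr \<beta>) (\<lambda>z. ennreal (b0 * norm (g z))) z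
        + ennreal (K' * s powr (\<kappa> - 1)) * kavg (a0 * s powr (\<beta> + \<kappa>)) (b0 * s powr \<beta>) (\<lambda>z. ennreal (a0 / b0 * norm (S z))) z)
          * indicator {\<epsilon>..r} s \<partial>lborel)" if "0 < \<epsilon>" "\<epsilon> \<le> r" for z \<epsilon> r
        by (rule kmean_diff_le[OF f g S _ _ wg kin a0 b0 that hom' vol K K'(1,2)]) (use p \<mu> in auto)
    qed (use f p \<mu> q \<beta> \<kappa> a0 b0 K' hom' vol in \<open>auto simp: \<beta>_def \<kappa>_def\<close>)
    show "(\<integral>\<^sup>+z. ennreal (\<bar>f z\<bar> powr q) \<partial>lborel) \<le> ennreal ?C"
      by (rule strong_type)
  qed
qed

lemma Lp_norm_powr: "0 < r \<Longrightarrow> Lp_norm r f powr r = (\<integral>z. norm (f z) powr r \<partial>lborel)"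
  by (simp add: Lp_norm_def powr_powr)

theorem theorem1p2:
  fixes p \<mu> :: real
  assumes "p > 1" and "\<mu> > 1"
    and "1 / ((1 / (4 * real CARD('d) + 2)) * ((3 * real CARD('d) + 1) / p
            + (real CARD('d) + 1) / \<mu> - 1)) > max 2 (max p \<mu>)"
  shows "\<exists>C > 0. \<forall>(f :: 'd phase \<Rightarrow> real) (g :: 'd phase \<Rightarrow> real ^ 'd) (S\<^sub>0 :: 'd phase \<Rightarrow> real ^ 'd).
    in_Lp 2 f \<and> weak_grad_v f g \<and> in_Lp p g \<and> in_Lp \<mu> S\<^sub>0 \<and> kinetic_eq f S\<^sub>0 \<longrightarrow>
    (let q = 1 / ((1 / (4 * real CARD('d) + 2)) * ((3 * real CARD('d) + 1) / p
            + (real CARD('d) + 1) / \<mu> - 1))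
     in in_Lp q f \<and>
        Lp_norm q f \<le> C * Lp_norm p g powr ((3 * real CARD('d) + 1) / (4 * real CARD('d) + 2))
                        * Lp_norm \<mu> S\<^sub>0 powr ((real CARD('d) + 1) / (4 * real CARD('d) + 2)))"
proof -
  let ?d = "CARD('d)"
  let ?n = "4 * real ?d + 2"
  define q where "q = 1 / ((1 / ?n) * ((3 * real ?d + 1) / p + (real ?d + 1) / \<mu> - 1))"
  define \<theta> \<eta> where "\<theta> = (3 * real ?d + 1) / ?n" and "\<eta> = (real ?d + 1) / ?n"
  have q: "0 < q" "p < q" "\<mu> < q" using assms(3) unfolding q_def[symmetric] by auto
  have n: "0 < ?n" by simp
  have \<theta>: "0 < \<theta>" "0 < \<eta>" "1 - \<eta> = \<theta>" "1 - \<theta> = \<eta>" by (auto simp: \<theta>_def \<eta>_def field_simps)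
  have "1 / q = (1 / ?n) * ((3 * real ?d + 1) / p + (real ?d + 1) / \<mu> - 1)" by (simp add: q_def)
  then have "?n * (1 / q) = (3 * real ?d + 1) / p + (real ?d + 1) / \<mu> - 1" using n by simp
  then have hom: "(3 * real ?d + 1) / p + (real ?d + 1) / \<mu> - ?n / q = 1" by simp
  obtain C where C: "0 \<le> C"
    and bound: "\<And>(f :: 'd phase \<Rightarrow> real) g S a0 b0. \<lbrakk>in_Lp 2 f; in_Lp p g; in_Lp \<mu> S; weak_grad_v f g; kinetic_eq f S; 0 < a0; 0 < b0;
      a0 ^ (?d + 1) * b0 ^ (2 * ?d) = 1;
      (\<integral>z. norm (b0 *\<^sub>R g z) powr p \<partial>lborel) \<le> 1; (\<integral>z. norm ((a0 / b0) *\<^sub>R S z) powr \<mu> \<partial>lborel) \<le> 1\<rbrakk>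
      \<Longrightarrow> (\<integral>\<^sup>+z. ennreal (\<bar>f z\<bar> powr q) \<partial>lborel) \<le> ennreal C"
    using normalized_bound[OF assms(1,2) q hom] by metis
  \<comment> \<open>The summand 1 keeps the constant positive even if \<open>C\<close> is 0.\<close>
  define D where "D = C powr (1 / q) + 1"
  have D: "0 < D" by (simp add: D_def add_nonneg_pos)
  have main: "in_Lp q f \<and> Lp_norm q f \<le> D * Lp_norm p g powr \<theta> * Lp_norm \<mu> S powr \<eta>"
    if f: "in_Lp 2 f" and wg: "weak_grad_v f g" and g: "in_Lp p g" and S: "in_Lp \<mu> S" and kin: "kinetic_eq f S"
    for f :: "'d phase \<Rightarrow> real" and g S :: "'d phase \<Rightarrow> real ^ 'd"
  proof -
    let ?A = "Lp_norm p g" and ?B = "Lp_norm \<mu> S"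
    have AB: "0 \<le> ?A" "0 \<le> ?B" by (simp_all add: Lp_norm_def)
    have [measurable]: "f \<in> borel_measurable borel" using f by (simp add: in_Lp_def)
    \<comment> \<open>Either norm may vanish, which would make the optimal dilation degenerate;
      enlarging both by \<open>e\<close> avoids this, and \<open>e\<close> tends to 0 at the
      end.\<close>
    have est: "in_Lp q f \<and> Lp_norm q f \<le> D * ((?A + e) powr \<theta> * (?B + e) powr \<eta>)" if e: "0 < e" for e
    proof -
      define A B where "A = ?A + e" and "B = ?B + e"
      have A: "0 < A" "0 < B" using AB e by (auto simp: A_def B_def)
      define M where "M = A powr \<theta> * B powr \<eta>"
      have M: "0 < M" using A by (simp add: M_def)
      \<comment> \<open>The powers m^(2d) and m^(-(d+1)) parametrise the dilations of unit volume.
        Requiring b0 A = (a0/b0) B means a0 / b0^2 = A/B, that is m^(4d+2) = A/B; the common value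
        is then \<open>M\<close>.\<close>
      define m where "m = (A / B) powr (1 / ?n)"
      have m: "0 < m" using A by (simp add: m_def)
      define a0 where "a0 = m powr (2 * real ?d)"
      define b0 where "b0 = m powr (- (real ?d + 1))"
      have ab: "0 < a0" "0 < b0" using m by (auto simp: a0_def b0_def)
      have "a0 ^ (?d + 1) * b0 ^ (2 * ?d) = m powr (2 * real ?d * real (?d + 1)) * m powr (- (real ?d + 1) * real (2 * ?d))"
        using m unfolding a0_def b0_def by (subst (1 2) powr_power) (simp_all add: mult_ac)
      also have "\<dots> = 1"
        unfolding powr_add[symmetric] using m by (simp add: algebra_simps)
      finally have vol: "a0 ^ (?d + 1) * b0 ^ (2 * ?d) = 1" .
      have mp: "m powr x = A powr (x / ?n) / B powr (x / ?n)" for x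
        unfolding m_def powr_powr by (simp add: powr_divide)
      have b0M: "b0 * A = M"
      proof -
        have "b0 = B powr \<eta> / A powr \<eta>"
        proof -
          have "- (real ?d + 1) / ?n = - \<eta>" unfolding \<eta>_def by (rule minus_divide_left[symmetric])
          then show ?thesis unfolding b0_def mp by (simp add: powr_minus_divide)
        qed
        moreover have "A powr \<theta> = A / A powr \<eta>"
          using A \<theta>(3) powr_diff[of A 1 \<eta>] by simp
        ultimately show ?thesis by (simp add: M_def)
      qed
      have abM: "a0 / b0 * B = M"
      proof -
        have "a0 / b0 = m powr (3 * real ?d + 1)"
          unfolding a0_def b0_def powr_diff[symmetric] by (simp add: algebra_simps)
        then have "a0 / b0 = A powr \<theta> / B powr \<theta>"
          unfolding mp by (simp add: \<theta>_def)
        moreover have "B powr \<eta> = B / B powr \<theta>"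
          using A \<theta>(4) powr_diff[of B 1 \<theta>] by simp
        ultimately show ?thesis by (simp add: M_def)
      qed
      \<comment> \<open>All relations are linear in \<open>f\<close> and the data, so after division
        by \<open>M\<close> both weighted data have norm at most one and the normalised bound
        applies.\<close>
      have unit: "(\<integral>z. norm (k *\<^sub>R (1 / M) *\<^sub>R F z) powr r \<partial>lborel) \<le> 1"
        if "in_Lp r F" "0 < k" "1 < r" "k * Lp_norm r F \<le> M" for k r and F :: "'d phase \<Rightarrow> real ^ 'd"
      proof -
        have "(\<integral>z. norm (k *\<^sub>R (1 / M) *\<^sub>R F z) powr r \<partial>lborel) = \<bar>k / M\<bar> powr r * (\<integral>z. norm (F z) powr r \<partial>lborel)"
          using in_Lp_cmult(2)[OF that(1), of "k / M"] by simp
        also have "\<dots> = \<bar>k / M\<bar> powr r * Lp_norm r F powr r"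
          using that(3) by (simp add: Lp_norm_powr)
        also have "\<dots> = (\<bar>k / M\<bar> * Lp_norm r F) powr r"
          by (rule powr_mult[symmetric])
        also have "\<dots> \<le> 1 powr r"
          using that M by (intro powr_mono2) (auto simp: Lp_norm_def field_simps)
        finally show ?thesis by simp
      qed
      have "b0 * ?A \<le> b0 * A" "a0 / b0 * ?B \<le> a0 / b0 * B"
        using ab e by (intro mult_left_mono; simp add: A_def B_def)+
      then have le: "b0 * ?A \<le> M" "a0 / b0 * ?B \<le> M" using b0M abM by auto
      have fin: "(\<integral>\<^sup>+z. ennreal (\<bar>1 / M * f z\<bar> powr q) \<partial>lborel) \<le> ennreal C"
      proof (rule bound[of _ "\<lambda>z. (1 / M) *\<^sub>R g z" "\<lambda>z. (1 / M) *\<^sub>R S z" a0 b0])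
        show "in_Lp 2 (\<lambda>z. 1 / M * f z)" using in_Lp_cmult(1)[OF f, of "1 / M"] by simp
        show "(\<integral>z. norm (b0 *\<^sub>R (1 / M) *\<^sub>R g z) powr p \<partial>lborel) \<le> 1"
          by (rule unit) (use g ab assms(1) le in auto)
        show "(\<integral>z. norm ((a0 / b0) *\<^sub>R (1 / M) *\<^sub>R S z) powr \<mu> \<partial>lborel) \<le> 1"
          by (rule unit) (use S ab assms(2) le in auto)
      qed (intro in_Lp_cmult g S weak_grad_v_cmult wg kinetic_eq_cmult kin ab vol)+
      have i: "integrable lborel (\<lambda>z. \<bar>1 / M * f z\<bar> powr q)"
      proof (rule integrableI_bounded)
        show "(\<integral>\<^sup>+z. ennreal (norm (\<bar>1 / M * f z\<bar> powr q)) \<partial>lborel) < \<infinity>"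
          using order.strict_trans1[OF fin, of \<infinity>] by simp
      qed simp
      have le1: "(\<integral>z. \<bar>1 / M * f z\<bar> powr q \<partial>lborel) \<le> C"
        using fin C by (subst (asm) nn_integral_eq_integral[OF i]) auto
      have eq: "norm (f z) powr q = M powr q * \<bar>1 / M * f z\<bar> powr q" for z
        using M by (simp add: powr_mult[symmetric] abs_mult)
      have in_q: "in_Lp q f"
        unfolding in_Lp_def eq using i by simp
      have "Lp_norm q f = (M powr q * (\<integral>z. \<bar>1 / M * f z\<bar> powr q \<partial>lborel)) powr (1 / q)"
        unfolding Lp_norm_def eq by simp
      also have "\<dots> \<le> (M powr q * C) powr (1 / q)"
        using le1 q by (intro powr_mono2 mult_left_mono mult_nonneg_nonneg) auto
      also have "\<dots> = M * C powr (1 / q)"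
        using M C q by (simp add: powr_mult powr_powr)
      also have "\<dots> \<le> M * D"
        using M by (intro mult_left_mono) (auto simp: D_def)
      finally show ?thesis
        using in_q by (simp add: M_def A_def B_def mult_ac)
    qed
    \<comment> \<open>Continuity of powers up to base 0, from the right and for positive exponents;
      it covers the case of a vanishing norm.\<close>
    have tp: "((\<lambda>e. (X + e) powr t) \<longlongrightarrow> (X + 0) powr t) (at_right 0)" if "0 \<le> X" "0 < t" for X t :: real
    proof (rule tendsto_powr')
      show "((\<lambda>e. X + e) \<longlongrightarrow> X + 0) (at_right 0)" by (intro tendsto_intros)
      show "X + 0 \<noteq> 0 \<or> 0 < t \<and> (\<forall>\<^sub>F e in at_right 0. 0 \<le> X + e)"
        using that eventually_at_right_less[of "0::real"] by (auto elim!: eventually_mono)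
    qed simp
    have "((\<lambda>e. D * ((?A + e) powr \<theta> * (?B + e) powr \<eta>)) \<longlongrightarrow> D * ((?A + 0) powr \<theta> * (?B + 0) powr \<eta>)) (at_right 0)"
      by (intro tendsto_mult tendsto_const tp AB \<theta>)
    moreover have "eventually (\<lambda>e. Lp_norm q f \<le> D * ((?A + e) powr \<theta> * (?B + e) powr \<eta>)) (at_right 0)"
      using eventually_at_right_less[of 0] by eventually_elim (use est in blast)
    ultimately have "Lp_norm q f \<le> D * ((?A + 0) powr \<theta> * (?B + 0) powr \<eta>)"
      by (rule tendsto_lowerbound) simp
    then show ?thesis
      using est[of 1] by (simp add: mult.assoc)
  qed
  show ?thesis
    unfolding q_def[symmetric] \<theta>_def[symmetric] \<eta>_def[symmetric] Let_def
    using D main by blast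
qed

end
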